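(* Let $\beta\in k^\times$, $X^*=\beta\cdot\sqrt\varpi\in\mathfrak t_\varpi^*$, and let $s,\theta'\in k^\times$, $Y=s\cdot\sqrt{\theta'}\in\mathfrak t_{\theta'}$. If $\operatorname{depth}(X^* )+\operatorname{depth}(Y)=0$, and $\widetilde Y$ is a stable conjugate of $Y$ that lies in a torus with $X^*$ (i.e. $\widetilde Y\in\mathfrak t_\varpi$), then $$M^G_{X^*}(Y)=\tfrac12\,q^{-(h+1)}|D_{\mathfrak g}(Y)|^{-1/2}\Bigl(\gamma_\Phi(X^*,Y)\sum_{\sigma\in W(\mathbf G,\mathbf T_\varpi)}\Phi(\langle\mathrm{Ad}^*(\sigma)X^*,\widetilde Y\rangle)+q^{-1/2}\sum_{\substack{Z\in(\mathfrak t_\varpi)_{r:r+}\\ Z\ne\pm\widetilde Y}}\Phi(\langle X^*,Z\rangle)\operatorname{sgn}_\varpi(Y^2-Z^2)\Bigr),$$ where the scalar matrices $Y^2$ and $Z^2$ are identified with elements of $k$ in the natural way.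
   Context: $k$ is a non-discrete non-Archimedean local field of residual characteristic $\ne 2$, with ring of integers $\mathcal O$, maximal ideal $\mathfrak p$, valuation $\operatorname{ord}$ with value group $\mathbb Z$, residue field of order $q$, $|x|=q^{-\operatorname{ord}(x)}$; $\varpi$ is a uniformiser. $dx$ (or $dt$) is the Haar measure on $k$ giving $\mathcal O$ measure $1$, and $d^\times x=|x|^{-1}dx$. $\Phi$ is a non-trivial additive character of $k$; $\Phi_b(x)=\Phi(bx)$; the depth of a non-trivial additive character $\Psi$ is $\min\{i\in\mathbb Z:\Psi$ trivial on $\mathfrak p^{i+1}\}$. $k_\varpi=k(\sqrt\varpi)$, $N_\varpi(a+b\sqrt\varpi)=a^2-b^2\varpi$, and $\operatorname{sgn}_\varpi$ is the quadratic character of $k^\times$ with kernel $N_\varpi(k_\varpi^\times)$. $\mathbf G=\mathrm{SL}_2$, $\mathfrak g=\mathfrak{sl}_2(k)$ with dual $\mathfrak g^*$ and pairing $\langle\cdot,\cdot\rangle$. For $\theta\in k^\times$, $\mathbf T_\theta=\{\begin{pmatrix}a&b\\ b\theta&a\end{pmatrix}:a^2-b^2\theta=1\}$, with Lie algebra $\mathfrak t_\theta=k\cdot\sqrt\theta$, where here $\sqrt\theta$ denotes the matrix $\begin{pmatrix}0&1\\ \theta&0\end{pmatrix}$. $X^*=\beta\sqrt\varpi$ means the functional $Z\mapsto\mathrm{Tr}(\beta\sqrt\varpi Z)$ on $\mathfrak g$. Two regular semisimple elements $Y,\widetilde Y\in\mathfrak g$ are stably conjugate if $\widetilde Y=\mathrm{Ad}(g)Y$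 for some $g\in\mathrm{SL}_2(E)$ and some field extension $E/k$ (equivalently, $Y^2=\widetilde Y^2$); the existence of $\widetilde Y\in\mathfrak t_\varpi$ forces $\theta'\in\varpi(k^\times)^2$. $W(\mathbf G,\mathbf T_\varpi)=N_{\mathbf G}(\mathbf T_\varpi)/\mathbf T_\varpi$ is the absolute Weyl group, of order $2$, whose non-trivial element sends $X^*$ to $-X^*$. $D_{\mathfrak g}\begin{pmatrix}a&b\\c&-a\end{pmatrix}=4(a^2+bc)$. Depth: $\operatorname{depth}(c\sqrt\theta)=\tfrac12\operatorname{ord}(c^2\theta)$ for $c\sqrt\theta\in\mathfrak t_\theta$; $\operatorname{depth}(X^* )$ is the largest real $\rho$ such that $\Phi(\langle X^*,Z\rangle)=1$ for all $Z\in\mathfrak t_\varpi$ with $\operatorname{depth}(Z)>-\rho$. Put $r=-\operatorname{depth}(X^* )$, $\Phi'=\Phi_\beta$ and $h=r+\tfrac12=\operatorname{depth}(\Phi')\in\mathbb Z$. $(\mathfrak t_\varpi)_{r:r+}$ is the quotient of $\{Z\in\mathfrak t_\varpi:\operatorname{depth}(Z)\ge r\}$ by $\{Z\in\mathfrak t_\varpi:\operatorname{depth}(Z)>r\}$ (with $\operatorname{depth}(0)=\infty$); the condition $Z\ne\pm\widetilde Y$ is understood in this quotient, and the summand depends only on the class of $Z$. For $\theta'\in\varpi(k^\times)^2$, $\gamma_\Phi(X^*,Y)=\operatorname{sgn}_\varpi(-s)\,G_\varpi(\Phi')$, where $G_\varpi(\Psi)=q^{-1/2}\sum_{X\in\mathcal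 O/\mathfrak p}\Psi((-\varpi)^{\operatorname{depth}(\Psi)}X^2)$. Mock Fourier transform: $$M^G_{X^*}(Y)=\sum_{n\in\mathbb Z}\int_{\operatorname{ord}(x)=n}\mathbf 1_{N_\varpi(k_\varpi^\times)}(x)\Bigl(\sum_{l\in\mathbb Z}\int_{\operatorname{ord}(t)=l}\Phi\bigl(\beta s(x\theta'+x^{-1}\varpi-x^{-1}t^2)\bigr)\,dt\Bigr)d^\times x,$$ where $\mathbf 1_S$ is the characteristic function of $S$. *)

theory Defs
  imports
    "HOL-Analysis.Analysis"
    "HOL-Algebra.Group_Action"
    "HOL-Algebra.Algebraic_Closure_Type"
begin

text \<open>
  A valuation is a function \<open>ord\<close> into the integers whose value at \<open>0\<close> is irrelevant: every
  definition below treats \<open>0\<close> separately, so that \<open>0\<close> behaves as an element of infinite order.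
\<close>

text \<open>The fractional ideal \<open>p^n\<close>; \<open>n = 0\<close> gives the ring of integers, \<open>n = 1\<close> its maximal ideal.\<close>

definition prime_pow :: "('a::field \<Rightarrow> int) \<Rightarrow> int \<Rightarrow> 'a set" where
  "prime_pow ord n = {x. x = 0 \<or> ord x \<ge> n}"

text \<open>The set of cosets of \<open>B\<close> in \<open>A\<close>, for additive groups \<open>B \<subseteq> A\<close>.\<close>

definition add_quot :: "'g::ab_group_add set \<Rightarrow> 'g set \<Rightarrow> 'g set set" where
  "add_quot A B = A // {(x, y). x \<in> A \<and> y \<in> A \<and> x - y \<in> B}"

text \<open>Applied only to summands that depend only on the coset, so the choice is immaterial.\<close>

definition coset_rep :: "'g set \<Rightarrow> 'g" where
  "coset_rep C = (SOME x. x \<in> C)"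

definition residue_field :: "('a::field \<Rightarrow> int) \<Rightarrow> 'a set set" where
  "residue_field ord = add_quot (prime_pow ord 0) (prime_pow ord 1)"

definition residue_card :: "('a::field \<Rightarrow> int) \<Rightarrow> nat" where
  "residue_card ord = card (residue_field ord)"

definition abs_val :: "('a::field \<Rightarrow> int) \<Rightarrow> 'a \<Rightarrow> real" where
  "abs_val ord x = (if x = 0 then 0 else real (residue_card ord) powi (- ord x))"

definition valuation_topology :: "('a::field \<Rightarrow> int) \<Rightarrow> 'a topology" where
  "valuation_topology ord =
     topology (\<lambda>U. \<forall>x\<in>U. \<exists>n. \<forall>y. y - x \<in> prime_pow ord n \<longrightarrow> y \<in> U)"

lemma openin_valuation_topology:
  assumes "\<And>x y. x \<noteq> 0 \<Longrightarrow> y \<noteq> 0 \<Longrightarrow> x + y \<noteq> 0 \<Longrightarrow> min (ord x) (ord y) \<le> ord (x + y)"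
  shows "openin (valuation_topology ord) U \<longleftrightarrow>
    (\<forall>x\<in>U. \<exists>n. \<forall>y. y - x \<in> prime_pow ord n \<longrightarrow> y \<in> U)"
proof -
  have "istopology (\<lambda>U. \<forall>x\<in>U. \<exists>n. \<forall>y. y - x \<in> prime_pow ord n \<longrightarrow> y \<in> U)"
    unfolding istopology_def
  proof (intro conjI allI impI ballI)
    fix S T x
    assume S: "\<forall>x\<in>S. \<exists>n. \<forall>y. y - x \<in> prime_pow ord n \<longrightarrow> y \<in> S"
      and T: "\<forall>x\<in>T. \<exists>n. \<forall>y. y - x \<in> prime_pow ord n \<longrightarrow> y \<in> T" and x: "x \<in> S \<inter> T"
    obtain m n where "\<forall>y. y - x \<in> prime_pow ord m \<longrightarrow> y \<in> S"
        "\<forall>y. y - x \<in> prime_pow ord n \<longrightarrow> y \<in> T"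
      using S T x by blast
    then show "\<exists>n. \<forall>y. y - x \<in> prime_pow ord n \<longrightarrow> y \<in> S \<inter> T"
      by (intro exI[of _ "max m n"]) (auto simp: prime_pow_def)
  next
    fix \<K> x
    assume K: "\<forall>K\<in>\<K>. \<forall>x\<in>K. \<exists>n. \<forall>y. y - x \<in> prime_pow ord n \<longrightarrow> y \<in> K"
      and x: "x \<in> \<Union> \<K>"
    then show "\<exists>n. \<forall>y. y - x \<in> prime_pow ord n \<longrightarrow> y \<in> \<Union> \<K>"
      by (meson Union_iff)
  qed
  then show ?thesis
    unfolding valuation_topology_def by simp
qed

text \<open>
  A field complete with respect to a discrete valuation with value group the integers and with
  finite residue field. Residual characteristic \<open>\<noteq> 2\<close> says that \<open>2\<close> is non-zero in the residue field.
\<close>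

locale nonarch_local_field =
  fixes ord :: "'a::field \<Rightarrow> int"
  assumes ord_mult: "\<And>x y. x \<noteq> 0 \<Longrightarrow> y \<noteq> 0 \<Longrightarrow> ord (x * y) = ord x + ord y"
    and ord_add: "\<And>x y. x \<noteq> 0 \<Longrightarrow> y \<noteq> 0 \<Longrightarrow> x + y \<noteq> 0 \<Longrightarrow> min (ord x) (ord y) \<le> ord (x + y)"
    and value_group: "ord ` (UNIV - {0}) = UNIV"
    and finite_residue_field: "finite (residue_field ord)"
    and complete: "\<And>u :: nat \<Rightarrow> 'a.
      (\<And>n. \<exists>M. \<forall>i\<ge>M. \<forall>j\<ge>M. u i - u j \<in> prime_pow ord n) \<Longrightarrow>
      \<exists>l. \<forall>n. \<exists>M. \<forall>i\<ge>M. u i - l \<in> prime_pow ord n"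

locale nonarch_local_field_odd = nonarch_local_field +
  assumes residue_char_not_2: "2 \<notin> prime_pow ord 1"

definition uniformiser :: "('a::field \<Rightarrow> int) \<Rightarrow> 'a \<Rightarrow> bool" where
  "uniformiser ord w \<longleftrightarrow> w \<noteq> 0 \<and> ord w = 1"

definition normalised_haar :: "('a::field \<Rightarrow> int) \<Rightarrow> 'a measure \<Rightarrow> bool" where
  "normalised_haar ord \<mu> \<longleftrightarrow>
     space \<mu> = UNIV \<and>
     sets \<mu> = sigma_sets UNIV {U. openin (valuation_topology ord) U} \<and>
     (\<forall>a. \<forall>A\<in>sets \<mu>. emeasure \<mu> ((\<lambda>x. a + x) ` A) = emeasure \<mu> A) \<and>
     emeasure \<mu> (prime_pow ord 0) = 1"

definition additive_character :: "('a::field \<Rightarrow> int) \<Rightarrow> ('a \<Rightarrow> complex) \<Rightarrow> bool" where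
  "additive_character ord \<Psi> \<longleftrightarrow>
     continuous_map (valuation_topology ord) euclidean \<Psi> \<and>
     (\<forall>x. cmod (\<Psi> x) = 1) \<and> (\<forall>x y. \<Psi> (x + y) = \<Psi> x * \<Psi> y)"

definition nontrivial_additive_character :: "('a::field \<Rightarrow> int) \<Rightarrow> ('a \<Rightarrow> complex) \<Rightarrow> bool" where
  "nontrivial_additive_character ord \<Psi> \<longleftrightarrow> additive_character ord \<Psi> \<and> (\<exists>x. \<Psi> x \<noteq> 1)"

definition twist :: "('a::field \<Rightarrow> complex) \<Rightarrow> 'a \<Rightarrow> 'a \<Rightarrow> complex" where
  "twist \<Phi> b = (\<lambda>x. \<Phi> (b * x))"

definition char_depth :: "('a::field \<Rightarrow> int) \<Rightarrow> ('a \<Rightarrow> complex) \<Rightarrow> int" where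
  "char_depth ord \<Psi> = (LEAST i. \<forall>x\<in>prime_pow ord (i + 1). \<Psi> x = 1)"

text \<open>
  The norms from \<open>k(\<surd>w)\<close> of its non-zero elements \<open>a + b\<surd>w\<close>, for \<open>w\<close> a non-square.
\<close>

definition norm_group :: "'a::field \<Rightarrow> 'a set" where
  "norm_group w = {a\<^sup>2 - b\<^sup>2 * w | a b. a \<noteq> 0 \<or> b \<noteq> 0}"

definition sgn_norm :: "'a::field \<Rightarrow> 'a \<Rightarrow> complex" where
  "sgn_norm w x = (if x = 0 then 0 else if x \<in> norm_group w then 1 else -1)"

definition gauss_sum :: "('a::field \<Rightarrow> int) \<Rightarrow> 'a \<Rightarrow> ('a \<Rightarrow> complex) \<Rightarrow> complex" where
  "gauss_sum ord w \<Psi> = complex_of_real (real (residue_card ord) powr (-1/2)) *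
     (\<Sum>C\<in>residue_field ord. \<Psi> ((- w) powi char_depth ord \<Psi> * (coset_rep C)\<^sup>2))"

text \<open>The matrix \<open>c\<surd>\<theta>\<close>.\<close>

definition sqrt_mat :: "'a::field \<Rightarrow> 'a \<Rightarrow> 'a^2^2" where
  "sqrt_mat c \<theta> = vector [vector [0, c], vector [c * \<theta>, 0]]"

definition lie_torus :: "'a::field \<Rightarrow> ('a^2^2) set" where
  "lie_torus \<theta> = range (\<lambda>c. sqrt_mat c \<theta>)"

definition torus :: "'a::field \<Rightarrow> ('a^2^2) set" where
  "torus \<theta> = {vector [vector [a, b], vector [b * \<theta>, a]] | a b. a\<^sup>2 - b\<^sup>2 * \<theta> = 1}"

definition scalar_of :: "'a::field^2^2 \<Rightarrow> 'a" where
  "scalar_of M = (THE a. M = mat a)"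

definition discr :: "'a::field^2^2 \<Rightarrow> 'a" where
  "discr Y = 4 * ((Y $ 1 $ 1)\<^sup>2 + Y $ 1 $ 2 * Y $ 2 $ 1)"

text \<open>Used on Lie algebras of tori only, where the square of \<open>c\<surd>\<theta>\<close> is the scalar matrix \<open>c\<^sup>2\<theta>\<close>.\<close>

definition mat_depth :: "('a::field \<Rightarrow> int) \<Rightarrow> 'a^2^2 \<Rightarrow> ereal" where
  "mat_depth ord Z =
     (if Z = 0 then \<infinity> else ereal (real_of_int (ord (scalar_of (Z ** Z))) / 2))"

definition lie_torus_quot :: "('a::field \<Rightarrow> int) \<Rightarrow> 'a \<Rightarrow> real \<Rightarrow> ('a^2^2) set set" where
  "lie_torus_quot ord \<theta> r =
     add_quot {Z \<in> lie_torus \<theta>. mat_depth ord Z \<ge> ereal r}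
              {Z \<in> lie_torus \<theta>. mat_depth ord Z > ereal r}"

text \<open>The functional \<open>\<langle>X\<^sup>*, \<cdot>\<rangle>\<close> for \<open>X\<^sup>* = \<beta>\<surd>\<theta>\<close>; it is only evaluated on trace-zero matrices.\<close>

definition trace_functional :: "'a::field \<Rightarrow> 'a \<Rightarrow> 'a^2^2 \<Rightarrow> 'a" where
  "trace_functional \<beta> \<theta> Z = trace (sqrt_mat \<beta> \<theta> ** Z)"

definition dual_depth ::
    "('a::field \<Rightarrow> int) \<Rightarrow> ('a \<Rightarrow> complex) \<Rightarrow> 'a \<Rightarrow> ('a^2^2 \<Rightarrow> 'a) \<Rightarrow> real" where
  "dual_depth ord \<Phi> \<theta> F =
     (GREATEST \<rho>. \<forall>Z\<in>lie_torus \<theta>. mat_depth ord Z > ereal (- \<rho>) \<longrightarrow> \<Phi> (F Z) = 1)"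

definition Ad :: "'b::field^2^2 \<Rightarrow> 'b^2^2 \<Rightarrow> 'b^2^2" where
  "Ad g Z = g ** Z ** matrix_inv g"

definition coAd :: "'b::field^2^2 \<Rightarrow> ('b^2^2 \<Rightarrow> 'b) \<Rightarrow> ('b^2^2 \<Rightarrow> 'b)" where
  "coAd g F = (\<lambda>Z. F (Ad (matrix_inv g) Z))"

definition base_change :: "'a::field^2^2 \<Rightarrow> 'a alg_closure^2^2" where
  "base_change = map_matrix to_ac"

text \<open>
  Conjugacy over some extension field is the same as conjugacy over an algebraic closure.
\<close>

definition stably_conjugate :: "'a::field^2^2 \<Rightarrow> 'a^2^2 \<Rightarrow> bool" where
  "stably_conjugate Y Y' \<longleftrightarrow>
     (\<exists>g :: 'a alg_closure^2^2. det g = 1 \<and> base_change Y' = Ad g (base_change Y))"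

definition SL2 :: "('b::field^2^2) monoid" where
  "SL2 = \<lparr>carrier = {g. det g = 1}, mult = (**), one = mat 1\<rparr>"

text \<open>The group of points over the algebraic closure of \<open>N_G(T_\<theta>)/T_\<theta>\<close>.\<close>

definition weyl_group :: "'a::field \<Rightarrow> ('a alg_closure^2^2) set monoid" where
  "weyl_group \<theta> =
     (SL2\<lparr>carrier := normalizer SL2 (torus (to_ac \<theta>))\<rparr>) Mod torus (to_ac \<theta>)"

text \<open>
  \<open>\<langle>Ad\<^sup>*(\<sigma>)X\<^sup>*, Z\<rangle>\<close> for \<open>X\<^sup>* = \<beta>\<surd>\<theta>\<close> and \<open>Z\<close> in the Lie algebra of \<open>T_\<theta>\<close>. It is computed over the
  algebraic closure from any representative \<open>n\<close> of \<open>\<sigma>\<close>, and lies in the ground field.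
\<close>

definition weyl_pairing ::
    "'a::field \<Rightarrow> 'a \<Rightarrow> ('a alg_closure^2^2) set \<Rightarrow> 'a^2^2 \<Rightarrow> 'a" where
  "weyl_pairing \<beta> \<theta> \<sigma> Z =
     (THE y. \<forall>n\<in>\<sigma>. to_ac y = coAd n (trace_functional (to_ac \<beta>) (to_ac \<theta>)) (base_change Z))"

text \<open>For \<open>X\<^sup>* = \<beta>\<surd>w\<close> and \<open>Y = s\<surd>\<theta>'\<close>, when \<open>\<theta>'\<close> is a square multiple of \<open>w\<close>.\<close>

definition gamma_const ::
    "('a::field \<Rightarrow> int) \<Rightarrow> ('a \<Rightarrow> complex) \<Rightarrow> 'a \<Rightarrow> 'a \<Rightarrow> 'a \<Rightarrow> complex" where
  "gamma_const ord \<Phi> w \<beta> s = sgn_norm w (- s) * gauss_sum ord w (twist \<Phi> \<beta>)"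

definition shell :: "('a::field \<Rightarrow> int) \<Rightarrow> int \<Rightarrow> 'a set" where
  "shell ord n = {x. x \<noteq> 0 \<and> ord x = n}"

text \<open>
  For \<open>X\<^sup>* = \<beta>\<surd>w\<close> and \<open>Y = s\<surd>\<theta>'\<close>. The factor \<open>1 / |x|\<close> turns \<open>dx\<close> into the multiplicative
  measure.
\<close>

definition mock_fourier_transform ::
    "('a::field \<Rightarrow> int) \<Rightarrow> 'a measure \<Rightarrow> ('a \<Rightarrow> complex) \<Rightarrow> 'a \<Rightarrow> 'a \<Rightarrow> 'a \<Rightarrow> 'a \<Rightarrow> complex" where
  "mock_fourier_transform ord \<mu> \<Phi> w \<beta> s \<theta>' =
     (\<Sum>\<^sub>\<infinity>n::int. LINT x:shell ord n|\<mu>.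
        indicator (norm_group w) x *
        (\<Sum>\<^sub>\<infinity>l::int. LINT t:shell ord l|\<mu>.
            \<Phi> (\<beta> * s * (x * \<theta>' + inverse x * w - inverse x * t\<^sup>2))) *
        complex_of_real (1 / abs_val ord x))"

end

(*
  Translating the variable of integration by a suitable small
  element multiplies an oscillating integral over a shell by a constant different from 1. This kills
  the outer integral over every shell ord x = n except n = ord s + 1 - h, and there the inner
  integral is 1/q times a value of the character. What remains is a sum over the squares U of
  the residue field of psi(k^2 U + 1/U). Writing U = u^2, the pair (k u + 1/u, k u - 1/u) runs over
  the pairs of square roots of v + 2k, v - 2k, where v = k^2 u^2 + 1/u^2. Hence v is attained
  (1 + chi(v + 2k)) (1 + chi(v - 2k)) times; expanding the product gives the Kloosterman part
  (the sum over Z) and the Salie part (Gauss sum times psi(2k) + psi(-2k)).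
*)
theory Submission
  imports Defs
begin

section \<open>Valuations and residue classes\<close>

text \<open>On the shell \<open>ord x = n\<close> the two terms \<open>s * x * \<theta>'\<close> and
  \<open>s * w / x\<close> of the phase have orders \<open>h + (n - n0)\<close> and
  \<open>h - (n - n0)\<close>, where \<open>n0 = ord s + 1 - h\<close>. The orders always add up to
  \<open>2 * h\<close>, so for \<open>n \<noteq> n0\<close> exactly one term drops below the depth
  \<open>h\<close> and oscillates, while at \<open>n0\<close> the two are balanced and the integrand
  sees only leading coefficients. The inner integral does not disturb this: it depends only on the
  leading term of \<open>s / x\<close>, which permits translations before its value is known, and at
  \<open>n0\<close> the order of \<open>s / x\<close> is \<open>h - 1\<close>, the parity for which
  no Gauss sum appears. Squares of the residue field enter because \<open>-w\<close> is the norm of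
  the square root of \<open>w\<close>: once powers of \<open>-w\<close> are split off, being a norm
  means that the unit part is a square modulo \<open>P 1\<close>. Each such square has two roots,
  whence the factor 1/2. The factor \<open>chi\<close> at \<open>v^2 - 4 k^2\<close> vanishes
  exactly at the classes of \<open>2k\<close> and \<open>-2k\<close>, which correspond to the stable
  conjugate and its negative; this is why these two are left out of the sum over
  \<open>Z\<close>.\<close>

context nonarch_local_field
begin

abbreviation P :: "int \<Rightarrow> 'a set" where "P \<equiv> prime_pow ord"

lemma P_iff: "x \<in> P n \<longleftrightarrow> x = 0 \<or> n \<le> ord x"
  by (simp add: prime_pow_def)

lemma zero_in_P [simp]: "0 \<in> P n"
  by (simp add: P_iff)

lemma ord_1 [simp]: "ord 1 = 0"
  using ord_mult[of 1 1] by simp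

lemma ord_minus [simp]: "ord (- x) = ord x"
proof (cases "x = 0")
  case False
  have "ord (-1) = 0"
    using ord_mult[of "-1" "-1"] by simp
  with False ord_mult[of "-1" x] show ?thesis by simp
qed simp

lemma ord_inverse: "x \<noteq> 0 \<Longrightarrow> ord (inverse x) = - ord x"
  using ord_mult[of x "inverse x"] by simp

lemma ord_divide: "x \<noteq> 0 \<Longrightarrow> y \<noteq> 0 \<Longrightarrow> ord (x / y) = ord x - ord y"
  by (simp add: divide_inverse ord_mult ord_inverse)

lemma ord_power: "x \<noteq> 0 \<Longrightarrow> ord (x ^ n) = int n * ord x"
  by (induction n) (auto simp: ord_mult algebra_simps)

lemma ord_power_int: "x \<noteq> 0 \<Longrightarrow> ord (x powi n) = n * ord x"
  by (cases "n \<ge> 0") (auto simp: power_int_def ord_power ord_inverse)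

lemma P_mono: "x \<in> P n \<Longrightarrow> m \<le> n \<Longrightarrow> x \<in> P m"
  by (auto simp: P_iff)

lemma P_add: "x \<in> P n \<Longrightarrow> y \<in> P n \<Longrightarrow> x + y \<in> P n"
  using ord_add[of x y] by (force simp: P_iff)

lemma P_minus [simp]: "- x \<in> P n \<longleftrightarrow> x \<in> P n"
  by (simp add: P_iff)

lemma P_diff: "x \<in> P n \<Longrightarrow> y \<in> P n \<Longrightarrow> x - y \<in> P n"
  using P_add[of x n "- y"] by simp

lemma P_diff_commute: "x - y \<in> P n \<longleftrightarrow> y - x \<in> P n"
  using P_minus[of "x - y"] by simp

lemma P_mult: "x \<in> P m \<Longrightarrow> y \<in> P n \<Longrightarrow> x * y \<in> P (m + n)"
  by (cases "x = 0"; cases "y = 0") (simp_all add: P_iff ord_mult)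

lemma P_ord [simp]: "x \<in> P (ord x)"
  by (simp add: P_iff)

lemma P_mult_iff: "c \<noteq> 0 \<Longrightarrow> c * x \<in> P n \<longleftrightarrow> x \<in> P (n - ord c)"
  by (cases "x = 0") (auto simp: P_iff ord_mult)

lemma P_power2_iff: "x\<^sup>2 \<in> P 1 \<longleftrightarrow> x \<in> P 1"
  by (cases "x = 0") (auto simp: P_iff ord_power)

lemma not_P1_iff: "x \<in> P 0 \<Longrightarrow> x \<notin> P 1 \<longleftrightarrow> x \<noteq> 0 \<and> ord x = 0"
  by (auto simp: P_iff)

lemma unit_mult_P_iff: "ord c = 0 \<Longrightarrow> c \<noteq> 0 \<Longrightarrow> c * x \<in> P n \<longleftrightarrow> x \<in> P n"
  by (simp add: P_mult_iff)

lemma P1_prime: "x \<in> P 0 \<Longrightarrow> y \<in> P 0 \<Longrightarrow> x * y \<in> P 1 \<longleftrightarrow> x \<in> P 1 \<or> y \<in> P 1"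
  by (cases "x = 0"; cases "y = 0") (auto simp: P_iff ord_mult)

lemma ord_add_eq:
  assumes "x \<noteq> 0" "y \<in> P (ord x + 1)"
  shows "x + y \<noteq> 0" "ord (x + y) = ord x"
proof -
  show nz: "x + y \<noteq> 0"
  proof
    assume "x + y = 0"
    then have "y = - x" by (simp only: add_eq_0_iff)
    with assms show False by (simp add: P_iff)
  qed
  have "x + y \<in> P (ord x)"
    using assms by (intro P_add) (auto intro: P_mono)
  moreover have "x + y \<notin> P (ord x + 1)"
    using P_diff[of "x + y" "ord x + 1" y] assms by (auto simp: P_iff)
  ultimately show "ord (x + y) = ord x"
    using nz by (auto simp: P_iff)
qed

lemma openin_iff:
  "openin (valuation_topology ord) U \<longleftrightarrow> (\<forall>x\<in>U. \<exists>n. \<forall>y. y - x \<in> P n \<longrightarrow> y \<in> U)"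
  by (rule openin_valuation_topology[OF ord_add])

lemma topspace_valuation_topology: "topspace (valuation_topology ord) = UNIV"
  using openin_subset[of "valuation_topology ord" UNIV] by (auto simp: openin_iff)

lemma shell_add: "x \<in> shell ord n \<Longrightarrow> z \<in> P (n + 1) \<Longrightarrow> x + z \<in> shell ord n"
  using ord_add_eq[of x z] by (simp add: shell_def)

text \<open>A system of representatives of the residue field, so that sums over it become sums over
  field elements.\<close>

definition R :: "'a set" where "R = coset_rep ` residue_field ord"

lemma residue_field_member:
  assumes "C \<in> residue_field ord"
  obtains x where "x \<in> P 0" "C = {y. y - x \<in> P 1}"
proof -
  obtain x where x: "x \<in> P 0" "C = {y \<in> P 0. x - y \<in> P 1}"
    using assms by (auto simp: residue_field_def add_quot_def quotient_def)
  moreover have "y \<in> P 0" if "y - x \<in> P 1" for y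
    using P_add[of "y - x" 0 x] x(1) that P_mono[of "y - x" 1 0] by simp
  ultimately have "C = {y. y - x \<in> P 1}"
    using P_diff_commute by blast
  with x(1) that show ?thesis by blast
qed

lemma residue_field_class: "x \<in> P 0 \<Longrightarrow> {y. y - x \<in> P 1} \<in> residue_field ord"
proof -
  assume x: "x \<in> P 0"
  have "y \<in> P 0" if "y - x \<in> P 1" for y
    using P_add[of "y - x" 0 x] x that P_mono[of "y - x" 1 0] by simp
  then have "{y. y - x \<in> P 1} = {(x, y). x \<in> P 0 \<and> y \<in> P 0 \<and> x - y \<in> P 1} `` {x}"
    using x P_diff_commute by auto
  with x show ?thesis
    by (auto simp: residue_field_def add_quot_def quotient_def)
qed

lemma coset_rep_in: "C \<in> residue_field ord \<Longrightarrow> coset_rep C \<in> C"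
proof -
  assume "C \<in> residue_field ord"
  then obtain x where "C = {y. y - x \<in> P 1}" using residue_field_member by blast
  then have "x \<in> C" by simp
  then show ?thesis unfolding coset_rep_def by (rule someI)
qed

lemma residue_field_eq_class: "C \<in> residue_field ord \<Longrightarrow> x \<in> C \<Longrightarrow> C = {y. y - x \<in> P 1}"
proof -
  assume "C \<in> residue_field ord" "x \<in> C"
  then obtain z where z: "C = {y. y - z \<in> P 1}" "x - z \<in> P 1" using residue_field_member by blast
  have "y - z \<in> P 1 \<longleftrightarrow> y - x \<in> P 1" for y
    using P_add[of "y - x" 1 "x - z"] P_diff[of "y - z" 1 "x - z"] z(2) by auto
  with z show ?thesis by simp
qed

lemma inj_coset_rep: "inj_on coset_rep (residue_field ord)"
proof (rule inj_onI)
  fix C D assume *: "C \<in> residue_field ord" "D \<in> residue_field ord" "coset_rep C = coset_rep D"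
  show "C = D"
    using residue_field_eq_class[OF *(1) coset_rep_in[OF *(1)]]
      residue_field_eq_class[OF *(2) coset_rep_in[OF *(2)]] *(3) by (simp only:)
qed

lemma finite_R [simp]: "finite R"
  by (simp add: R_def finite_residue_field)

lemma card_R: "card R = residue_card ord"
  by (simp add: R_def residue_card_def card_image inj_coset_rep)

lemma sum_residue_field: "(\<Sum>C\<in>residue_field ord. f (coset_rep C)) = (\<Sum>u\<in>R. f u)"
  by (simp add: R_def sum.reindex inj_coset_rep)

lemma R_subset: "u \<in> R \<Longrightarrow> u \<in> P 0"
proof -
  assume "u \<in> R"
  then obtain C where C: "C \<in> residue_field ord" "u = coset_rep C" by (auto simp: R_def)
  with residue_field_member[OF C(1)] coset_rep_in[OF C(1)] obtain x
    where "x \<in> P 0" "u - x \<in> P 1" by blast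
  then show ?thesis using P_add[of "u - x" 0 x] P_mono[of "u - x" 1 0] by simp
qed

lemma R_eqI: "u \<in> R \<Longrightarrow> v \<in> R \<Longrightarrow> u - v \<in> P 1 \<Longrightarrow> u = v"
proof -
  assume uv: "u \<in> R" "v \<in> R" "u - v \<in> P 1"
  then obtain C D where CD: "C \<in> residue_field ord" "u = coset_rep C"
      "D \<in> residue_field ord" "v = coset_rep D" by (auto simp: R_def)
  have D: "D = {y. y - v \<in> P 1}"
    using CD coset_rep_in residue_field_eq_class by blast
  with uv(3) have "u \<in> D" by simp
  then have "D = {y. y - u \<in> P 1}" using CD residue_field_eq_class by blast
  moreover have "C = {y. y - u \<in> P 1}"
    using CD coset_rep_in residue_field_eq_class by blast
  ultimately have "C = D" by (simp only:)
  then show "u = v" using CD(2,4) by (simp only:)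
qed

text \<open>\<open>R\<close> is not closed under the field operations. \<open>red\<close> leads back
  into it, so that a map on residue classes becomes a formula in the field followed by
  \<open>red\<close>.\<close>

definition red :: "'a \<Rightarrow> 'a" where "red x = (SOME u. u \<in> R \<and> x - u \<in> P 1)"

lemma red:
  assumes "x \<in> P 0" shows "red x \<in> R" "x - red x \<in> P 1"
proof -
  let ?C = "{y. y - x \<in> P 1}"
  have C: "?C \<in> residue_field ord" using residue_field_class[OF assms] .
  then have "coset_rep ?C \<in> R" "x - coset_rep ?C \<in> P 1"
    using coset_rep_in[OF C] P_diff_commute by (auto simp: R_def)
  then have "\<exists>u. u \<in> R \<and> x - u \<in> P 1" by blast
  from someI_ex[OF this] show "red x \<in> R" "x - red x \<in> P 1" by (simp_all add: red_def)
qed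

lemma red_unique: "x \<in> P 0 \<Longrightarrow> u \<in> R \<Longrightarrow> x - u \<in> P 1 \<Longrightarrow> red x = u"
proof -
  assume *: "x \<in> P 0" "u \<in> R" "x - u \<in> P 1"
  have "red x - u \<in> P 1" using P_diff[OF *(3) red(2)[OF *(1)]] by simp
  then show ?thesis using R_eqI * red by blast
qed

text \<open>An injective self-map of the finite set of residue classes is bijective, and congruence
  invariance lets \<open>f\<close> ignore the reduction that follows \<open>\<phi>\<close>.\<close>

lemma sum_R_reindex:
  assumes \<phi>0: "\<And>x. x \<in> R \<Longrightarrow> \<phi> x \<in> P 0"
    and inj: "\<And>x y. x \<in> R \<Longrightarrow> y \<in> R \<Longrightarrow> \<phi> x - \<phi> y \<in> P 1 \<Longrightarrow> x - y \<in> P 1"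
    and f: "\<And>x y. x \<in> P 0 \<Longrightarrow> y \<in> P 0 \<Longrightarrow> x - y \<in> P 1 \<Longrightarrow> f x = f y"
  shows "(\<Sum>u\<in>R. f (\<phi> u)) = (\<Sum>u\<in>R. f u)"
proof -
  have inj': "inj_on (red \<circ> \<phi>) R"
  proof (rule inj_onI)
    fix x y assume xy: "x \<in> R" "y \<in> R" "(red \<circ> \<phi>) x = (red \<circ> \<phi>) y"
    have "\<phi> x - \<phi> y \<in> P 1"
      using P_diff[OF red(2)[OF \<phi>0[OF xy(1)]] red(2)[OF \<phi>0[OF xy(2)]]] xy(3) by simp
    then show "x = y" using inj R_eqI xy by blast
  qed
  have "(red \<circ> \<phi>) ` R \<subseteq> R" using red \<phi>0 by auto
  then have "bij_betw (red \<circ> \<phi>) R R"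
    using inj' endo_inj_surj[OF finite_R] unfolding bij_betw_def by blast
  then have "(\<Sum>u\<in>R. f ((red \<circ> \<phi>) u)) = (\<Sum>u\<in>R. f u)"
    by (rule sum.reindex_bij_betw)
  moreover have "f ((red \<circ> \<phi>) u) = f (\<phi> u)" if "u \<in> R" for u
  proof -
    have "\<phi> u - red (\<phi> u) \<in> P 1" "\<phi> u \<in> P 0" "red (\<phi> u) \<in> P 0"
      using that \<phi>0 red R_subset by auto
    then show ?thesis using f[of "\<phi> u" "red (\<phi> u)"] by simp
  qed
  ultimately show ?thesis by simp
qed

text \<open>The terms are grouped by the class of \<open>\<phi> u\<close>. The weights are then
  point counts over the residue field, which is how numbers of square roots enter character
  sums.\<close>

lemma sum_R_by_value:
  fixes f :: "'a \<Rightarrow> 'c::comm_semiring_1"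
  assumes A: "finite A" and \<phi>0: "\<And>x. x \<in> A \<Longrightarrow> \<phi> x \<in> P 0"
    and f: "\<And>x y. x \<in> P 0 \<Longrightarrow> y \<in> P 0 \<Longrightarrow> x - y \<in> P 1 \<Longrightarrow> f x = f y"
  shows "(\<Sum>u\<in>A. f (\<phi> u)) = (\<Sum>v\<in>R. of_nat (card {u \<in> A. \<phi> u - v \<in> P 1}) * f v)"
proof -
  have "(\<Sum>u\<in>A. f (\<phi> u)) = (\<Sum>v\<in>R. \<Sum>u\<in>{u \<in> A. red (\<phi> u) = v}. f (\<phi> u))"
    by (rule sum.group[symmetric]) (use A red \<phi>0 in auto)
  also have "\<dots> = (\<Sum>v\<in>R. of_nat (card {u \<in> A. \<phi> u - v \<in> P 1}) * f v)"
  proof (rule sum.cong[OF refl])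
    fix v assume v: "v \<in> R"
    have eq: "{u \<in> A. red (\<phi> u) = v} = {u \<in> A. \<phi> u - v \<in> P 1}"
      using red red_unique \<phi>0 v by blast
    have "f (\<phi> u) = f v" if "u \<in> {u \<in> A. \<phi> u - v \<in> P 1}" for u
      using that f[of "\<phi> u" v] \<phi>0 v R_subset by auto
    then show "(\<Sum>u\<in>{u \<in> A. red (\<phi> u) = v}. f (\<phi> u)) =
        of_nat (card {u \<in> A. \<phi> u - v \<in> P 1}) * f v"
      by (simp add: eq)
  qed
  finally show ?thesis .
qed

end

section \<open>Square roots of principal units, from completeness\<close>

context nonarch_local_field_odd
begin

lemma two_nonzero: "(2::'a) \<noteq> 0"
  using residue_char_not_2 by auto

lemma two_P0: "(2::'a) \<in> P 0"
  using P_add[of 1 0 1] by (simp add: P_iff)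

lemma ord_2 [simp]: "ord 2 = 0"
  using two_P0 residue_char_not_2 two_nonzero by (auto simp: P_iff)

lemma two_mult_P_iff [simp]: "2 * x \<in> P n \<longleftrightarrow> x \<in> P n"
  by (simp add: P_mult_iff two_nonzero)

lemma half_P_iff [simp]: "x / 2 \<in> P n \<longleftrightarrow> x \<in> P n"
  using two_mult_P_iff[of "x / 2"] two_nonzero by simp

text \<open>\<open>z\<close> is the limit of the contraction \<open>z \<mapsto> (x - z\<^sup>2) / 2\<close> on the maximal ideal.\<close>

lemma principal_unit_square:
  assumes x: "x \<in> P 1"
  obtains z where "z \<in> P 1" "(1 + z)\<^sup>2 = 1 + x"
proof -
  define T where "T z = (x - z\<^sup>2) / 2" for z
  have T1: "T z \<in> P 1" if "z \<in> P 1" for z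
    using that x unfolding T_def half_P_iff by (intro P_diff) (simp_all add: P_power2_iff)
  have Td: "T z - T z' \<in> P (n + 1)" if "z \<in> P 1" "z' \<in> P 1" "z - z' \<in> P n" for z z' n
  proof -
    have "T z - T z' = - ((z - z') * (z + z') / 2)"
      by (simp add: T_def power2_eq_square field_simps)
    moreover have "(z - z') * (z + z') \<in> P (n + 1)"
      using that by (intro P_mult P_add) auto
    ultimately show ?thesis by simp
  qed
  define u where "u n = (T ^^ n) 0" for n
  have u1: "u n \<in> P 1" for n
    by (induction n) (auto simp: u_def T1)
  have ustep: "u (Suc n) - u n \<in> P (int n)" for n
  proof (induction n)
    case 0
    then show ?case using P_mono[OF P_diff[OF u1[of 1] u1[of 0]], of 0] by simp
  next
    case (Suc n)
    have "u (Suc (Suc n)) - u (Suc n) = T (u (Suc n)) - T (u n)" by (simp add: u_def)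
    with Td[OF u1 u1 Suc] show ?case by (simp add: add.commute)
  qed
  have udiff: "u (n + k) - u n \<in> P (int n)" for n k
  proof (induction k)
    case (Suc k)
    have "u (n + Suc k) - u n = (u (Suc (n + k)) - u (n + k)) + (u (n + k) - u n)" by simp
    moreover have "u (Suc (n + k)) - u (n + k) \<in> P (int n)"
      using ustep[of "n + k"] by (rule P_mono) simp
    ultimately show ?case using Suc P_add by metis
  qed simp
  have "\<exists>l. \<forall>n. \<exists>M. \<forall>i\<ge>M. u i - l \<in> P n"
  proof (rule complete)
    fix n :: int
    have "u i - u j \<in> P n" if "nat n \<le> i" "nat n \<le> j" for i j
    proof -
      have *: "u i - u (nat n) \<in> P n" if "nat n \<le> i" for i
        using udiff[of "nat n" "i - nat n"] that by (auto intro: P_mono)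
      show ?thesis using P_diff[OF *[OF that(1)] *[OF that(2)]] by simp
    qed
    then show "\<exists>M. \<forall>i\<ge>M. \<forall>j\<ge>M. u i - u j \<in> P n" by blast
  qed
  then obtain l where l: "\<And>n. \<exists>M. \<forall>i\<ge>M. u i - l \<in> P n" by blast
  have l1: "l \<in> P 1"
  proof -
    from l[of 1] obtain M where "u M - l \<in> P 1" by blast
    from P_diff[OF u1[of M] this] show ?thesis by simp
  qed
  have "l - T l \<in> P n" for n
  proof -
    from l[of n] obtain M where M: "\<And>i. i \<ge> M \<Longrightarrow> u i - l \<in> P n" by blast
    have "T (u M) - T l \<in> P n" using Td[OF u1 l1 M[OF order_refl]] by (rule P_mono) simp
    moreover have "u (Suc M) - l \<in> P n" using M by simp
    ultimately have "(T (u M) - T l) - (u (Suc M) - l) \<in> P n" by (rule P_diff)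
    then show ?thesis by (simp add: u_def)
  qed
  \<comment> \<open>A non-zero element does not lie in \<open>P\<close> of its own order plus
    one.\<close>
  from this[of "ord (l - T l) + 1"] have "l = T l" by (auto simp: P_iff)
  then have "2 * l = x - l\<^sup>2" using two_nonzero by (simp add: T_def field_simps)
  then have "(1 + l)\<^sup>2 = 1 + x" by (simp add: power2_eq_square algebra_simps)
  with l1 that show ?thesis by blast
qed

end

section \<open>Character sums over the residue field\<close>

context nonarch_local_field
begin

definition cong1 :: "'a \<Rightarrow> 'a \<Rightarrow> bool" (infix "\<asymp>" 50) where "x \<asymp> y \<longleftrightarrow> x - y \<in> P 1"

lemma cong1_refl [simp]: "x \<asymp> x"
  by (simp add: cong1_def)

lemma cong1_sym: "x \<asymp> y \<Longrightarrow> y \<asymp> x"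
  using P_diff_commute by (simp add: cong1_def)

lemma cong1_trans [trans]: "x \<asymp> y \<Longrightarrow> y \<asymp> z \<Longrightarrow> x \<asymp> z"
  using P_add[of "x - y" 1 "y - z"] by (simp add: cong1_def)

lemma cong1_add: "x \<asymp> x' \<Longrightarrow> y \<asymp> y' \<Longrightarrow> x + y \<asymp> x' + y'"
  using P_add[of "x - x'" 1 "y - y'"] by (simp add: cong1_def algebra_simps)

lemma cong1_diff: "x \<asymp> x' \<Longrightarrow> y \<asymp> y' \<Longrightarrow> x - y \<asymp> x' - y'"
  using P_diff[of "x - x'" 1 "y - y'"] by (simp add: cong1_def algebra_simps)

lemma cong1_P0: "x \<asymp> y \<Longrightarrow> y \<in> P 0 \<Longrightarrow> x \<in> P 0"
  using P_add[of "x - y" 0 y] P_mono[of "x - y" 1 0] by (simp add: cong1_def)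

lemma cong1_P1: "x \<asymp> y \<Longrightarrow> x \<in> P 1 \<longleftrightarrow> y \<in> P 1"
  using P_add[of "x - y" 1 y] P_diff[of x 1 "x - y"] by (auto simp: cong1_def)

lemma P0_mult: "x \<in> P 0 \<Longrightarrow> y \<in> P 0 \<Longrightarrow> x * y \<in> P 0"
  using P_mult[of x 0 y 0] by simp

lemma P0_power: "x \<in> P 0 \<Longrightarrow> x ^ n \<in> P 0"
  by (induction n) (auto simp: P0_mult P_iff[of 1])

lemma cong1_mult: "x \<asymp> x' \<Longrightarrow> y \<asymp> y' \<Longrightarrow> x' \<in> P 0 \<Longrightarrow> y' \<in> P 0 \<Longrightarrow> x * y \<asymp> x' * y'"
proof -
  assume a: "x \<asymp> x'" "y \<asymp> y'" "x' \<in> P 0" "y' \<in> P 0"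
  have "x * y - x' * y' = (x - x') * y + x' * (y - y')" by (simp add: algebra_simps)
  moreover have "(x - x') * y \<in> P 1"
    using a cong1_P0 P_mult[of "x - x'" 1 y 0] by (simp add: cong1_def)
  moreover have "x' * (y - y') \<in> P 1"
    using a P_mult[of x' 0 "y - y'" 1] by (simp add: cong1_def)
  ultimately show ?thesis using P_add by (simp add: cong1_def)
qed

lemma cong1_power2: "x \<asymp> x' \<Longrightarrow> x' \<in> P 0 \<Longrightarrow> x\<^sup>2 \<asymp> x'\<^sup>2"
  by (simp add: power2_eq_square cong1_mult)

lemma cong1_unit_cancel: "c \<in> P 0 \<Longrightarrow> c \<notin> P 1 \<Longrightarrow> c * x \<asymp> c * y \<longleftrightarrow> x \<asymp> y"
proof -
  assume "c \<in> P 0" "c \<notin> P 1"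
  then have "c \<noteq> 0" "ord c = 0" by (auto simp: P_iff)
  then show ?thesis
    using unit_mult_P_iff[of c "x - y" 1] by (simp add: cong1_def right_diff_distrib)
qed

lemma inverse_unit: "x \<in> P 0 \<Longrightarrow> x \<notin> P 1 \<Longrightarrow> inverse x \<in> P 0 \<and> inverse x \<notin> P 1"
  by (auto simp: P_iff ord_inverse)

lemma cong1_inverse:
  assumes "x \<asymp> y" "y \<in> P 0" "y \<notin> P 1"
  shows "inverse x \<asymp> inverse y"
proof -
  have x: "x \<in> P 0" "x \<notin> P 1" using assms cong1_P0 cong1_P1 by blast+
  have nz: "x \<noteq> 0" "y \<noteq> 0" using x assms by auto
  have "(x * y) * inverse x = y" "(x * y) * inverse y = x"
    using nz by (simp_all add: field_simps)
  then have "(x * y) * inverse x \<asymp> (x * y) * inverse y"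
    using cong1_sym[OF assms(1)] by (simp only:)
  then show ?thesis
    using cong1_unit_cancel[of "x * y"] P0_mult P1_prime x assms by blast
qed

lemma red_cong: "x \<in> P 0 \<Longrightarrow> red x \<asymp> x"
  using red(2) P_diff_commute by (simp add: cong1_def)

lemma red_R: "x \<in> P 0 \<Longrightarrow> red x \<in> R"
  by (rule red(1))

lemma red_eqI: "u \<in> R \<Longrightarrow> u \<asymp> x \<Longrightarrow> x \<in> P 0 \<Longrightarrow> red x = u"
  using red_unique P_diff_commute by (simp add: cong1_def)

text \<open>A non-trivial additive character of the residue field, kept as a function on the whole
  local field so that no induced function on cosets has to be formed.\<close>

definition additive_mod1 :: "('a \<Rightarrow> complex) \<Rightarrow> bool" where
  "additive_mod1 \<psi> \<longleftrightarrow> (\<forall>x y. \<psi> (x + y) = \<psi> x * \<psi> y) \<and> (\<forall>x\<in>P 1. \<psi> x = 1) \<and> (\<exists>x\<in>P 0. \<psi> x \<noteq> 1)"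

lemma additive_mod1_cong: "additive_mod1 \<psi> \<Longrightarrow> x \<asymp> y \<Longrightarrow> \<psi> x = \<psi> y"
proof -
  assume "additive_mod1 \<psi>" "x \<asymp> y"
  then have "\<psi> ((x - y) + y) = 1 * \<psi> y"
    unfolding additive_mod1_def cong1_def by metis
  then show ?thesis by simp
qed

lemma sum_R_cong_reindex:
  assumes "\<And>x. x \<in> R \<Longrightarrow> \<phi> x \<in> P 0"
    and "\<And>x y. \<phi> x \<asymp> \<phi> y \<Longrightarrow> x \<asymp> y" "\<And>x y. x \<asymp> y \<Longrightarrow> f x = f y"
  shows "(\<Sum>u\<in>R. f (\<phi> u)) = (\<Sum>u\<in>R. f u)"
  using assms by (intro sum_R_reindex) (auto simp: cong1_def)

lemma sum_R_shift: "a \<in> P 0 \<Longrightarrow> (\<And>x y. x \<asymp> y \<Longrightarrow> f x = f y) \<Longrightarrow> (\<Sum>u\<in>R. f (u + a)) = (\<Sum>u\<in>R. f u)"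
  by (rule sum_R_cong_reindex) (auto simp: cong1_def R_subset P_add)

lemma sum_R_scale:
  "a \<in> P 0 \<Longrightarrow> a \<notin> P 1 \<Longrightarrow> (\<And>x y. x \<asymp> y \<Longrightarrow> f x = f y) \<Longrightarrow> (\<Sum>u\<in>R. f (a * u)) = (\<Sum>u\<in>R. f u)"
  by (rule sum_R_cong_reindex) (auto simp: cong1_unit_cancel R_subset P0_mult)

text \<open>A shift by \<open>a\<close> with \<open>\<psi> a \<noteq> 1\<close> permutes the classes
  but multiplies the sum by \<open>\<psi> a\<close>.\<close>

lemma sum_additive_mod1:
  assumes "additive_mod1 \<psi>" shows "(\<Sum>u\<in>R. \<psi> u) = 0"
proof -
  obtain a where a: "a \<in> P 0" "\<psi> a \<noteq> 1" using assms by (auto simp: additive_mod1_def)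
  have "(\<Sum>u\<in>R. \<psi> u) = (\<Sum>u\<in>R. \<psi> (u + a))"
    using a assms additive_mod1_cong by (intro sum_R_shift[symmetric]) auto
  also have "\<dots> = \<psi> a * (\<Sum>u\<in>R. \<psi> u)"
    using assms by (simp add: additive_mod1_def sum_distrib_left mult.commute)
  finally show ?thesis using a(2) by simp
qed

text \<open>The Legendre symbol of the residue field, with value 0 at the zero class. Off
  \<open>P 0\<close> it is constantly -1, so congruence invariance holds without an integrality
  hypothesis.\<close>

definition chi :: "'a \<Rightarrow> complex" where
  "chi v = (if v \<in> P 1 then 0 else if \<exists>u\<in>P 0. u\<^sup>2 \<asymp> v then 1 else -1)"

lemma chi_cong: "x \<asymp> y \<Longrightarrow> chi x = chi y"
proof -
  assume xy: "x \<asymp> y"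
  have "u\<^sup>2 \<asymp> x \<longleftrightarrow> u\<^sup>2 \<asymp> y" for u using xy cong1_sym cong1_trans by blast
  then show ?thesis using cong1_P1[OF xy] by (simp add: chi_def)
qed

lemma chi_square_mult:
  assumes "u \<in> P 0" "u \<notin> P 1" "b \<in> P 0"
  shows "chi (u\<^sup>2 * b) = chi b"
proof -
  have u2: "u\<^sup>2 \<in> P 0" "u\<^sup>2 \<notin> P 1" using assms P0_power P_power2_iff by auto
  have iff: "(\<exists>z\<in>P 0. z\<^sup>2 \<asymp> u\<^sup>2 * b) \<longleftrightarrow> (\<exists>z\<in>P 0. z\<^sup>2 \<asymp> b)"
  proof
    assume "\<exists>z\<in>P 0. z\<^sup>2 \<asymp> u\<^sup>2 * b"
    then obtain z where z: "z \<in> P 0" "z\<^sup>2 \<asymp> u\<^sup>2 * b" by blast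
    have "u\<^sup>2 * (z * inverse u)\<^sup>2 = z\<^sup>2"
      using assms by (auto simp: power_mult_distrib field_simps)
    then have "(z * inverse u)\<^sup>2 \<asymp> b" using z cong1_unit_cancel[OF u2] by metis
    then show "\<exists>z\<in>P 0. z\<^sup>2 \<asymp> b" using P0_mult z(1) inverse_unit assms by blast
  next
    assume "\<exists>z\<in>P 0. z\<^sup>2 \<asymp> b"
    then obtain z where z: "z \<in> P 0" "z\<^sup>2 \<asymp> b" by blast
    then have "(u * z)\<^sup>2 \<asymp> u\<^sup>2 * b"
      using cong1_unit_cancel[OF u2] by (simp add: power_mult_distrib)
    then show "\<exists>z\<in>P 0. z\<^sup>2 \<asymp> u\<^sup>2 * b" using P0_mult z(1) assms(1) by blast
  qed
  have "u\<^sup>2 * b \<in> P 1 \<longleftrightarrow> b \<in> P 1" using P1_prime u2 assms by blast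
  with iff show ?thesis by (simp add: chi_def)
qed

lemma chi_values: "chi v \<in> {0, 1, -1}"
  by (simp add: chi_def)

end

section \<open>The quadratic character and Gauss sums in odd residual characteristic\<close>

context nonarch_local_field_odd
begin

text \<open>The counts are 1, 2 and 0 for the zero class, the non-zero squares and the non-squares.
  That \<open>u\<close> and \<open>- u\<close> are different classes rests on 2 being a
  unit.\<close>

lemma card_square_roots:
  assumes v: "v \<in> P 0"
  shows "of_nat (card {z \<in> R. z\<^sup>2 - v \<in> P 1}) = 1 + chi v"
proof -
  consider "v \<in> P 1" | u where "v \<notin> P 1" "u \<in> P 0" "u\<^sup>2 \<asymp> v" | "v \<notin> P 1" "\<not> (\<exists>u\<in>P 0. u\<^sup>2 \<asymp> v)"
    by blast
  then show ?thesis
  proof cases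
    case 1
    then have "z\<^sup>2 - v \<in> P 1 \<longleftrightarrow> z \<in> P 1" for z
      using P_add[of "z\<^sup>2 - v" 1 v] P_diff[of "z\<^sup>2" 1 v] by (auto simp: P_power2_iff)
    moreover have "z = red 0" if "z \<in> R" "z \<in> P 1" for z
      using red_unique[of 0 z] that by simp
    moreover have "red 0 \<in> R" "red 0 \<in> P 1" using red[of 0] by simp_all
    ultimately have "{z \<in> R. z\<^sup>2 - v \<in> P 1} = {red 0}" by blast
    with 1 show ?thesis by (simp add: chi_def)
  next
    case 2
    have u: "u \<notin> P 1" using 2 cong1_P1 P_power2_iff by blast
    have "z\<^sup>2 - v \<in> P 1 \<longleftrightarrow> z \<asymp> u \<or> z \<asymp> - u" if "z \<in> R" for z
    proof -
      have "z\<^sup>2 - v \<in> P 1 \<longleftrightarrow> z\<^sup>2 \<asymp> u\<^sup>2"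
        using 2(3) cong1_sym cong1_trans unfolding cong1_def[symmetric] by blast
      also have "\<dots> \<longleftrightarrow> (z - u) * (z + u) \<in> P 1"
        by (simp add: cong1_def power2_eq_square algebra_simps)
      also have "\<dots> \<longleftrightarrow> z \<asymp> u \<or> z \<asymp> - u"
        using P1_prime[OF P_diff P_add] R_subset[OF that] 2(2) by (simp add: cong1_def)
      finally show ?thesis .
    qed
    moreover have u': "- u \<in> P 0" using 2 by simp
    moreover have "z \<asymp> x \<longleftrightarrow> z = red x" if "z \<in> R" "x \<in> P 0" for z x
      using that red_eqI red_cong by metis
    ultimately have "z\<^sup>2 - v \<in> P 1 \<longleftrightarrow> z = red u \<or> z = red (- u)" if "z \<in> R" for z
      using that 2(2) by presburger
    then have "{z \<in> R. z\<^sup>2 - v \<in> P 1} = {red u, red (- u)}"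
      using red_R 2(2) u' by auto
    moreover have "red u \<noteq> red (- u)"
    proof
      assume "red u = red (- u)"
      then have "u \<asymp> - u" using red_cong 2(2) u' cong1_sym cong1_trans by metis
      then have "2 * u \<in> P 1" by (simp add: cong1_def)
      with u show False by simp
    qed
    moreover have "chi v = 1" using 2 by (auto simp: chi_def)
    ultimately show ?thesis by simp
  next
    case 3
    then have "{z \<in> R. z\<^sup>2 - v \<in> P 1} = {}" using R_subset by (auto simp: cong1_def)
    with 3 show ?thesis by (simp add: chi_def)
  qed
qed

lemma sum_R_square:
  fixes f :: "'a \<Rightarrow> complex"
  assumes "\<And>x y. x \<asymp> y \<Longrightarrow> f x = f y"
  shows "(\<Sum>z\<in>R. f (z\<^sup>2)) = (\<Sum>v\<in>R. (1 + chi v) * f v)"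
proof -
  have "(\<Sum>z\<in>R. f (z\<^sup>2)) = (\<Sum>v\<in>R. of_nat (card {z \<in> R. z\<^sup>2 - v \<in> P 1}) * f v)"
    using assms by (intro sum_R_by_value) (auto simp: R_subset P0_power cong1_def)
  also have "\<dots> = (\<Sum>v\<in>R. (1 + chi v) * f v)"
    using card_square_roots R_subset by (intro sum.cong) auto
  finally show ?thesis .
qed

text \<open>Counting all \<open>z\<close> by their squares gives the cardinality of \<open>R\<close>
  again, so the corrections \<open>chi v\<close> cancel.\<close>

lemma sum_chi: "(\<Sum>v\<in>R. chi v) = 0"
  using sum_R_square[of "\<lambda>_. 1"] by (simp add: sum.distrib)

text \<open>For a non-square unit \<open>a\<close> all terms of the vanishing sum \<open>\<Sum>v. chi v + chi (a v)\<close> are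
  \<open>\<le> 0\<close>.\<close>

lemma chi_mult:
  assumes a: "a \<in> P 0" and b: "b \<in> P 0"
  shows "chi (a * b) = chi a * chi b"
proof -
  consider "a \<in> P 1" | u where "a \<notin> P 1" "u \<in> P 0" "u\<^sup>2 \<asymp> a"
    | "a \<notin> P 1" "\<not> (\<exists>u\<in>P 0. u\<^sup>2 \<asymp> a)" by blast
  then show ?thesis
  proof cases
    case 1
    then show ?thesis using P1_prime a b by (simp add: chi_def)
  next
    case 2
    have u: "u \<notin> P 1" using 2 cong1_P1 P_power2_iff by blast
    have "a * b \<asymp> u\<^sup>2 * b" using 2 cong1_mult[OF cong1_sym] P0_power b by simp
    then have "chi (a * b) = chi b" using chi_cong chi_square_mult 2 u b by metis
    moreover have "chi a = 1" using 2 by (auto simp: chi_def)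
    ultimately show ?thesis by simp
  next
    case 3
    then have chi_a: "chi a = -1" by (simp add: chi_def)
    define g where "g v = Re (chi v + chi (a * v))" for v
    have nonpos: "g v \<le> 0" if "v \<in> R" for v
    proof -
      have v: "v \<in> P 0" using that R_subset by simp
      consider "chi v = 0" | "chi v = 1" | "chi v = -1" using chi_values by blast
      then show ?thesis
      proof cases
        case 1
        then have "v \<in> P 1" by (auto simp: chi_def split: if_splits)
        then have "a * v \<in> P 1" using P1_prime a v by simp
        with 1 show ?thesis by (simp add: g_def chi_def)
      next
        assume c1: "chi v = 1"
        then obtain u where u: "u \<in> P 0" "u\<^sup>2 \<asymp> v" "v \<notin> P 1"
          by (auto simp: chi_def split: if_splits)
        then have u1: "u \<notin> P 1" using cong1_P1 P_power2_iff by blast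
        have "a * v \<asymp> u\<^sup>2 * a"
          using u cong1_mult[OF cong1_sym[OF u(2)], of a a] P0_power a by (simp add: mult.commute)
        then have "chi (a * v) = chi a" using chi_cong chi_square_mult u u1 a by metis
        with c1 chi_a show ?thesis by (simp add: g_def)
      next
        assume "chi v = -1"
        then show ?thesis using chi_values[of "a * v"] by (auto simp: g_def)
      qed
    qed
    have "(\<Sum>v\<in>R. chi (a * v)) = 0"
      using sum_R_scale[of a chi] a 3(1) chi_cong sum_chi by simp
    then have "(\<Sum>v\<in>R. g v) = 0"
      using sum_chi by (simp add: g_def sum.distrib flip: Re_sum)
    then have z: "\<forall>v\<in>R. g v = 0"
      using sum_nonneg_eq_0_iff[OF finite_R, of "\<lambda>v. - g v"] nonpos by (simp add: sum_negf)
    have rb: "red b \<in> R" "red b \<asymp> b" using red_R red_cong b by auto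
    have "a * red b \<asymp> a * b" using rb cong1_mult a b by simp
    then have "chi b = chi (red b)" "chi (a * b) = chi (a * red b)" using chi_cong rb cong1_sym by metis+
    then have "Re (chi b + chi (a * b)) = 0" using z rb by (simp add: g_def)
    then have "chi (a * b) = - chi b" using chi_values[of b] chi_values[of "a * b"] by auto
    then show ?thesis using chi_a by simp
  qed
qed

text \<open>The two classical forms of the quadratic Gauss sum: in the root count
  \<open>1 + chi v\<close> the summand 1 drops out by orthogonality.\<close>

lemma sum_square_additive:
  assumes "additive_mod1 \<psi>"
  shows "(\<Sum>z\<in>R. \<psi> (z\<^sup>2)) = (\<Sum>v\<in>R. chi v * \<psi> v)"
  using sum_R_square[of \<psi>] sum_additive_mod1[OF assms] additive_mod1_cong[OF assms]
  by (simp add: distrib_right sum.distrib)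

text \<open>Replacing \<open>\<alpha> * v\<close> by \<open>v\<close> moves \<open>\<alpha>\<close>
  from the character into \<open>chi\<close>, and multiplicativity with
  \<open>chi \<alpha> * chi \<alpha> = 1\<close> takes it out.\<close>

lemma gauss_sum_scale:
  assumes \<psi>: "additive_mod1 \<psi>" and \<alpha>: "\<alpha> \<in> P 0" "\<alpha> \<notin> P 1"
  shows "(\<Sum>z\<in>R. \<psi> (\<alpha> * z\<^sup>2)) = chi \<alpha> * (\<Sum>z\<in>R. \<psi> (z\<^sup>2))"
proof -
  have \<alpha>_cong: "\<alpha> * x \<asymp> \<alpha> * y" if "x \<asymp> y" for x y using that \<alpha> cong1_unit_cancel by blast
  have chi_\<alpha>: "chi \<alpha> * chi \<alpha> = 1" using \<alpha> by (auto simp: chi_def)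
  have "(\<Sum>z\<in>R. \<psi> (\<alpha> * z\<^sup>2)) = (\<Sum>v\<in>R. (1 + chi v) * \<psi> (\<alpha> * v))"
    using sum_R_square[of "\<lambda>v. \<psi> (\<alpha> * v)"] additive_mod1_cong[OF \<psi>] \<alpha>_cong by blast
  also have "\<dots> = (\<Sum>v\<in>R. \<psi> (\<alpha> * v)) + (\<Sum>v\<in>R. chi \<alpha> * (chi (\<alpha> * v) * \<psi> (\<alpha> * v)))"
  proof -
    have "(1 + chi v) * \<psi> (\<alpha> * v) = \<psi> (\<alpha> * v) + chi \<alpha> * (chi (\<alpha> * v) * \<psi> (\<alpha> * v))"
      if "v \<in> R" for v
    proof -
      have "chi \<alpha> * (chi (\<alpha> * v) * \<psi> (\<alpha> * v)) = (chi \<alpha> * chi \<alpha>) * (chi v * \<psi> (\<alpha> * v))"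
        using chi_mult \<alpha>(1) R_subset[OF that] by simp
      also have "\<dots> = chi v * \<psi> (\<alpha> * v)" by (simp add: chi_\<alpha>)
      finally have "chi \<alpha> * (chi (\<alpha> * v) * \<psi> (\<alpha> * v)) = chi v * \<psi> (\<alpha> * v)" .
      then show ?thesis by (simp only: distrib_right mult_1)
    qed
    then show ?thesis by (simp add: sum.distrib)
  qed
  also have "(\<Sum>v\<in>R. \<psi> (\<alpha> * v)) = (\<Sum>v\<in>R. \<psi> v)"
    using additive_mod1_cong[OF \<psi>] \<alpha> by (intro sum_R_scale) auto
  also have "\<dots> = 0" using \<psi> by (rule sum_additive_mod1)
  also have "(\<Sum>v\<in>R. chi \<alpha> * (chi (\<alpha> * v) * \<psi> (\<alpha> * v))) = chi \<alpha> * (\<Sum>v\<in>R. chi v * \<psi> v)"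
    unfolding sum_distrib_left[symmetric]
    using additive_mod1_cong[OF \<psi>] chi_cong \<alpha>
    by (subst sum_R_scale[where f = "\<lambda>v. chi v * \<psi> v"]) (auto intro!: arg_cong2[where f = "(*)"])
  finally show ?thesis using sum_square_additive[OF \<psi>] by simp
qed

text \<open>Every non-zero square class has exactly two roots. This passage from squares to their
  roots is the origin of the factor 1/2 in the final formula.\<close>

lemma sum_unit_squares:
  fixes f :: "'a \<Rightarrow> complex"
  assumes "\<And>x y. x \<asymp> y \<Longrightarrow> f x = f y"
  shows "(\<Sum>u\<in>{u \<in> R. u \<notin> P 1}. f (u\<^sup>2)) = 2 * (\<Sum>v\<in>{v \<in> R. chi v = 1}. f v)"
proof -
  let ?A = "{u \<in> R. u \<notin> P 1}"
  have "(\<Sum>u\<in>?A. f (u\<^sup>2)) = (\<Sum>v\<in>R. of_nat (card {z \<in> ?A. z\<^sup>2 - v \<in> P 1}) * f v)"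
    using assms by (intro sum_R_by_value) (auto simp: R_subset P0_power cong1_def)
  also have "\<dots> = (\<Sum>v\<in>R. if chi v = 1 then 2 * f v else 0)"
  proof (rule sum.cong[OF refl])
    fix v assume v: "v \<in> R"
    show "of_nat (card {z \<in> ?A. z\<^sup>2 - v \<in> P 1}) * f v = (if chi v = 1 then 2 * f v else 0)"
    proof (cases "v \<in> P 1")
      case True
      then have "{z \<in> ?A. z\<^sup>2 - v \<in> P 1} = {}"
        using cong1_P1 P_power2_iff unfolding cong1_def by blast
      moreover have "chi v = 0" using True by (simp add: chi_def)
      ultimately show ?thesis by simp
    next
      case False
      then have "{z \<in> ?A. z\<^sup>2 - v \<in> P 1} = {z \<in> R. z\<^sup>2 - v \<in> P 1}"
        using cong1_P1 P_power2_iff unfolding cong1_def by blast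
      then have "of_nat (card {z \<in> ?A. z\<^sup>2 - v \<in> P 1}) = 1 + chi v"
        using card_square_roots R_subset[OF v] by simp
      moreover have "chi v = 1 \<or> chi v = -1" using False by (simp add: chi_def)
      ultimately show ?thesis by auto
    qed
  qed
  also have "\<dots> = (\<Sum>v\<in>{v \<in> R. chi v = 1}. 2 * f v)"
    by (rule sum.inter_filter[symmetric]) simp
  finally show ?thesis by (simp add: sum_distrib_left)
qed

end

section \<open>Evaluation of the character sum over unit squares\<close>

context nonarch_local_field_odd
begin

text \<open>The residue classes of \<open>u\<close> with \<open>\<kappa>\<^sup>2 u\<^sup>2 + 1/u\<^sup>2 = v\<close> correspond to pairs of square roots of
  \<open>v \<plusminus> 2 \<kappa>\<close>, namely \<open>\<kappa> u \<plusminus> 1/u\<close>.\<close>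

lemma card_salie_fibre:
  assumes \<kappa>: "\<kappa> \<in> P 0" "\<kappa> \<notin> P 1" and v: "v \<in> P 0"
  shows "of_nat (card {u \<in> {u \<in> R. u \<notin> P 1}. \<kappa>\<^sup>2 * u\<^sup>2 + inverse (u\<^sup>2) - v \<in> P 1}) =
    (1 + chi (v + 2 * \<kappa>)) * (1 + chi (v - 2 * \<kappa>))"
proof -
  let ?A = "{u \<in> {u \<in> R. u \<notin> P 1}. \<kappa>\<^sup>2 * u\<^sup>2 + inverse (u\<^sup>2) - v \<in> P 1}"
  let ?S = "\<lambda>x. {z \<in> R. z\<^sup>2 - x \<in> P 1}"
  let ?f = "\<lambda>u. (red (\<kappa> * u + inverse u), red (\<kappa> * u - inverse u))"
  \<comment> \<open>For \<open>p = \<kappa> u + 1/u\<close> and \<open>m = \<kappa> u - 1/u\<close>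
    the sum \<open>p + m\<close> is \<open>2 \<kappa> u\<close>, so this formula, reduced, inverts
    \<open>?f\<close>.\<close>
  let ?U = "\<lambda>p m. (p + m) / (2 * \<kappa>)"
  have \<kappa>0: "\<kappa> \<noteq> 0" using \<kappa> by auto
  have ord\<kappa>: "ord \<kappa> = 0" using \<kappa> by (auto simp: P_iff)
  have div2\<kappa>: "x / (2 * \<kappa>) \<in> P n \<longleftrightarrow> x \<in> P n" for x n
    using unit_mult_P_iff[OF ord\<kappa> \<kappa>0, of "x / (2 * \<kappa>)"] \<kappa>0 two_mult_P_iff[of "x / 2"] two_nonzero
    by (simp add: field_simps)
  have f: "?f u \<in> ?S (v + 2 * \<kappa>) \<times> ?S (v - 2 * \<kappa>)
      \<and> red (?U (fst (?f u)) (snd (?f u))) = u" if "u \<in> ?A" for u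
  proof -
    have u: "u \<in> R" "u \<in> P 0" "u \<notin> P 1" "u \<noteq> 0" "\<kappa>\<^sup>2 * u\<^sup>2 + inverse (u\<^sup>2) \<asymp> v"
      using that R_subset by (auto simp: cong1_def)
    have iu: "inverse u \<in> P 0" using inverse_unit u by blast
    have ku: "\<kappa> * u \<in> P 0" using P0_mult \<kappa> u by blast
    have p0: "\<kappa> * u + inverse u \<in> P 0" and m0: "\<kappa> * u - inverse u \<in> P 0"
      using P_add P_diff iu ku by auto
    have "(\<kappa> * u + inverse u)\<^sup>2 = \<kappa>\<^sup>2 * u\<^sup>2 + inverse (u\<^sup>2) + 2 * \<kappa>"
      "(\<kappa> * u - inverse u)\<^sup>2 = \<kappa>\<^sup>2 * u\<^sup>2 + inverse (u\<^sup>2) - 2 * \<kappa>"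
      using u(4) by (simp_all add: power2_eq_square field_simps)
    then have "(\<kappa> * u + inverse u)\<^sup>2 \<asymp> v + 2 * \<kappa>" "(\<kappa> * u - inverse u)\<^sup>2 \<asymp> v - 2 * \<kappa>"
      using cong1_add[OF u(5)] cong1_diff[OF u(5)] by simp_all
    moreover note cong1_power2[OF red_cong p0] cong1_power2[OF red_cong m0]
    ultimately have sq: "(red (\<kappa> * u + inverse u))\<^sup>2 \<asymp> v + 2 * \<kappa>" "(red (\<kappa> * u - inverse u))\<^sup>2 \<asymp> v - 2 * \<kappa>"
      using cong1_trans p0 m0 by blast+
    have "red (\<kappa> * u + inverse u) + red (\<kappa> * u - inverse u) - 2 * \<kappa> * u \<in> P 1"
      using cong1_add[OF red_cong[OF p0] red_cong[OF m0]] by (simp add: cong1_def mult.assoc)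
    then have "(red (\<kappa> * u + inverse u) + red (\<kappa> * u - inverse u) - 2 * \<kappa> * u) / (2 * \<kappa>) \<in> P 1"
      using div2\<kappa> by blast
    moreover have "(x - 2 * \<kappa> * u) / (2 * \<kappa>) = x / (2 * \<kappa>) - u" for x
      using \<kappa>0 two_nonzero by (simp add: field_simps)
    ultimately have c: "?U (red (\<kappa> * u + inverse u)) (red (\<kappa> * u - inverse u)) \<asymp> u"
      by (simp only: cong1_def)
    then have "red (?U (red (\<kappa> * u + inverse u)) (red (\<kappa> * u - inverse u))) = u"
      using red_eqI[OF u(1) cong1_sym[OF c]] cong1_P0 u(2) by blast
    with sq show ?thesis using p0 m0 by (simp add: cong1_def red_R)
  qed
  have f': "red (?U p m) \<in> ?A \<and> ?f (red (?U p m)) = (p, m)"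
    if "p \<in> ?S (v + 2 * \<kappa>)" "m \<in> ?S (v - 2 * \<kappa>)" for p m
  proof -
    have pm: "p \<in> R" "m \<in> R" "p \<in> P 0" "m \<in> P 0" "p\<^sup>2 \<asymp> v + 2 * \<kappa>" "m\<^sup>2 \<asymp> v - 2 * \<kappa>"
      using that R_subset by (auto simp: cong1_def)
    define U V where "U = ?U p m" and "V = (p - m) / 2"
    have U0: "U \<in> P 0" and V0: "V \<in> P 0" using pm P_add P_diff by (auto simp: U_def V_def div2\<kappa>)
    have p: "\<kappa> * U + V = p" and m: "\<kappa> * U - V = m"
    proof -
      have \<kappa>U: "\<kappa> * U = (p + m) / 2" using \<kappa>0 by (simp add: U_def)
      have "(p + m) / 2 + (p - m) / 2 = (2 * p) / 2" "(p + m) / 2 - (p - m) / 2 = (2 * m) / 2"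
        unfolding add_divide_distrib[symmetric] diff_divide_distrib[symmetric] by simp_all
      then show "\<kappa> * U + V = p" "\<kappa> * U - V = m"
        unfolding \<kappa>U V_def using two_nonzero by simp_all
    qed
    \<comment> \<open>Since \<open>p\<close> and \<open>m\<close> are \<open>\<kappa> U + V\<close>
      and \<open>\<kappa> U - V\<close>, the difference of their squares is
      \<open>4 \<kappa> U V\<close>; the hypotheses make it congruent to \<open>4 \<kappa>\<close>.
      Hence \<open>V\<close> is an inverse of \<open>U\<close> modulo \<open>P 1\<close>.\<close>
    have "p\<^sup>2 - m\<^sup>2 - 4 * \<kappa> \<in> P 1"
      using cong1_diff[OF pm(5,6)] by (simp add: cong1_def algebra_simps)
    moreover have "p\<^sup>2 - m\<^sup>2 - 4 * \<kappa> = \<kappa> * (2 * (2 * (U * V - 1)))"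
      by (simp add: p[symmetric] m[symmetric] power2_eq_square algebra_simps)
    ultimately have "\<kappa> * (2 * (2 * (U * V - 1))) \<in> P 1" by (simp only:)
    then have UV: "U * V \<asymp> 1"
      unfolding unit_mult_P_iff[OF ord\<kappa> \<kappa>0] two_mult_P_iff cong1_def .
    have U1: "U \<notin> P 1"
    proof
      assume "U \<in> P 1"
      then have "U * V \<in> P 1" using P_mult[of U 1 V 0] V0 by simp
      then show False using cong1_P1[OF UV] by (simp add: P_iff)
    qed
    have Unz: "U \<noteq> 0" using U1 by auto
    have "V \<asymp> inverse U"
      using cong1_unit_cancel[OF U0 U1, of V "inverse U"] UV Unz by simp
    have rU: "red U \<asymp> U" "red U \<in> R" using red_cong red_R U0 by auto
    have ru1: "red U \<notin> P 1" using cong1_P1 rU U1 by blast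
    have "inverse (red U) \<asymp> inverse U" using cong1_inverse rU U0 U1 by blast
    then have iU: "inverse (red U) \<asymp> V" using \<open>V \<asymp> inverse U\<close> cong1_sym cong1_trans by blast
    have \<kappa>U: "\<kappa> * red U \<asymp> \<kappa> * U" using cong1_unit_cancel \<kappa> rU by blast
    have c: "\<kappa> * red U + inverse (red U) \<asymp> p" "\<kappa> * red U - inverse (red U) \<asymp> m"
      using cong1_add[OF \<kappa>U iU] cong1_diff[OF \<kappa>U iU] p m by simp_all
    then have "red (\<kappa> * red U + inverse (red U)) = p" "red (\<kappa> * red U - inverse (red U)) = m"
      using red_eqI cong1_sym cong1_P0 pm by blast+
    moreover have "\<kappa>\<^sup>2 * (red U)\<^sup>2 + inverse ((red U)\<^sup>2) - v \<in> P 1"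
    proof -
      have "(\<kappa> * red U + inverse (red U))\<^sup>2 \<asymp> v + 2 * \<kappa>"
        using cong1_trans[OF cong1_power2[OF c(1) pm(3)] pm(5)] .
      moreover have "red U \<noteq> 0" using ru1 by auto
      then have "(\<kappa> * red U + inverse (red U))\<^sup>2 = \<kappa>\<^sup>2 * (red U)\<^sup>2 + inverse ((red U)\<^sup>2) + 2 * \<kappa>"
        by (simp add: power2_eq_square field_simps)
      ultimately show ?thesis by (simp add: cong1_def)
    qed
    ultimately show ?thesis using rU ru1 by (simp add: U_def)
  qed
  have "bij_betw ?f ?A (?S (v + 2 * \<kappa>) \<times> ?S (v - 2 * \<kappa>))"
    by (rule bij_betw_byWitness[where f' = "\<lambda>(p, m). red (?U p m)"]) (use f f' in \<open>force+\<close>)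
  then have "card ?A = card (?S (v + 2 * \<kappa>)) * card (?S (v - 2 * \<kappa>))"
    by (simp add: bij_betw_same_card card_cartesian_product)
  moreover have "v + 2 * \<kappa> \<in> P 0" "v - 2 * \<kappa> \<in> P 0"
    using P_add P_diff v \<kappa> by simp_all
  ultimately show ?thesis
    using card_square_roots by (simp only: of_nat_mult)
qed

text \<open>Of the four terms of the product the constant one vanishes by orthogonality. The two
  with a single \<open>chi\<close> become Gauss sums when \<open>v\<close> is translated, at the
  cost of a value of \<open>\<psi>\<close>; in the last one multiplicativity merges the two
  symbols.\<close>

lemma sum_unit_squares_inverse:
  assumes \<psi>: "additive_mod1 \<psi>" and \<kappa>: "\<kappa> \<in> P 0" "\<kappa> \<notin> P 1"
  shows "(\<Sum>u\<in>{u \<in> R. u \<notin> P 1}. \<psi> (\<kappa>\<^sup>2 * u\<^sup>2 + inverse (u\<^sup>2))) =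
    (\<Sum>v\<in>R. chi (v\<^sup>2 - 4 * \<kappa>\<^sup>2) * \<psi> v) + (\<psi> (2 * \<kappa>) + \<psi> (- (2 * \<kappa>))) * (\<Sum>z\<in>R. \<psi> (z\<^sup>2))"
proof -
  note \<psi>_cong = additive_mod1_cong[OF \<psi>]
  have \<psi>_add: "\<psi> (x + y) = \<psi> x * \<psi> y" for x y using \<psi> by (simp add: additive_mod1_def)
  have shift: "(\<Sum>v\<in>R. chi (v + a) * \<psi> v) = \<psi> (- a) * (\<Sum>z\<in>R. \<psi> (z\<^sup>2))" if a: "a \<in> P 0" for a
  proof -
    have "(\<Sum>v\<in>R. chi (v + a) * \<psi> v) = (\<Sum>v\<in>R. chi (v + a) * \<psi> ((v + a) + - a))" by simp
    also have "\<dots> = (\<Sum>v\<in>R. chi v * \<psi> (v + - a))"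
    proof (rule sum_R_shift[OF a])
      fix x y assume "x \<asymp> y"
      then show "chi x * \<psi> (x + - a) = chi y * \<psi> (y + - a)"
        using chi_cong \<psi>_cong[OF cong1_add[OF _ cong1_refl]] by (intro arg_cong2[where f = "(*)"]) blast+
    qed
    also have "\<dots> = \<psi> (- a) * (\<Sum>v\<in>R. chi v * \<psi> v)"
      unfolding \<psi>_add by (simp add: sum_distrib_left mult_ac)
    finally show ?thesis using sum_square_additive[OF \<psi>] by simp
  qed
  have "(\<Sum>u\<in>{u \<in> R. u \<notin> P 1}. \<psi> (\<kappa>\<^sup>2 * u\<^sup>2 + inverse (u\<^sup>2))) =
      (\<Sum>v\<in>R. of_nat (card {u \<in> {u \<in> R. u \<notin> P 1}. \<kappa>\<^sup>2 * u\<^sup>2 + inverse (u\<^sup>2) - v \<in> P 1}) * \<psi> v)"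
  proof (rule sum_R_by_value)
    fix u assume "u \<in> {u \<in> R. u \<notin> P 1}"
    then have "u\<^sup>2 \<in> P 0" "u\<^sup>2 \<notin> P 1" using R_subset P0_power P_power2_iff by auto
    then show "\<kappa>\<^sup>2 * u\<^sup>2 + inverse (u\<^sup>2) \<in> P 0"
      using P_add[OF P0_mult[OF P0_power[OF \<kappa>(1)]]] inverse_unit by simp
  qed (use \<psi>_cong in \<open>auto simp: cong1_def\<close>)
  also have "\<dots> = (\<Sum>v\<in>R. \<psi> v + chi (v + 2 * \<kappa>) * \<psi> v + chi (v + - (2 * \<kappa>)) * \<psi> v
      + chi (v\<^sup>2 - 4 * \<kappa>\<^sup>2) * \<psi> v)"
  proof (rule sum.cong[OF refl])
    fix v assume "v \<in> R"
    then have v: "v \<in> P 0" by (rule R_subset)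
    have "v + 2 * \<kappa> \<in> P 0" "v - 2 * \<kappa> \<in> P 0" using P_add P_diff v \<kappa> by simp_all
    then have "chi ((v + 2 * \<kappa>) * (v - 2 * \<kappa>)) = chi (v + 2 * \<kappa>) * chi (v - 2 * \<kappa>)"
      by (rule chi_mult)
    moreover have "(v + 2 * \<kappa>) * (v - 2 * \<kappa>) = v\<^sup>2 - 4 * \<kappa>\<^sup>2"
      by (simp add: power2_eq_square algebra_simps)
    ultimately have chi: "chi (v\<^sup>2 - 4 * \<kappa>\<^sup>2) = chi (v + 2 * \<kappa>) * chi (v - 2 * \<kappa>)"
      by (simp only:)
    show "of_nat (card {u \<in> {u \<in> R. u \<notin> P 1}. \<kappa>\<^sup>2 * u\<^sup>2 + inverse (u\<^sup>2) - v \<in> P 1}) * \<psi> v =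
        \<psi> v + chi (v + 2 * \<kappa>) * \<psi> v + chi (v + - (2 * \<kappa>)) * \<psi> v + chi (v\<^sup>2 - 4 * \<kappa>\<^sup>2) * \<psi> v"
      unfolding card_salie_fibre[OF \<kappa> v] chi by (simp add: algebra_simps)
  qed
  also have "\<dots> = (\<Sum>v\<in>R. chi (v\<^sup>2 - 4 * \<kappa>\<^sup>2) * \<psi> v)
      + (\<psi> (2 * \<kappa>) + \<psi> (- (2 * \<kappa>))) * (\<Sum>z\<in>R. \<psi> (z\<^sup>2))"
  proof -
    have "2 * \<kappa> \<in> P 0" "- (2 * \<kappa>) \<in> P 0" using \<kappa> by simp_all
    then show ?thesis
      using sum_additive_mod1[OF \<psi>] by (simp only: sum.distrib shift) (simp add: algebra_simps)
  qed
  finally show ?thesis .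
qed

end

section \<open>The norm group of a ramified quadratic extension\<close>

locale uniformised_field = nonarch_local_field_odd ord for ord :: "'a::field \<Rightarrow> int" +
  fixes w :: 'a
  assumes uniformiser: "uniformiser ord w"
begin

lemma w_nonzero [simp]: "w \<noteq> 0" and ord_w [simp]: "ord w = 1"
  using uniformiser by (simp_all add: uniformiser_def)

lemma ord_w_power [simp]: "ord ((- w) powi n) = n"
  by (simp add: ord_power_int)

lemma w_power_mult_P_iff [simp]: "(- w) powi n * x \<in> P m \<longleftrightarrow> x \<in> P (m - n)"
  by (simp add: P_mult_iff)

lemma w_power_add: "(- w) powi (m + n) = (- w) powi m * (- w) powi n"
  by (simp add: power_int_add)

text \<open>Powers of \<open>- w\<close> are split off rather than powers of \<open>w\<close>:
  \<open>- w\<close> is a norm, so the power has no influence on membership in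
  \<open>norm_group w\<close>.\<close>

lemma shell_unit_decomp:
  assumes "x \<noteq> 0"
  obtains u where "u \<in> P 0" "u \<notin> P 1" "x = (- w) powi ord x * u"
proof
  let ?u = "(- w) powi (- ord x) * x"
  show "?u \<in> P 0" "?u \<notin> P 1" using assms by (simp_all add: P_iff ord_mult)
  show "x = (- w) powi ord x * ?u" by (simp add: power_int_minus)
qed

text \<open>If the class of \<open>u\<close> is a square then so is \<open>u\<close>, because
  principal units are squares, and \<open>- w\<close> is a norm. Conversely the two terms of
  \<open>a\<^sup>2 - b\<^sup>2 * w\<close> have orders of different parity, so one dominates, and
  its unit part is a square.\<close>

lemma norm_group_iff:
  assumes u: "u \<in> P 0" "u \<notin> P 1"
  shows "(- w) powi n * u \<in> norm_group w \<longleftrightarrow> chi u = 1"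
proof
  assume "chi u = 1"
  then obtain y where y: "y \<in> P 0" "y\<^sup>2 \<asymp> u" by (auto simp: chi_def split: if_splits)
  have y1: "y \<notin> P 1" using cong1_P1[OF y(2)] u P_power2_iff by blast
  then have ynz: "y \<noteq> 0" and y2: "y\<^sup>2 \<in> P 0" "y\<^sup>2 \<notin> P 1" using y P0_power P_power2_iff by auto
  have "y\<^sup>2 * (u / y\<^sup>2) \<asymp> y\<^sup>2 * 1" using cong1_sym[OF y(2)] ynz by simp
  then have "u / y\<^sup>2 - 1 \<in> P 1" using cong1_unit_cancel[OF y2] by (simp only: cong1_def)
  then obtain z where z: "(1 + z)\<^sup>2 = 1 + (u / y\<^sup>2 - 1)" by (rule principal_unit_square)
  define a where "a = y * (1 + z)"
  have ua: "u = a\<^sup>2" using z ynz by (simp add: a_def power_mult_distrib)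
  then have anz: "a \<noteq> 0" using u by auto
  show "(- w) powi n * u \<in> norm_group w"
  proof (cases "even n")
    case True
    then obtain j where "n = j + j" by (metis evenE mult_2)
    then have "(- w) powi n = (- w) powi j * (- w) powi j" by (simp only: w_power_add)
    then have "(- w) powi n * u = ((- w) powi j * a)\<^sup>2 - 0\<^sup>2 * w"
      by (simp only: ua) (simp add: power2_eq_square)
    moreover have "(- w) powi j * a \<noteq> 0" using anz by simp
    ultimately show ?thesis unfolding norm_group_def by blast
  next
    case False
    then obtain j where "n = j + j + 1" by (metis oddE mult_2)
    then have "(- w) powi n = (- w) powi j * (- w) powi j * (- w)"
      by (simp only: w_power_add power_int_1_right)
    then have "(- w) powi n * u = 0\<^sup>2 - ((- w) powi j * a)\<^sup>2 * w"
      by (simp only: ua) (simp add: power2_eq_square)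
    moreover have "(- w) powi j * a \<noteq> 0" using anz by simp
    ultimately show ?thesis unfolding norm_group_def by blast
  qed
next
  assume "(- w) powi n * u \<in> norm_group w"
  then obtain a b where ab: "(- w) powi n * u = a\<^sup>2 - b\<^sup>2 * w" "a \<noteq> 0 \<or> b \<noteq> 0"
    by (auto simp: norm_group_def)
  have ordu: "ord u = 0" "u \<noteq> 0" using u by (auto simp: P_iff)
  \<comment> \<open>\<open>x\<^sup>2 * (- w) powi i\<close> is the dominating term, with
    \<open>i = 0\<close> if it is \<open>a\<^sup>2\<close> and \<open>i = 1\<close> if it is
    \<open>- b\<^sup>2 * w\<close>. Division by \<open>(- w) powi n\<close> shows \<open>u\<close>
    as a square plus an element of \<open>P 1\<close>.\<close>
  have key: "chi u = 1" if x: "x \<noteq> 0" and e: "(- w) powi n * u = x\<^sup>2 * (- w) powi i + y"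
    and y: "y \<in> P (2 * ord x + i + 1)" for x y i
  proof -
    have "ord (x\<^sup>2 * (- w) powi i) = 2 * ord x + i" using x by (simp add: ord_mult ord_power)
    then have "ord ((- w) powi n * u) = 2 * ord x + i"
      using ord_add_eq[of "x\<^sup>2 * (- w) powi i" y] x y e by simp
    then have n: "n = 2 * ord x + i" using ordu by (simp add: ord_mult)
    define c where "c = (- w) powi (- ord x) * x"
    have c: "c \<in> P 0" "c \<notin> P 1" using x by (simp_all add: c_def P_iff ord_mult)
    have "(- w) powi (- n) * (- w) powi i = (- w) powi (- ord x) * (- w) powi (- ord x)"
      unfolding w_power_add[symmetric] by (simp add: n)
    then have c2: "c\<^sup>2 = (- w) powi (- n) * (x\<^sup>2 * (- w) powi i)"
      by (simp add: c_def power2_eq_square algebra_simps)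
    have "(- w) powi (- n) * (- w) powi n = 1"
      unfolding w_power_add[symmetric] by simp
    then have "(- w) powi (- n) * ((- w) powi n * u) = u"
      by (simp only: mult.assoc[symmetric] mult_1)
    then have "u = c\<^sup>2 + (- w) powi (- n) * y"
      unfolding e distrib_left c2 by (rule sym)
    moreover have "(- w) powi (- n) * y \<in> P 1"
      unfolding w_power_mult_P_iff using y by (simp add: n algebra_simps)
    ultimately have "c\<^sup>2 \<asymp> u" by (simp add: cong1_def)
    then have "\<exists>y\<in>P 0. y\<^sup>2 \<asymp> u" using c by blast
    then show ?thesis using u by (simp add: chi_def)
  qed
  show "chi u = 1"
  proof (cases "a \<noteq> 0 \<and> (b = 0 \<or> ord a \<le> ord b)")
    case True
    then have "b\<^sup>2 * w \<in> P (2 * ord a + 1)"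
      by (cases "b = 0") (auto simp: P_iff ord_mult ord_power)
    with True show ?thesis using ab by (intro key[of a 0 "- (b\<^sup>2 * w)"]) auto
  next
    case False
    with ab(2) have b: "b \<noteq> 0" "a = 0 \<or> ord b < ord a" by auto
    then have "a\<^sup>2 \<in> P (2 * ord b + 2)" by (cases "a = 0") (auto simp: P_iff ord_power)
    with b show ?thesis using ab by (intro key[of b 1 "a\<^sup>2"]) (auto simp: add.commute)
  qed
qed

lemma sgn_norm_eq:
  assumes "u \<in> P 0" "u \<notin> P 1"
  shows "sgn_norm w ((- w) powi n * u) = chi u"
proof -
  have "u \<noteq> 0" using assms by auto
  moreover have "chi u \<noteq> 1 \<Longrightarrow> chi u = -1" using assms by (simp add: chi_def split: if_splits)
  ultimately show ?thesis using norm_group_iff[OF assms] by (auto simp: sgn_norm_def)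
qed

end

section \<open>Integration over shells\<close>

locale haar_field = uniformised_field +
  fixes \<mu> :: "'a measure"
  assumes haar: "normalised_haar ord \<mu>"
begin

abbreviation q :: real where "q \<equiv> real (residue_card ord)"

lemma space_haar [simp]: "space \<mu> = UNIV"
  and haar_P0: "emeasure \<mu> (P 0) = 1"
  and haar_translate: "A \<in> sets \<mu> \<Longrightarrow> emeasure \<mu> ((\<lambda>x. a + x) ` A) = emeasure \<mu> A"
  and sets_haar: "sets \<mu> = sigma_sets UNIV {U. openin (valuation_topology ord) U}"
  using haar by (auto simp: normalised_haar_def)

lemma open_in_sets:
  assumes "\<And>x. x \<in> U \<Longrightarrow> \<exists>n. \<forall>y. y - x \<in> P n \<longrightarrow> y \<in> U"
  shows "U \<in> sets \<mu>"
  unfolding sets_haar using assms openin_iff by (intro sigma_sets.Basic) blast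

definition coset :: "'a \<Rightarrow> int \<Rightarrow> 'a set" where "coset x n = {y. y - x \<in> P n}"

lemma coset_add: "y \<in> coset x n \<Longrightarrow> z \<in> P n \<Longrightarrow> y + z \<in> coset x n"
  using P_add[of "y - x" n z] by (simp add: coset_def algebra_simps)

lemma coset_sets [measurable]: "coset x n \<in> sets \<mu>"
proof (rule open_in_sets)
  fix y assume "y \<in> coset x n"
  then show "\<exists>m. \<forall>z. z - y \<in> P m \<longrightarrow> z \<in> coset x n"
    using coset_add[of y x n] by (intro exI[of _ n]) (metis add_diff_cancel_left' add.commute diff_add_cancel)
qed

text \<open>Every preimage under a locally constant function is open, hence measurable whatever the
  sigma-algebra of the target; only the condition on the range remains.\<close>

lemma locally_constant_measurable:
  assumes "\<And>x. \<exists>n. \<forall>z\<in>P n. F (x + z) = F x"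
  shows "F \<in> measurable \<mu> N \<longleftrightarrow> range F \<subseteq> space N"
proof
  assume "range F \<subseteq> space N"
  then show "F \<in> measurable \<mu> N"
  proof (intro measurableI)
    fix A
    have "F -` A \<in> sets \<mu>"
    proof (rule open_in_sets)
      fix x assume x: "x \<in> F -` A"
      from assms[of x] obtain n where n: "\<And>z. z \<in> P n \<Longrightarrow> F (x + z) = F x" by blast
      have "y \<in> F -` A" if "y - x \<in> P n" for y
        using n[OF that] x by simp
      then show "\<exists>n. \<forall>y. y - x \<in> P n \<longrightarrow> y \<in> F -` A" by blast
    qed
    then show "F -` A \<inter> space \<mu> \<in> sets \<mu>" by simp
  qed auto
qed (auto simp: measurable_def)

lemma translate_measurable: "(\<lambda>x. x + a) \<in> measurable \<mu> \<mu>"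
proof (rule measurable_sigma_sets[OF sets_haar])
  fix A assume "A \<in> {U. openin (valuation_topology ord) U}"
  then have A: "\<forall>x\<in>A. \<exists>n. \<forall>y. y - x \<in> P n \<longrightarrow> y \<in> A" using openin_iff by simp
  have "(\<lambda>x. x + a) -` A \<in> sets \<mu>"
  proof (rule open_in_sets)
    fix x assume "x \<in> (\<lambda>x. x + a) -` A"
    then obtain n where "\<And>y. y - (x + a) \<in> P n \<Longrightarrow> y \<in> A" using A by auto
    from this[of "_ + a"] show "\<exists>n. \<forall>y. y - x \<in> P n \<longrightarrow> y \<in> (\<lambda>x. x + a) -` A"
      by (intro exI[of _ n]) simp
  qed
  then show "(\<lambda>x. x + a) -` A \<inter> space \<mu> \<in> sets \<mu>" by simp
qed auto

lemma distr_translate: "distr \<mu> \<mu> (\<lambda>x. x + a) = \<mu>"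
proof (rule measure_eqI)
  fix A assume "A \<in> sets (distr \<mu> \<mu> (\<lambda>x. x + a))"
  then have A: "A \<in> sets \<mu>" by simp
  have "(\<lambda>x. x + a) -` A = (\<lambda>x. - a + x) ` A"
    by (force simp: image_iff)
  with A show "emeasure (distr \<mu> \<mu> (\<lambda>x. x + a)) A = emeasure \<mu> A"
    using haar_translate[OF A, of "- a"] by (simp add: emeasure_distr[OF translate_measurable A])
qed simp

lemma integral_translate:
  fixes F :: "'a \<Rightarrow> complex"
  assumes "F \<in> borel_measurable \<mu>"
  shows "(LINT x|\<mu>. F (x + a)) = (LINT x|\<mu>. F x)"
  using integral_distr[OF translate_measurable assms, of a] by (simp add: distr_translate)

lemma emeasure_coset: "emeasure \<mu> (coset x n) = emeasure \<mu> (P n)"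
proof -
  have "coset x n = (\<lambda>y. x + y) ` P n"
    by (force simp: coset_def image_iff)
  moreover have "P n = coset 0 n" by (simp add: coset_def)
  ultimately show ?thesis using haar_translate[of "P n" x] coset_sets[of 0 n] by simp
qed

lemma coset_disjoint:
  assumes "u \<in> R" "v \<in> R" "u \<noteq> v"
  shows "coset ((- w) powi n * u) (n + 1) \<inter> coset ((- w) powi n * v) (n + 1) = {}"
proof (rule ccontr)
  assume "\<not> ?thesis"
  then obtain y where "y - (- w) powi n * u \<in> P (n + 1)" "y - (- w) powi n * v \<in> P (n + 1)"
    by (auto simp: coset_def)
  from P_diff[OF this(2,1)] have "(- w) powi n * (u - v) \<in> P (n + 1)"
    by (simp add: algebra_simps)
  then have "u - v \<in> P 1" by (simp only: w_power_mult_P_iff) simp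
  then show False using assms R_eqI by blast
qed

text \<open>The index \<open>u\<close> is the residue class of \<open>x\<close> divided by
  \<open>(- w) powi n\<close>.\<close>

lemma P_decomp: "P n = (\<Union>u\<in>R. coset ((- w) powi n * u) (n + 1))"
proof (intro equalityI subsetI)
  fix x assume x: "x \<in> P n"
  define y where "y = (- w) powi (- n) * x"
  have y: "y \<in> P 0" using x by (simp only: y_def w_power_mult_P_iff) simp
  have xy: "x = (- w) powi n * y" by (simp add: y_def power_int_minus)
  have "(- w) powi n * (y - red y) \<in> P (n + 1)"
    using red(2)[OF y] by (simp only: w_power_mult_P_iff) simp
  then have "x \<in> coset ((- w) powi n * red y) (n + 1)"
    by (simp add: xy coset_def right_diff_distrib)
  then show "x \<in> (\<Union>u\<in>R. coset ((- w) powi n * u) (n + 1))" using red y by blast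
next
  fix x assume "x \<in> (\<Union>u\<in>R. coset ((- w) powi n * u) (n + 1))"
  then obtain u where u: "u \<in> R" "x - (- w) powi n * u \<in> P (n + 1)" by (auto simp: coset_def)
  have "(- w) powi n * u \<in> P n" using R_subset[OF u(1)] by (simp only: w_power_mult_P_iff) simp
  with P_mono[OF u(2), of n] P_add show "x \<in> P n" by fastforce
qed

lemma shell_decomp: "shell ord n = (\<Union>u\<in>{u \<in> R. u \<notin> P 1}. coset ((- w) powi n * u) (n + 1))"
proof -
  have shell: "x \<in> shell ord n \<longleftrightarrow> x \<in> P n \<and> x \<notin> P (n + 1)" for x
    by (auto simp: shell_def P_iff)
  have *: "x \<in> P (n + 1) \<longleftrightarrow> u \<in> P 1" if "x \<in> coset ((- w) powi n * u) (n + 1)" for x u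
  proof -
    have "x \<in> P (n + 1) \<longleftrightarrow> (- w) powi n * u \<in> P (n + 1)"
      using that P_diff[of x "n + 1" "x - (- w) powi n * u"]
        P_add[of "x - (- w) powi n * u" "n + 1" "(- w) powi n * u"] by (auto simp: coset_def)
    also have "\<dots> \<longleftrightarrow> u \<in> P 1" by (simp only: w_power_mult_P_iff) simp
    finally show ?thesis .
  qed
  show ?thesis
  proof (rule Set.set_eqI)
    fix x
    have "x \<in> P n \<longleftrightarrow> (\<exists>u\<in>R. x \<in> coset ((- w) powi n * u) (n + 1))"
      by (subst P_decomp) (rule UN_iff)
    then show "x \<in> shell ord n \<longleftrightarrow>
        x \<in> (\<Union>u\<in>{u \<in> R. u \<notin> P 1}. coset ((- w) powi n * u) (n + 1))"
      using shell[of x] *[of x] by auto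
  qed
qed

lemma residue_card_pos: "q > 0"
proof -
  have "R \<noteq> {}" using red(1)[of 0] by auto
  then show ?thesis using card_R card_gt_0_iff finite_R by (metis of_nat_0_less_iff)
qed

lemma q_powi_add: "q powi (a + b) = q powi a * q powi b"
  using residue_card_pos by (intro power_int_add) simp

lemma q_gt_1: "q > 1"
proof -
  have "red 0 \<noteq> red 1"
  proof
    assume "red 0 = red 1"
    then have "1 - red 0 - (0 - red 0) \<in> P 1"
      using P_diff red(2)[of 0] red(2)[of 1] by (metis P_ord ord_1 zero_in_P)
    then show False by (simp add: P_iff)
  qed
  moreover have "red 0 \<in> R" "red 1 \<in> R" using red(1)[of 0] red(1)[of 1] by (auto simp: P_iff)
  ultimately have "card {red 0, red 1} \<le> card R" "card {red 0, red 1} = 2"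
    using card_mono[OF finite_R, of "{red 0, red 1}"] by simp_all
  then show ?thesis by (simp add: card_R)
qed

lemma emeasure_P_step: "emeasure \<mu> (P n) = ennreal q * emeasure \<mu> (P (n + 1))"
proof -
  have "emeasure \<mu> (P n) = (\<Sum>u\<in>R. emeasure \<mu> (coset ((- w) powi n * u) (n + 1)))"
    unfolding P_decomp[of n]
    by (rule sum_emeasure[symmetric]) (auto simp: disjoint_family_on_def coset_disjoint)
  also have "\<dots> = ennreal q * emeasure \<mu> (P (n + 1))"
    by (simp add: emeasure_coset card_R ennreal_of_nat_eq_real_of_nat)
  finally show ?thesis .
qed

text \<open>Only \<open>P 0\<close> is normalised; the relation between neighbouring ideals carries
  its measure in both directions.\<close>

lemma emeasure_P: "emeasure \<mu> (P n) = ennreal (q powi (- n))"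
proof (induction n rule: int_induct[of _ 0])
  case base
  then show ?case by (simp add: haar_P0)
next
  case (step1 i)
  have "ennreal q * emeasure \<mu> (P (i + 1)) = ennreal q * ennreal (q powi (- (i + 1)))"
    using step1 emeasure_P_step[of i] residue_card_pos
    by (simp add: ennreal_mult[symmetric] power_int_diff power_int_minus field_simps)
  then show ?case
    using residue_card_pos by (simp add: ennreal_mult_cancel_left)
next
  case (step2 i)
  then show ?case
    using emeasure_P_step[of "i - 1"] residue_card_pos
    by (simp add: ennreal_mult[symmetric] power_int_diff power_int_minus field_simps)
qed

lemma measure_coset: "measure \<mu> (coset x n) = q powi (- n)"
  using residue_card_pos by (simp add: measure_def emeasure_coset emeasure_P)

lemma coset_integrable:
  fixes f :: "'a \<Rightarrow> complex"
  assumes f: "\<And>y z. y \<in> coset x n \<Longrightarrow> z \<in> P k \<Longrightarrow> f (y + z) = f y"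
    and B: "\<And>y. y \<in> coset x n \<Longrightarrow> cmod (f y) \<le> B"
  shows "set_integrable \<mu> (coset x n) f"
proof -
  let ?F = "\<lambda>y. indicator (coset x n) y *\<^sub>R f y"
  \<comment> \<open>Translation has to preserve both the coset, which needs \<open>P n\<close>, and
    \<open>f\<close>, which needs \<open>P k\<close>.\<close>
  have "?F (y + z) = ?F y" if z: "z \<in> P (max n k)" for y z
  proof -
    have "z \<in> P n" "z \<in> P k" using z P_mono by (meson max.cobounded1 max.cobounded2)+
    moreover have "y \<in> coset x n" if "y + z \<in> coset x n" "z \<in> P n"
      using coset_add[OF that(1), of "- z"] that(2) by simp
    ultimately show ?thesis using f[of y z] coset_add[of y x n z] by (auto simp: indicator_def)
  qed
  then have "?F \<in> borel_measurable \<mu>"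
    by (subst locally_constant_measurable) auto
  moreover have "emeasure \<mu> (coset x n) < \<infinity>"
    by (simp add: emeasure_coset emeasure_P)
  ultimately show ?thesis
    unfolding set_integrable_def
    using B by (intro integrableI_bounded_set[of "coset x n" _ _ B]) auto
qed

lemma integral_coset_const:
  fixes f :: "'a \<Rightarrow> complex"
  assumes "\<And>y. y \<in> coset x n \<Longrightarrow> f y = c"
  shows "(LINT y:coset x n|\<mu>. f y) = complex_of_real (q powi (- n)) * c"
proof -
  have "(LINT y:coset x n|\<mu>. f y) = (LINT y:coset x n|\<mu>. c)"
    using assms by (intro set_lebesgue_integral_cong) auto
  also have "\<dots> = (LINT y|\<mu>. indicator (coset x n) y *\<^sub>R c)"
    by (simp add: set_lebesgue_integral_def)
  also have "\<dots> = complex_of_real (q powi (- n)) * c"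
    by (simp add: emeasure_coset emeasure_P measure_coset scaleR_conv_of_real)
  finally show ?thesis .
qed

text \<open>Local constancy gives measurability. The condition on the modulus bounds
  \<open>f\<close> on each coset by its value at the centre, so that \<open>f\<close> is integrable
  there and the integral splits.\<close>

lemma shell_integral:
  fixes f :: "'a \<Rightarrow> complex"
  assumes f: "\<And>y z. y \<in> shell ord n \<Longrightarrow> z \<in> P k \<Longrightarrow> f (y + z) = f y"
    and B: "\<And>y z. y \<in> shell ord n \<Longrightarrow> z \<in> P (n + 1) \<Longrightarrow> cmod (f (y + z)) = cmod (f y)"
  shows "(LINT y:shell ord n|\<mu>. f y) =
    (\<Sum>u\<in>{u \<in> R. u \<notin> P 1}. LINT y:coset ((- w) powi n * u) (n + 1)|\<mu>. f y)"
  unfolding shell_decomp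
proof (rule set_integral_finite_Union)
  show "disjoint_family_on (\<lambda>u. coset ((- w) powi n * u) (n + 1)) {u \<in> R. u \<notin> P 1}"
    by (auto simp: disjoint_family_on_def coset_disjoint)
  fix u assume u: "u \<in> {u \<in> R. u \<notin> P 1}"
  let ?x = "(- w) powi n * u"
  have sub: "coset ?x (n + 1) \<subseteq> shell ord n" using u shell_decomp by blast
  have x: "?x \<in> shell ord n" using sub by (auto simp: coset_def)
  have "cmod (f y) \<le> cmod (f ?x)" if "y \<in> coset ?x (n + 1)" for y
    using B[OF x, of "y - ?x"] that by (simp add: coset_def)
  then show "set_integrable \<mu> (coset ?x (n + 1)) f"
    using f sub by (intro coset_integrable[where k = k]) auto
qed auto

text \<open>Translation by a suitable \<open>z\<close> multiplies the integral over each coset of \<open>P (n + 1)\<close> by a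
  constant different from \<open>1\<close>.\<close>

lemma shell_integral_eq_0:
  fixes f :: "'a \<Rightarrow> complex" and \<Psi> :: "'a \<Rightarrow> complex"
  assumes \<Psi>_add: "\<And>x y. \<Psi> (x + y) = \<Psi> x * \<Psi> y" and \<Psi>_1: "\<And>x. x \<in> P (h + 1) \<Longrightarrow> \<Psi> x = 1"
    and e: "e \<in> P h" "\<Psi> e \<noteq> 1"
    and k: "n + 1 \<le> k"
    and f: "\<And>x z. x \<in> shell ord n \<Longrightarrow> z \<in> P k \<Longrightarrow> f (x + z) = f x * \<Psi> (g x * z)"
    and g: "\<And>x. x \<in> shell ord n \<Longrightarrow> g x \<noteq> 0 \<and> ord (g x) = h - k"
      "\<And>x z. x \<in> shell ord n \<Longrightarrow> z \<in> P (n + 1) \<Longrightarrow> g (x + z) - g x \<in> P (h - k + 1)"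
    and B: "\<And>y z. y \<in> shell ord n \<Longrightarrow> z \<in> P (n + 1) \<Longrightarrow> cmod (f (y + z)) = cmod (f y)"
  shows "(LINT y:shell ord n|\<mu>. f y) = 0"
proof -
  have f_const: "f (y + z) = f y" if "y \<in> shell ord n" "z \<in> P (k + 1)" for y z
  proof -
    have "g y * z \<in> P (h + 1)"
      using g(1)[OF that(1)] P_mult[OF P_ord that(2), of "g y"] by simp
    then show ?thesis using f[OF that(1) P_mono[OF that(2)]] \<Psi>_1 by simp
  qed
  have "(LINT y:coset ((- w) powi n * u) (n + 1)|\<mu>. f y) = 0" if u: "u \<in> {u \<in> R. u \<notin> P 1}" for u
  proof -
    let ?x = "(- w) powi n * u"
    let ?C = "coset ?x (n + 1)"
    let ?F = "\<lambda>y. indicator ?C y *\<^sub>R f y"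
    have sub: "?C \<subseteq> shell ord n" using u shell_decomp by blast
    have x: "?x \<in> shell ord n" using sub by (auto simp: coset_def)
    \<comment> \<open>Chosen so that \<open>g ?x * z = e\<close>. The order of \<open>g\<close> puts
      \<open>z\<close> into \<open>P k\<close>, and the variation of \<open>g\<close> over the coset
      alters \<open>g y * z\<close> only by elements of \<open>P (h + 1)\<close>, so the factor
      \<open>\<Psi> e\<close> is the same for all \<open>y\<close>.\<close>
    define z where "z = e / g ?x"
    have z: "z \<in> P k" "g ?x * z = e"
      using g(1)[OF x] e \<Psi>_1[OF zero_in_P] by (cases "e = 0"; auto simp: z_def P_iff ord_divide)+
    then have zn: "z \<in> P (n + 1)" using k P_mono by blast
    have "f (y + z) = f y * \<Psi> e" if y: "y \<in> ?C" for y
    proof -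
      have "(g (?x + (y - ?x)) - g ?x) * z \<in> P (h - k + 1 + k)"
        using g(2)[OF x, of "y - ?x"] y z(1) by (intro P_mult) (simp_all add: coset_def)
      then have "\<Psi> ((g y - g ?x) * z) = 1" using \<Psi>_1 by simp
      moreover have "\<Psi> (g y * z) = \<Psi> ((g y - g ?x) * z) * \<Psi> (g ?x * z)"
        unfolding \<Psi>_add[symmetric] by (simp add: algebra_simps)
      ultimately show ?thesis using f y sub z by (simp add: subset_iff)
    qed
    moreover have "y + z \<in> ?C \<longleftrightarrow> y \<in> ?C" for y
      using coset_add[of y ?x "n + 1" z] coset_add[of "y + z" ?x "n + 1" "- z"] zn by auto
    ultimately have "?F (y + z) = ?F y * \<Psi> e" for y
      by (auto simp: indicator_def)
    moreover have "cmod (f y) \<le> cmod (f ?x)" if "y \<in> ?C" for y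
      using B[OF x, of "y - ?x"] that by (simp add: coset_def)
    then have "set_integrable \<mu> ?C f"
      using f_const sub by (intro coset_integrable[where k = "k + 1"]) auto
    then have "?F \<in> borel_measurable \<mu>" by (simp add: set_integrable_def)
    then have "(LINT y|\<mu>. ?F (y + z)) = (LINT y|\<mu>. ?F y)" by (rule integral_translate)
    ultimately have "(LINT y|\<mu>. ?F y) * \<Psi> e = (LINT y|\<mu>. ?F y)"
      by (simp only: integral_mult_left_zero)
    then show ?thesis using e(2) by (simp add: set_lebesgue_integral_def)
  qed
  then show ?thesis
    using shell_integral[OF f_const B] by simp
qed

end

text \<open>\<open>h\<close> is the depth of \<open>\<Psi>\<close>, expressed by its two kernel
  conditions instead of the least element in \<open>char_depth\<close>.\<close>

locale haar_field_character = haar_field +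
  fixes \<Psi> :: "'a \<Rightarrow> complex" and h :: int
  assumes \<Psi>_add: "\<Psi> (x + y) = \<Psi> x * \<Psi> y"
    and cmod_\<Psi> [simp]: "cmod (\<Psi> x) = 1"
    and \<Psi>_triv: "x \<in> P (h + 1) \<Longrightarrow> \<Psi> x = 1"
    and \<Psi>_nontriv: "\<exists>x\<in>P h. \<Psi> x \<noteq> 1"
begin

lemma \<Psi>_cong: "x - y \<in> P (h + 1) \<Longrightarrow> \<Psi> x = \<Psi> y"
  using \<Psi>_add[of "x - y" y] \<Psi>_triv[of "x - y"] by simp

text \<open>An element of order \<open>h\<close> carries \<open>P 0\<close> and \<open>P 1\<close>
  onto \<open>P h\<close> and \<open>P (h + 1)\<close>, which turns depth \<open>h\<close> into
  depth 0.\<close>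

lemma additive_mod1_scaled:
  assumes "c \<noteq> 0" "ord c = h" shows "additive_mod1 (\<lambda>v. \<Psi> (c * v))"
proof -
  obtain e where e: "e \<in> P h" "\<Psi> e \<noteq> 1" using \<Psi>_nontriv by blast
  then have "e \<noteq> 0" using \<Psi>_triv[OF zero_in_P] by auto
  then have "e / c \<in> P 0" using e assms by (simp add: P_iff ord_divide)
  moreover have "\<Psi> (c * (e / c)) \<noteq> 1" using e assms by simp
  moreover have "\<Psi> (c * x) = 1" if "x \<in> P 1" for x
    using that assms by (intro \<Psi>_triv) (simp add: P_mult_iff)
  ultimately show ?thesis
    unfolding additive_mod1_def by (metis distrib_left \<Psi>_add)
qed

lemma shell_integral_\<Psi>_eq_0:
  assumes "n + 1 \<le> k"
    and "\<And>x z. x \<in> shell ord n \<Longrightarrow> z \<in> P k \<Longrightarrow> f (x + z) = f x * \<Psi> (g x * z)"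
    and "\<And>x. x \<in> shell ord n \<Longrightarrow> g x \<noteq> 0 \<and> ord (g x) = h - k"
    and "\<And>x z. x \<in> shell ord n \<Longrightarrow> z \<in> P (n + 1) \<Longrightarrow> g (x + z) - g x \<in> P (h - k + 1)"
    and "\<And>y z. y \<in> shell ord n \<Longrightarrow> z \<in> P (n + 1) \<Longrightarrow> cmod (f (y + z)) = cmod (f y)"
  shows "(LINT y:shell ord n|\<mu>. f y) = 0"
proof -
  obtain e where e: "e \<in> P h" "\<Psi> e \<noteq> 1" using \<Psi>_nontriv by blast
  show ?thesis
    by (rule shell_integral_eq_0[of \<Psi> h e n k f g]) (fact \<Psi>_add \<Psi>_triv e assms)+
qed

text \<open>The phase \<open>b * t\<^sup>2\<close> has slope \<open>2 * b * t\<close> of order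
  \<open>ord b + l\<close>, hence \<open>k = h - ord b - l\<close>. The hypothesis says that
  \<open>k\<close> exceeds \<open>l\<close>; it also pushes the second-order term
  \<open>b * z\<^sup>2\<close> into \<open>P (h + 1)\<close>.\<close>

lemma quadratic_shell_eq_0:
  assumes b: "b \<noteq> 0" and l: "ord b + 2 * l < h"
  shows "(LINT t:shell ord l|\<mu>. \<Psi> (- (b * t\<^sup>2))) = 0"
proof (rule shell_integral_\<Psi>_eq_0[where k = "h - ord b - l" and g = "\<lambda>t. - (2 * b * t)"])
  fix t z assume t: "t \<in> shell ord l" and z: "z \<in> P (h - ord b - l)"
  have "b * (z * z) \<in> P (ord b + ((h - ord b - l) + (h - ord b - l)))"
    using z by (intro P_mult) auto
  then have "b * z\<^sup>2 \<in> P (h + 1)" using l by (auto simp: power2_eq_square intro: P_mono)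
  moreover have "- (b * (t + z)\<^sup>2) - (- (b * t\<^sup>2) + - (2 * b * t) * z) = - (b * z\<^sup>2)"
    by (simp add: power2_eq_square algebra_simps)
  ultimately have "\<Psi> (- (b * (t + z)\<^sup>2)) = \<Psi> (- (b * t\<^sup>2) + - (2 * b * t) * z)"
    by (intro \<Psi>_cong) simp
  then show "\<Psi> (- (b * (t + z)\<^sup>2)) = \<Psi> (- (b * t\<^sup>2)) * \<Psi> (- (2 * b * t) * z)"
    by (simp only: \<Psi>_add)
next
  fix t z assume t: "t \<in> shell ord l" and z: "z \<in> P (l + 1)"
  have "2 * (b * z) \<in> P (h - (h - ord b - l) + 1)"
    unfolding two_mult_P_iff using P_mult[OF P_ord z, of b] by (simp add: algebra_simps)
  moreover have "- (2 * b * (t + z)) - - (2 * b * t) = - (2 * (b * z))" by (simp add: algebra_simps)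
  ultimately show "- (2 * b * (t + z)) - - (2 * b * t) \<in> P (h - (h - ord b - l) + 1)" by simp
qed (use b l in \<open>auto simp: shell_def ord_mult two_nonzero\<close>)

text \<open>The quadratic Gauss integral over the whole field. With \<open>b = s / x\<close> it is
  the part of the inner integral of the transform that involves \<open>t\<close>.\<close>

definition J :: "'a \<Rightarrow> complex" where
  "J b = (\<Sum>\<^sub>\<infinity>l::int. LINT t:shell ord l|\<mu>. \<Psi> (- (b * t\<^sup>2)))"

text \<open>The equality holds shell by shell: for \<open>ord b + 2 * l < h\<close> both integrals
  vanish, and otherwise \<open>d * t\<^sup>2\<close> lies in \<open>P (h + 1)\<close>. So the inner
  integral is constant on the cosets used for translation, whatever its value.\<close>

lemma J_cong:
  assumes b: "b \<noteq> 0" "d \<in> P (ord b + 1)"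
  shows "J (b + d) = J b"
  unfolding J_def
proof (rule infsum_cong)
  fix l :: int
  have b': "b + d \<noteq> 0" "ord (b + d) = ord b" using ord_add_eq[OF b] by auto
  show "(LINT t:shell ord l|\<mu>. \<Psi> (- ((b + d) * t\<^sup>2))) = (LINT t:shell ord l|\<mu>. \<Psi> (- (b * t\<^sup>2)))"
  proof (cases "ord b + 2 * l < h")
    case True
    then show ?thesis using quadratic_shell_eq_0 b b' by simp
  next
    case False
    have "\<Psi> (- ((b + d) * t\<^sup>2)) = \<Psi> (- (b * t\<^sup>2))" if "t \<in> shell ord l" for t
    proof (rule \<Psi>_cong)
      have "t \<in> P l" using that by (simp add: shell_def P_iff)
      then have "d * (t * t) \<in> P (ord b + 1 + (l + l))" using b by (intro P_mult) auto
      then have "d * t\<^sup>2 \<in> P (h + 1)" using False by (auto simp: power2_eq_square intro: P_mono)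
      moreover have "- ((b + d) * t\<^sup>2) - - (b * t\<^sup>2) = - (d * t\<^sup>2)" by (simp add: algebra_simps)
      ultimately show "- ((b + d) * t\<^sup>2) - - (b * t\<^sup>2) \<in> P (h + 1)" by simp
    qed
    then have "indicator (shell ord l) t *\<^sub>R \<Psi> (- ((b + d) * t\<^sup>2)) =
        indicator (shell ord l) t *\<^sub>R \<Psi> (- (b * t\<^sup>2))" for t
      by (auto simp: indicator_def)
    then show ?thesis unfolding set_lebesgue_integral_def by (simp only:)
  qed
qed

lemma card_units: "of_nat (card {u \<in> R. u \<notin> P 1}) = complex_of_real (q - 1)"
proof -
  have "u = red 0" if "u \<in> R" "u \<in> P 1" for u using red_unique[of 0 u] that by simp
  moreover have r: "red 0 \<in> R" "red 0 \<in> P 1" using red[of 0] by simp_all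
  ultimately have "{u \<in> R. u \<notin> P 1} = R - {red 0}" by blast
  then have "card {u \<in> R. u \<notin> P 1} = residue_card ord - 1" using r by (simp add: card_R)
  then show ?thesis using residue_card_pos by (simp add: of_nat_diff)
qed

lemma shell_integral_1:
  "(LINT t:shell ord n|\<mu>. (1::complex)) = complex_of_real ((q - 1) * q powi (- (n + 1)))"
proof -
  have "(LINT t:shell ord n|\<mu>. (1::complex)) =
      (\<Sum>u\<in>{u \<in> R. u \<notin> P 1}. LINT t:coset ((- w) powi n * u) (n + 1)|\<mu>. 1)"
    by (rule shell_integral) auto
  also have "\<dots> = (\<Sum>u\<in>{u \<in> R. u \<notin> P 1}. complex_of_real (q powi (- (n + 1))))"
    by (intro sum.cong) (auto simp: integral_coset_const[where c = 1])
  also have "\<dots> = complex_of_real ((q - 1) * q powi (- (n + 1)))"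
    unfolding sum_constant card_units by simp
  finally show ?thesis .
qed

text \<open>As \<open>ord b = h - 1\<close>, no shell has \<open>ord b + 2 * l = h\<close>, the case
  that would yield a Gauss sum: the shells with \<open>l \<le> 0\<close> vanish, and for
  \<open>l \<ge> 1\<close> the integrand is 1. The value is the volume of \<open>P 1\<close>,
  obtained as a geometric series because \<open>J\<close> is a sum over shells.\<close>

lemma J_eq:
  assumes b: "b \<noteq> 0" "ord b = h - 1"
  shows "J b = complex_of_real (1 / q)"
proof -
  let ?c = "complex_of_real ((q - 1) / q)" and ?z = "complex_of_real (1 / q)"
  have zero: "(LINT t:shell ord l|\<mu>. \<Psi> (- (b * t\<^sup>2))) = 0" if "l \<le> 0" for l
    using quadratic_shell_eq_0 b that by simp
  have pos: "(LINT t:shell ord l|\<mu>. \<Psi> (- (b * t\<^sup>2))) = ?c * ?z ^ nat l" if "l \<ge> 1" for l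
  proof -
    have "\<Psi> (- (b * t\<^sup>2)) = 1" if "t \<in> shell ord l" for t
    proof (rule \<Psi>_triv)
      have "t \<in> P l" using that by (simp add: shell_def P_iff)
      then have "b * (t * t) \<in> P (h - 1 + (l + l))" using b P_ord[of b] by (intro P_mult) auto
      then show "- (b * t\<^sup>2) \<in> P (h + 1)" using \<open>l \<ge> 1\<close> by (auto simp: power2_eq_square intro: P_mono)
    qed
    then have "indicator (shell ord l) t *\<^sub>R \<Psi> (- (b * t\<^sup>2)) =
        indicator (shell ord l) t *\<^sub>R (1::complex)" for t
      by (auto simp: indicator_def)
    then have "(LINT t:shell ord l|\<mu>. \<Psi> (- (b * t\<^sup>2))) = (LINT t:shell ord l|\<mu>. (1::complex))"
      unfolding set_lebesgue_integral_def by (simp only:)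
    also have "\<dots> = complex_of_real ((q - 1) * q powi (- (l + 1)))" by (rule shell_integral_1)
    also have "(q - 1) * q powi (- (l + 1)) = (q - 1) / q * (1 / q) ^ nat l"
    proof -
      obtain m where "l = int m" using \<open>l \<ge> 1\<close> by (metis nonneg_int_cases order_trans zero_le_one)
      moreover have "q powi (- (l + 1)) = q powi (- l) * q powi (- 1)"
        unfolding q_powi_add[symmetric] by simp
      ultimately show ?thesis
        by (simp add: power_int_minus power_divide divide_inverse power_inverse)
    qed
    finally show ?thesis by simp
  qed
  have "((\<lambda>m. ?z ^ m) has_sum (?z / (1 - ?z))) {1..}"
    by (rule has_sum_geometric_from_1) (use q_gt_1 in \<open>simp add: norm_divide\<close>)
  moreover have "bij_betw nat {1..} {1..}"
    by (rule bij_betw_byWitness[where f' = int]) auto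
  ultimately have "((\<lambda>l. ?z ^ nat l) has_sum (?z / (1 - ?z))) {1..}"
    using has_sum_reindex_bij_betw by blast
  then have "((\<lambda>l. ?c * ?z ^ nat l) has_sum (?c * (?z / (1 - ?z)))) {1..}"
    by (rule has_sum_cmult_right)
  then have "(\<Sum>\<^sub>\<infinity>l\<in>{1..}. ?c * ?z ^ nat l) = ?c * (?z / (1 - ?z))" by (rule infsumI)
  moreover have "J b = (\<Sum>\<^sub>\<infinity>l\<in>{1..}. ?c * ?z ^ nat l)"
    unfolding J_def by (rule infsum_cong_neutral) (auto simp: zero pos)
  moreover have "(q - 1) / q * ((1 / q) / (1 - 1 / q)) = 1 / q"
    using q_gt_1 by (simp add: field_simps)
  then have "?c * (?z / (1 - ?z)) = ?z"
    by (metis of_real_1 of_real_diff of_real_divide of_real_mult)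
  ultimately show ?thesis by simp
qed

text \<open>A relative change by an element of \<open>P 1\<close> keeps the residue class of the
  unit part, which decides membership.\<close>

lemma norm_group_shell_cong:
  assumes "x \<in> shell ord n" "z \<in> P (n + 1)"
  shows "x + z \<in> norm_group w \<longleftrightarrow> x \<in> norm_group w"
proof -
  have x: "x \<noteq> 0" "ord x = n" using assms by (auto simp: shell_def)
  obtain u where u: "u \<in> P 0" "u \<notin> P 1" "x = (- w) powi n * u"
    using shell_unit_decomp[OF x(1)] x(2) by metis
  define v where "v = (- w) powi (- n) * z"
  have v: "v \<in> P 1" unfolding v_def w_power_mult_P_iff using assms(2) by (simp add: add.commute)
  have xz: "x + z = (- w) powi n * (u + v)"
    by (simp add: u(3) v_def distrib_left power_int_minus)
  have c: "u + v \<asymp> u" using v by (simp add: cong1_def)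
  then have "u + v \<in> P 0" "u + v \<notin> P 1" using u cong1_P0 cong1_P1 by blast+
  then have "x + z \<in> norm_group w \<longleftrightarrow> chi (u + v) = 1" unfolding xz by (rule norm_group_iff)
  also have "\<dots> \<longleftrightarrow> x \<in> norm_group w"
    unfolding u(3) norm_group_iff[OF u(1,2)] chi_cong[OF c] ..
  finally show ?thesis .
qed

end

section \<open>The mock Fourier transform as a character sum\<close>

text \<open>\<open>y\<close> is the coefficient of the stable conjugate \<open>sqrt_mat y w\<close>.
  Its depth is \<open>ord y + 1/2\<close> and that of the functional is \<open>1/2 - h\<close>, so
  \<open>ord y = h - 1\<close> is the depth hypothesis of the theorem.\<close>

locale mock_transform = haar_field_character +
  fixes s \<theta>' y :: 'a
  assumes s: "s \<noteq> 0" and y: "y \<noteq> 0" and ord_y: "ord y = h - 1" and y_eq: "y\<^sup>2 * w = s\<^sup>2 * \<theta>'"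
begin

lemma \<theta>'_eq: "\<theta>' = w * (y / s)\<^sup>2"
  using y_eq s by (simp add: power_divide field_simps)

lemma \<theta>'_nonzero: "\<theta>' \<noteq> 0"
  using \<theta>'_eq y s by simp

lemma ord_\<theta>': "ord \<theta>' = 2 * h - 1 - 2 * ord s"
  using y s by (simp add: \<theta>'_eq ord_mult ord_power ord_divide ord_y)

text \<open>The outer integrand, after the part of the phase free of \<open>t\<close> has been taken
  out of the inner integral.\<close>

definition f :: "'a \<Rightarrow> complex" where
  "f x = indicator (norm_group w) x * (\<Psi> (s * (x * \<theta>' + inverse x * w)) * J (s * inverse x)) *
    complex_of_real (1 / abs_val ord x)"

text \<open>For \<open>x = (- w)^n0 * u\<close> the phase \<open>s (x \<theta>' + w / x)\<close> equals \<open>c2 (\<kappa>\<^sup>2 u + 1 / u)\<close>; the index \<open>n0\<close> is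
  the one for which both of its terms have order \<open>h\<close>.\<close>

definition n0 :: int where "n0 = ord s + 1 - h"

definition \<kappa> :: 'a where "\<kappa> = (y / s) * (- w) powi n0"

definition c2 :: 'a where "c2 = s * w * (- w) powi (- n0)"

text \<open>The only part of \<open>f\<close> that varies on a coset of \<open>P (n + 1)\<close> is the value of \<open>\<Psi>\<close>.\<close>

lemma f_shift:
  assumes x: "x \<in> shell ord n" and z: "z \<in> P (n + 1)"
  shows "f (x + z) = f x * \<Psi> (s * \<theta>' * z - s * w * z / (x * (x + z)))"
proof -
  have x': "x \<noteq> 0" "ord x = n" using x by (auto simp: shell_def)
  have xz: "x + z \<noteq> 0" "ord (x + z) = n" using shell_add[OF x z] by (auto simp: shell_def)
  have d: "inverse (x + z) = inverse x - z / (x * (x + z))"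
    using x' xz by (simp add: divide_simps)
  have "z / (x * (x + z)) \<in> P (1 - n)"
    using z x' xz by (cases "z = 0") (auto simp: P_iff ord_divide ord_mult)
  then have "s * (z / (x * (x + z))) \<in> P (ord s + (1 - n))" by (intro P_mult) auto
  then have "J (s * inverse x + - (s * (z / (x * (x + z))))) = J (s * inverse x)"
    using s x' by (intro J_cong) (simp_all add: ord_mult ord_inverse algebra_simps)
  then have J: "J (s * inverse (x + z)) = J (s * inverse x)"
    by (simp add: d right_diff_distrib)
  have "s * ((x + z) * \<theta>' + inverse (x + z) * w) =
      s * (x * \<theta>' + inverse x * w) + (s * \<theta>' * z - s * w * z / (x * (x + z)))"
    unfolding d by (simp add: algebra_simps)
  then have "\<Psi> (s * ((x + z) * \<theta>' + inverse (x + z) * w)) =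
      \<Psi> (s * (x * \<theta>' + inverse x * w)) * \<Psi> (s * \<theta>' * z - s * w * z / (x * (x + z)))"
    by (simp only: \<Psi>_add)
  moreover have "indicator (norm_group w) (x + z) = (indicator (norm_group w) x :: complex)"
    using norm_group_shell_cong[OF x z] by (simp add: indicator_def)
  moreover have "abs_val ord (x + z) = abs_val ord x"
    using x' xz by (simp add: abs_val_def)
  ultimately show ?thesis unfolding f_def J by (simp add: mult_ac)
qed

lemma cmod_f_shift:
  "x \<in> shell ord n \<Longrightarrow> z \<in> P (n + 1) \<Longrightarrow> cmod (f (x + z)) = cmod (f x)"
  using f_shift by (simp add: norm_mult)

text \<open>For \<open>n > n0\<close> the term \<open>s * w / x\<close> oscillates and must be
  linearised, with a slope that varies with \<open>x\<close>; for \<open>n < n0\<close> it is the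
  term \<open>s * x * \<theta>'\<close>, already linear with constant slope. The other term is
  constant under the translations in question.\<close>

lemma shell_integral_f_eq_0:
  assumes "n \<noteq> n0"
  shows "(LINT x:shell ord n|\<mu>. f x) = 0"
proof (cases "n > n0")
  case True
  \<comment> \<open>The slope \<open>- (s * w / x\<^sup>2)\<close> has order
    \<open>h + n0 - 2 * n\<close>, which has to be \<open>h - k\<close>.\<close>
  define k where "k = 2 * n - n0"
  have kn: "n + 1 \<le> k" using True by (simp add: k_def)
  show ?thesis
  proof (rule shell_integral_\<Psi>_eq_0[where k = k and g = "\<lambda>x. - (s * w / x\<^sup>2)"])
    fix x z assume x: "x \<in> shell ord n" and z: "z \<in> P k"
    have x': "x \<noteq> 0" "ord x = n" using x by (auto simp: shell_def)
    have zn: "z \<in> P (n + 1)" using z kn by (rule P_mono)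
    have xz: "x + z \<noteq> 0" "ord (x + z) = n" using shell_add[OF x zn] by (auto simp: shell_def)
    \<comment> \<open>Two errors lie in the kernel of \<open>\<Psi>\<close>: the change of the
      linear term, and the second-order remainder of the expansion of
      \<open>1 / (x + z)\<close>.\<close>
    have "s * \<theta>' * z \<in> P (h + 1)"
      using z s True \<theta>'_nonzero
      by (cases "z = 0") (auto simp: P_iff ord_mult ord_\<theta>' k_def n0_def)
    moreover have "s * w * z\<^sup>2 / (x\<^sup>2 * (x + z)) \<in> P (h + 1)"
      using z s True x' xz
      by (cases "z = 0") (auto simp: P_iff ord_mult ord_divide ord_power k_def n0_def)
    ultimately have "s * \<theta>' * z + s * w * z\<^sup>2 / (x\<^sup>2 * (x + z)) \<in> P (h + 1)"
      by (rule P_add)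
    moreover have "(s * \<theta>' * z - s * w * z / (x * (x + z))) - (- (s * w / x\<^sup>2) * z) =
        s * \<theta>' * z + s * w * z\<^sup>2 / (x\<^sup>2 * (x + z))"
      using x' xz by (simp add: divide_simps) (simp add: power2_eq_square algebra_simps)
    ultimately have "\<Psi> (s * \<theta>' * z - s * w * z / (x * (x + z))) = \<Psi> (- (s * w / x\<^sup>2) * z)"
      by (intro \<Psi>_cong) (simp only:)
    then show "f (x + z) = f x * \<Psi> (- (s * w / x\<^sup>2) * z)"
      using f_shift[OF x zn] by simp
  next
    fix x z assume x: "x \<in> shell ord n" and z: "z \<in> P (n + 1)"
    have x': "x \<noteq> 0" "ord x = n" using x by (auto simp: shell_def)
    have xz: "x + z \<noteq> 0" "ord (x + z) = n" using shell_add[OF x z] by (auto simp: shell_def)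
    have "2 * x \<in> P n" unfolding two_mult_P_iff using x' by (simp add: P_iff)
    then have "2 * x + z \<in> P n" using z by (intro P_add) (auto intro: P_mono)
    then have "s * w / (x\<^sup>2 * (x + z)\<^sup>2) * ((2 * x + z) * z) \<in> P (ord (s * w / (x\<^sup>2 * (x + z)\<^sup>2)) + (n + (n + 1)))"
      using z by (intro P_mult) auto
    moreover have "ord (s * w / (x\<^sup>2 * (x + z)\<^sup>2)) + (n + (n + 1)) = h - k + 1"
      using s x' xz by (simp add: ord_mult ord_divide ord_power k_def n0_def)
    moreover have "- (s * w / (x + z)\<^sup>2) - - (s * w / x\<^sup>2) = s * w / (x\<^sup>2 * (x + z)\<^sup>2) * ((2 * x + z) * z)"
      using x' xz by (simp add: divide_simps) (simp add: power2_eq_square algebra_simps)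
    ultimately show "- (s * w / (x + z)\<^sup>2) - - (s * w / x\<^sup>2) \<in> P (h - k + 1)" by (simp only:)
  next
    fix x assume "x \<in> shell ord n"
    then show "- (s * w / x\<^sup>2) \<noteq> 0 \<and> ord (- (s * w / x\<^sup>2)) = h - k"
      using s by (auto simp: shell_def ord_mult ord_divide ord_power k_def n0_def)
  qed (use kn cmod_f_shift in auto)
next
  case False
  \<comment> \<open>The slope \<open>s * \<theta>'\<close> has order \<open>h - n0\<close>.\<close>
  define k where "k = n0"
  have kn: "n + 1 \<le> k" using False assms by (simp add: k_def)
  show ?thesis
  proof (rule shell_integral_\<Psi>_eq_0[where k = k and g = "\<lambda>x. s * \<theta>'"])
    fix x z assume x: "x \<in> shell ord n" and z: "z \<in> P k"
    have x': "x \<noteq> 0" "ord x = n" using x by (auto simp: shell_def)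
    have zn: "z \<in> P (n + 1)" using z kn by (rule P_mono)
    have xz: "x + z \<noteq> 0" "ord (x + z) = n" using shell_add[OF x zn] by (auto simp: shell_def)
    have "s * w * z / (x * (x + z)) \<in> P (h + 1)"
      using z s kn x' xz
      by (cases "z = 0") (auto simp: P_iff ord_mult ord_divide k_def n0_def)
    then have "\<Psi> (s * \<theta>' * z - s * w * z / (x * (x + z))) = \<Psi> (s * \<theta>' * z)"
      by (intro \<Psi>_cong) simp
    then show "f (x + z) = f x * \<Psi> (s * \<theta>' * z)"
      using f_shift[OF x zn] by simp
  next
    show "s * \<theta>' \<noteq> 0 \<and> ord (s * \<theta>') = h - k"
      using s \<theta>'_nonzero by (simp add: ord_mult ord_\<theta>' k_def n0_def)
  qed (use kn cmod_f_shift in auto)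
qed

lemma ord_\<kappa>: "\<kappa> \<noteq> 0" "ord \<kappa> = 0"
  using s y by (simp_all add: \<kappa>_def ord_mult ord_divide ord_y n0_def)

lemma ord_c2: "c2 \<noteq> 0" "ord c2 = h"
  using s by (simp_all add: c2_def ord_mult n0_def)

text \<open>Thus \<open>\<Psi> (c2 * (2 * \<kappa>))\<close> is \<open>\<Psi> (2 * (y * w))\<close>,
  the character at the pairing with the stable conjugate; this makes the values at
  \<open>2 \<kappa>\<close> and \<open>- 2 \<kappa>\<close> the Weyl group terms.\<close>

lemma c2_\<kappa>: "c2 * \<kappa> = y * w"
  using s by (simp add: c2_def \<kappa>_def power_int_minus)

text \<open>At the balanced index \<open>f\<close> is constant on cosets of
  \<open>P (n0 + 1)\<close>. The power \<open>q powi (- 2)\<close> collects the coset volume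
  \<open>q powi (- (n0 + 1))\<close>, the factor \<open>q powi n0\<close> from the multiplicative
  measure and the inner integral \<open>1 / q\<close>.\<close>

lemma shell_integral_f:
  "(LINT x:shell ord n0|\<mu>. f x) = complex_of_real (q powi (- 2)) *
    (\<Sum>u\<in>{u \<in> R. chi u = 1}. \<Psi> (c2 * (\<kappa>\<^sup>2 * u + inverse u)))"
proof -
  have const: "f (x + z) = f x" if x: "x \<in> shell ord n0" and z: "z \<in> P (n0 + 1)" for x z
  proof -
    have x': "x \<noteq> 0" "ord x = n0" using x by (auto simp: shell_def)
    have xz: "x + z \<noteq> 0" "ord (x + z) = n0" using shell_add[OF x z] by (auto simp: shell_def)
    have "s * \<theta>' * z \<in> P (h + 1)"
      using z s \<theta>'_nonzero by (cases "z = 0") (auto simp: P_iff ord_mult ord_\<theta>' n0_def)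
    moreover have "s * w * z / (x * (x + z)) \<in> P (h + 1)"
      using z s x' xz by (cases "z = 0") (auto simp: P_iff ord_mult ord_divide n0_def)
    ultimately have "s * \<theta>' * z - s * w * z / (x * (x + z)) \<in> P (h + 1)" by (rule P_diff)
    then show ?thesis using f_shift[OF x z] \<Psi>_triv by simp
  qed
  have "(LINT x:shell ord n0|\<mu>. f x) =
      (\<Sum>u\<in>{u \<in> R. u \<notin> P 1}. LINT x:coset ((- w) powi n0 * u) (n0 + 1)|\<mu>. f x)"
    using const cmod_f_shift by (rule shell_integral)
  also have "\<dots> = (\<Sum>u\<in>{u \<in> R. u \<notin> P 1}. if chi u = 1
      then complex_of_real (q powi (- 2)) * \<Psi> (c2 * (\<kappa>\<^sup>2 * u + inverse u)) else 0)"
  proof (rule sum.cong[OF refl])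
    fix u assume u: "u \<in> {u \<in> R. u \<notin> P 1}"
    let ?x = "(- w) powi n0 * u"
    have u': "u \<in> P 0" "u \<notin> P 1" "u \<noteq> 0" "ord u = 0"
      using u R_subset not_P1_iff by auto
    have x: "?x \<in> shell ord n0" using u' by (simp add: shell_def ord_mult)
    have "f z = f ?x" if "z \<in> coset ?x (n0 + 1)" for z
      using const[OF x, of "z - ?x"] that by (simp add: coset_def)
    then have "(LINT x:coset ?x (n0 + 1)|\<mu>. f x) = complex_of_real (q powi (- (n0 + 1))) * f ?x"
      by (rule integral_coset_const)
    also have "f ?x = (if chi u = 1
        then \<Psi> (c2 * (\<kappa>\<^sup>2 * u + inverse u)) * complex_of_real (1 / q * q powi n0) else 0)"
    proof -
      have "s * inverse ?x \<noteq> 0" "ord (s * inverse ?x) = h - 1"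
        using s u' by (simp_all add: ord_mult ord_inverse n0_def)
      then have "J (s * inverse ?x) = complex_of_real (1 / q)" by (rule J_eq)
      moreover have "1 / abs_val ord ?x = q powi n0"
        using u' by (simp add: abs_val_def ord_mult power_int_minus divide_inverse)
      moreover have "s * (?x * \<theta>' + inverse ?x * w) = c2 * (\<kappa>\<^sup>2 * u + inverse u)"
        using s u' by (simp add: \<theta>'_eq c2_def \<kappa>_def power_int_minus power2_eq_square field_simps)
      ultimately show ?thesis
        using norm_group_iff[OF u'(1,2), of n0] by (simp add: f_def indicator_def)
    qed
    also have "complex_of_real (q powi (- (n0 + 1))) * \<dots> = (if chi u = 1
      then complex_of_real (q powi (- 2)) * \<Psi> (c2 * (\<kappa>\<^sup>2 * u + inverse u)) else 0)"
    proof -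
      have "q powi (- (n0 + 1)) * (1 / q * q powi n0) = q powi (- 2)"
      proof -
        have "- (n0 + 1) + (- 1 + n0) = - 2" by simp
        then have "q powi (- (n0 + 1)) * (q powi (- 1) * q powi n0) = q powi (- 2)"
          by (simp only: q_powi_add[symmetric])
        then show ?thesis by (simp add: power_int_minus divide_inverse)
      qed
      then have "complex_of_real (q powi (- (n0 + 1))) * complex_of_real (1 / q * q powi n0) =
          complex_of_real (q powi (- 2))"
        by (metis of_real_mult)
      moreover have "a * (if p then x * b else 0) = (if p then c * x else 0)"
        if "a * b = c" for a b c x :: complex and p
        using that by auto
      ultimately show ?thesis by blast
    qed
    finally show "(LINT x:coset ?x (n0 + 1)|\<mu>. f x) = (if chi u = 1
      then complex_of_real (q powi (- 2)) * \<Psi> (c2 * (\<kappa>\<^sup>2 * u + inverse u)) else 0)" .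
  qed
  also have "\<dots> = (\<Sum>u\<in>{u \<in> {u \<in> R. u \<notin> P 1}. chi u = 1}.
      complex_of_real (q powi (- 2)) * \<Psi> (c2 * (\<kappa>\<^sup>2 * u + inverse u)))"
    by (rule sum.inter_filter[symmetric]) simp
  also have "{u \<in> {u \<in> R. u \<notin> P 1}. chi u = 1} = {u \<in> R. chi u = 1}"
    by (auto simp: chi_def)
  finally show ?thesis by (simp add: sum_distrib_left)
qed

lemma mock_fourier_eq:
  assumes \<Psi>: "\<And>x. \<Phi> (\<beta> * x) = \<Psi> x"
  shows "mock_fourier_transform ord \<mu> \<Phi> w \<beta> s \<theta>' = (LINT x:shell ord n0|\<mu>. f x)"
proof -
  have inner: "(\<Sum>\<^sub>\<infinity>l::int. LINT t:shell ord l|\<mu>.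
      \<Phi> (\<beta> * s * (x * \<theta>' + inverse x * w - inverse x * t\<^sup>2))) =
      \<Psi> (s * (x * \<theta>' + inverse x * w)) * J (s * inverse x)" for x
  proof -
    have "\<Phi> (\<beta> * s * (x * \<theta>' + inverse x * w - inverse x * t\<^sup>2)) =
        \<Psi> (s * (x * \<theta>' + inverse x * w)) * \<Psi> (- (s * inverse x * t\<^sup>2))" for t
      unfolding \<Psi>_add[symmetric] mult.assoc \<Psi> by (simp add: algebra_simps)
    then show ?thesis by (simp add: J_def infsum_cmult_right')
  qed
  have "mock_fourier_transform ord \<mu> \<Phi> w \<beta> s \<theta>' = (\<Sum>\<^sub>\<infinity>n::int. LINT x:shell ord n|\<mu>. f x)"
    unfolding mock_fourier_transform_def inner f_def ..
  also have "\<dots> = (\<Sum>\<^sub>\<infinity>n\<in>{n0}. LINT x:shell ord n|\<mu>. f x)"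
    using shell_integral_f_eq_0 by (intro infsum_cong_neutral) auto
  finally show ?thesis by simp
qed

text \<open>\<open>c2\<close> is \<open>(- w) powi h\<close> times \<open>\<alpha>\<close>, the unit
  part of \<open>- s\<close>. The sign arises because \<open>c2\<close> contains \<open>w\<close>
  while units are measured against powers of \<open>- w\<close>.\<close>

lemma gauss_sum_c2:
  "(\<Sum>z\<in>R. \<Psi> (c2 * z\<^sup>2)) = sgn_norm w (- s) * (\<Sum>z\<in>R. \<Psi> ((- w) powi h * z\<^sup>2))"
proof -
  define \<alpha> where "\<alpha> = - s * (- w) powi (- ord s)"
  have \<alpha>: "\<alpha> \<in> P 0" "\<alpha> \<notin> P 1" using s by (simp_all add: \<alpha>_def P_iff ord_mult)
  have "(- w) powi h * (- w) powi (- ord s) = - w * (- w) powi (- n0)"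
  proof -
    have "(- w) powi (1 + - n0) = - w * (- w) powi (- n0)"
      by (simp only: w_power_add power_int_1_right)
    moreover have "h + - ord s = 1 + - n0" by (simp add: n0_def)
    ultimately show ?thesis by (simp only: w_power_add[symmetric])
  qed
  then have c2: "c2 = (- w) powi h * \<alpha>"
    by (simp add: c2_def \<alpha>_def algebra_simps)
  have "additive_mod1 (\<lambda>v. \<Psi> ((- w) powi h * v))" by (rule additive_mod1_scaled) simp_all
  from gauss_sum_scale[OF this \<alpha>]
  have "(\<Sum>z\<in>R. \<Psi> (c2 * z\<^sup>2)) = chi \<alpha> * (\<Sum>z\<in>R. \<Psi> ((- w) powi h * z\<^sup>2))"
    by (simp only: c2 mult.assoc)
  moreover have "- s = (- w) powi ord s * \<alpha>" by (simp add: \<alpha>_def power_int_minus)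
  then have "sgn_norm w (- s) = chi \<alpha>" using sgn_norm_eq[OF \<alpha>] by simp
  ultimately show ?thesis by simp
qed

lemma mock_fourier_value:
  assumes "\<And>x. \<Phi> (\<beta> * x) = \<Psi> x"
  shows "mock_fourier_transform ord \<mu> \<Phi> w \<beta> s \<theta>' = complex_of_real (q powi (- 2)) / 2 *
    ((\<Sum>v\<in>R. chi (v\<^sup>2 - 4 * \<kappa>\<^sup>2) * \<Psi> (c2 * v)) +
     (\<Psi> (2 * (y * w)) + \<Psi> (- (2 * (y * w)))) *
     (sgn_norm w (- s) * (\<Sum>z\<in>R. \<Psi> ((- w) powi h * z\<^sup>2))))"
proof -
  let ?\<psi> = "\<lambda>v. \<Psi> (c2 * v)"
  have \<psi>: "additive_mod1 ?\<psi>" using ord_c2 by (rule additive_mod1_scaled)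
  have \<kappa>: "\<kappa> \<in> P 0" "\<kappa> \<notin> P 1" using ord_\<kappa> by (auto simp: P_iff)
  \<comment> \<open>The summand makes sense as a function of classes only on units; extended by 0 it
    is congruence invariant everywhere, as \<open>sum_unit_squares\<close> demands.\<close>
  define g where "g v = (if v \<in> P 0 \<and> v \<notin> P 1 then ?\<psi> (\<kappa>\<^sup>2 * v + inverse v) else 0)" for v
  have g_cong: "g v = g v'" if "v \<asymp> v'" for v v'
  proof (cases "v' \<in> P 0 \<and> v' \<notin> P 1")
    case True
    then have "v \<in> P 0 \<and> v \<notin> P 1" using that cong1_P0 cong1_P1 by blast
    moreover have "\<kappa>\<^sup>2 * v + inverse v \<asymp> \<kappa>\<^sup>2 * v' + inverse v'"
      using that True \<kappa> cong1_inverse cong1_mult[OF cong1_refl that P0_power] by (intro cong1_add) auto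
    ultimately show ?thesis using True additive_mod1_cong[OF \<psi>] by (simp add: g_def)
  next
    case False
    then have "\<not> (v \<in> P 0 \<and> v \<notin> P 1)" using cong1_sym[OF that] cong1_P0 cong1_P1 by blast
    with False show ?thesis by (auto simp: g_def)
  qed
  have "2 * (\<Sum>u\<in>{u \<in> R. chi u = 1}. ?\<psi> (\<kappa>\<^sup>2 * u + inverse u)) = 2 * (\<Sum>u\<in>{u \<in> R. chi u = 1}. g u)"
    by (intro arg_cong2[where f = "(*)"] sum.cong) (auto simp: g_def R_subset chi_def split: if_splits)
  also have "\<dots> = (\<Sum>u\<in>{u \<in> R. u \<notin> P 1}. g (u\<^sup>2))"
    using sum_unit_squares[of g] g_cong by simp
  also have "\<dots> = (\<Sum>u\<in>{u \<in> R. u \<notin> P 1}. ?\<psi> (\<kappa>\<^sup>2 * u\<^sup>2 + inverse (u\<^sup>2)))"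
    by (intro sum.cong) (auto simp: g_def R_subset P0_power P_power2_iff)
  also have "\<dots> = (\<Sum>v\<in>R. chi (v\<^sup>2 - 4 * \<kappa>\<^sup>2) * ?\<psi> v) +
      (?\<psi> (2 * \<kappa>) + ?\<psi> (- (2 * \<kappa>))) * (\<Sum>z\<in>R. ?\<psi> (z\<^sup>2))"
    using \<psi> \<kappa> by (rule sum_unit_squares_inverse)
  also have "c2 * (2 * \<kappa>) = 2 * (y * w)" by (simp add: mult.left_commute[of c2] c2_\<kappa>)
  also have "c2 * - (2 * \<kappa>) = - (2 * (y * w))" by (simp add: mult.left_commute[of c2] c2_\<kappa>)
  also note gauss_sum_c2
  finally have "2 * (\<Sum>u\<in>{u \<in> R. chi u = 1}. ?\<psi> (\<kappa>\<^sup>2 * u + inverse u)) =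
    (\<Sum>v\<in>R. chi (v\<^sup>2 - 4 * \<kappa>\<^sup>2) * \<Psi> (c2 * v)) +
     (\<Psi> (2 * (y * w)) + \<Psi> (- (2 * (y * w)))) *
     (sgn_norm w (- s) * (\<Sum>z\<in>R. \<Psi> ((- w) powi h * z\<^sup>2)))" .
  moreover have "a * b = a / 2 * c" if "2 * b = c" for a b c :: complex
    using that by auto
  ultimately show ?thesis
    unfolding mock_fourier_eq[OF assms] shell_integral_f by blast
qed

end

section \<open>Two by two matrices\<close>

lemma mat2_eqI:
  fixes A B :: "'b^2^2"
  assumes "A $ 1 $ 1 = B $ 1 $ 1" "A $ 1 $ 2 = B $ 1 $ 2" "A $ 2 $ 1 = B $ 2 $ 1" "A $ 2 $ 2 = B $ 2 $ 2"
  shows "A = B"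
  using assms by (simp add: vec_eq_iff forall_2)

lemma mat2_nth [simp]:
  "(vector [vector [a, b], vector [c, d]] :: 'b::zero^2^2) $ 1 $ 1 = a"
  "(vector [vector [a, b], vector [c, d]] :: 'b::zero^2^2) $ 1 $ 2 = b"
  "(vector [vector [a, b], vector [c, d]] :: 'b::zero^2^2) $ 2 $ 1 = c"
  "(vector [vector [a, b], vector [c, d]] :: 'b::zero^2^2) $ 2 $ 2 = d"
  by simp_all

lemma mat_1_nth: "(mat 1 :: 'b::zero_neq_one^'n^'n) $ i $ j = (if i = j then 1 else 0)"
  by (simp add: mat_def)

lemma mat2_mult_nth:
  fixes A B :: "'b::semiring_1^2^2"
  shows "(A ** B) $ i $ j = A $ i $ 1 * B $ 1 $ j + A $ i $ 2 * B $ 2 $ j"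
  by (simp add: matrix_matrix_mult_def sum_2)

text \<open>The adjugate: an explicit inverse for determinant 1, in place of the choice inside
  \<open>matrix_inv\<close>.\<close>

definition adj2 :: "'b::field^2^2 \<Rightarrow> 'b^2^2" where
  "adj2 g = vector [vector [g $ 2 $ 2, - (g $ 1 $ 2)], vector [- (g $ 2 $ 1), g $ 1 $ 1]]"

lemma adj2_mult:
  assumes "det g = 1"
  shows "g ** adj2 g = mat 1" "adj2 g ** g = mat 1"
  using assms
  by (auto intro!: mat2_eqI simp: adj2_def mat2_mult_nth mat_def det_2 algebra_simps)

lemma det_adj2: "det (adj2 g) = det g"
  by (simp add: adj2_def det_2 mult.commute)

lemma adj2_adj2: "adj2 (adj2 g) = g"
  by (rule mat2_eqI) (simp_all add: adj2_def)

lemma matrix_inv_det_1: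
  assumes "det g = 1" shows "matrix_inv g = adj2 g"
  unfolding matrix_inv_def
proof (rule some_equality)
  fix B assume "g ** B = mat 1 \<and> B ** g = mat 1"
  then show "B = adj2 g"
    using adj2_mult[OF assms] by (metis matrix_mul_assoc matrix_mul_lid matrix_mul_rid)
qed (use adj2_mult[OF assms] in simp)

lemma Ad_det_1: "det g = 1 \<Longrightarrow> Ad g Z = g ** Z ** adj2 g"
  by (simp add: Ad_def matrix_inv_det_1)

lemma sqrt_mat_square: "sqrt_mat c \<theta> ** sqrt_mat c \<theta> = mat (c\<^sup>2 * \<theta>)"
  by (rule mat2_eqI) (simp_all add: sqrt_mat_def mat2_mult_nth mat_def power2_eq_square algebra_simps)

lemma scalar_of_mat [simp]: "scalar_of (mat a :: 'b::field^2^2) = a"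
proof -
  have "a = b" if "(mat a :: 'b^2^2) = mat b" for b
  proof -
    from arg_cong[OF that, of "\<lambda>A::'b^2^2. A $ 1 $ 1"] show ?thesis by (simp add: mat_def)
  qed
  then show ?thesis unfolding scalar_of_def by (intro the_equality) auto
qed

lemma sqrt_mat_eq_iff [simp]: "sqrt_mat c \<theta> = sqrt_mat d \<theta> \<longleftrightarrow> c = d"
proof
  assume "sqrt_mat c \<theta> = sqrt_mat d \<theta>"
  then have "sqrt_mat c \<theta> $ 1 $ 2 = sqrt_mat d \<theta> $ 1 $ 2" by simp
  then show "c = d" by (simp add: sqrt_mat_def)
qed simp

lemma sqrt_mat_0: "sqrt_mat 0 \<theta> = 0"
  by (rule mat2_eqI) (simp_all add: sqrt_mat_def)

lemma sqrt_mat_diff: "sqrt_mat c \<theta> - sqrt_mat d \<theta> = sqrt_mat (c - d) \<theta>"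
  by (rule mat2_eqI) (simp_all add: sqrt_mat_def algebra_simps)

lemma sqrt_mat_uminus: "- sqrt_mat c \<theta> = sqrt_mat (- c) \<theta>"
  by (rule mat2_eqI) (simp_all add: sqrt_mat_def)

lemma sqrt_mat_eq_0_iff: "sqrt_mat c \<theta> = 0 \<longleftrightarrow> c = 0"
  using sqrt_mat_eq_iff[of c \<theta> 0] by (simp add: sqrt_mat_0 del: sqrt_mat_eq_iff)

lemma trace_functional_sqrt_mat: "trace_functional \<beta> \<theta> (sqrt_mat c \<theta>) = 2 * (\<beta> * c * \<theta>)"
  by (simp add: trace_functional_def trace_def sum_2 mat2_mult_nth sqrt_mat_def algebra_simps)

lemma discr_sqrt_mat: "discr (sqrt_mat c \<theta>) = 4 * (c\<^sup>2 * \<theta>)"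
  by (simp add: discr_def sqrt_mat_def power2_eq_square algebra_simps)

lemma mat_depth_sqrt_mat:
  "mat_depth ord (sqrt_mat c \<theta>) = (if c = 0 then \<infinity> else ereal (real_of_int (ord (c\<^sup>2 * \<theta>)) / 2))"
  by (simp add: mat_depth_def sqrt_mat_eq_0_iff sqrt_mat_square)

lemma base_change_sqrt_mat: "base_change (sqrt_mat c \<theta>) = sqrt_mat (to_ac c) (to_ac \<theta>)"
  by (rule mat2_eqI) (simp_all add: base_change_def map_matrix_def sqrt_mat_def)

text \<open>Conjugate matrices have equal determinants, and \<open>det (c\<surd>\<theta>) = - c\<^sup>2 \<theta>\<close>.\<close>

lemma stably_conjugate_sqrt_mat:
  assumes "stably_conjugate (sqrt_mat s \<theta>') (sqrt_mat y \<theta>)"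
  shows "y\<^sup>2 * \<theta> = s\<^sup>2 * \<theta>'"
proof -
  obtain g :: "'a alg_closure^2^2" where g: "det g = 1"
      "sqrt_mat (to_ac y) (to_ac \<theta>) = Ad g (sqrt_mat (to_ac s) (to_ac \<theta>'))"
    using assms by (auto simp: stably_conjugate_def base_change_sqrt_mat)
  then have "det (sqrt_mat (to_ac y) (to_ac \<theta>)) = det (g ** sqrt_mat (to_ac s) (to_ac \<theta>') ** adj2 g)"
    by (simp add: Ad_det_1)
  then have "det (sqrt_mat (to_ac s) (to_ac \<theta>')) = det (sqrt_mat (to_ac y) (to_ac \<theta>))"
    by (simp add: det_mul det_adj2 g(1))
  then have "to_ac (y\<^sup>2 * \<theta>) = to_ac (s\<^sup>2 * \<theta>')"
    by (simp add: det_2 sqrt_mat_def power2_eq_square mult.assoc)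
  then show ?thesis by (simp only: to_ac_eq_iff)
qed

section \<open>The Weyl group\<close>

text \<open>For \<open>e = \<plusminus>1\<close>, the elements of \<open>SL2\<close> that conjugate \<open>\<surd>\<theta>\<close> to \<open>e\<surd>\<theta>\<close>.\<close>

definition twisted_torus :: "'b::field \<Rightarrow> 'b \<Rightarrow> ('b^2^2) set" where
  "twisted_torus \<theta> e = {g. det g = 1 \<and> g $ 2 $ 2 = e * g $ 1 $ 1 \<and> g $ 2 $ 1 = e * \<theta> * g $ 1 $ 2}"

lemma torus_eq: "torus \<theta> = twisted_torus \<theta> 1"
proof (intro equalityI subsetI)
  fix g assume "g \<in> torus \<theta>"
  then show "g \<in> twisted_torus \<theta> 1"
    by (auto simp: torus_def twisted_torus_def det_2 power2_eq_square algebra_simps)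
next
  fix g assume g: "g \<in> twisted_torus \<theta> 1"
  then have "(g $ 1 $ 1)\<^sup>2 - (g $ 1 $ 2)\<^sup>2 * \<theta> = 1"
    by (auto simp: twisted_torus_def det_2 power2_eq_square algebra_simps)
  moreover have "g = vector [vector [g $ 1 $ 1, g $ 1 $ 2], vector [g $ 1 $ 2 * \<theta>, g $ 1 $ 1]]"
    using g by (intro mat2_eqI) (simp_all add: twisted_torus_def mult.commute)
  ultimately show "g \<in> torus \<theta>" unfolding torus_def by blast
qed

lemma twisted_torus_det: "g \<in> twisted_torus \<theta> e \<Longrightarrow> det g = 1"
  by (simp add: twisted_torus_def)

lemma twisted_torus_mult:
  assumes "g \<in> twisted_torus \<theta> e" "k \<in> twisted_torus \<theta> f" "f * f = 1"
  shows "g ** k \<in> twisted_torus \<theta> (e * f)"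
proof -
  have f: "f * (f * x) = x" for x using assms(3) by (simp add: mult.assoc[symmetric])
  show ?thesis using assms(1,2)
    by (simp add: twisted_torus_def det_mul mat2_mult_nth algebra_simps f)
qed

lemma twisted_torus_adj2:
  assumes "g \<in> twisted_torus \<theta> e" "e * e = 1"
  shows "adj2 g \<in> twisted_torus \<theta> e"
proof -
  have "e * (e * x) = x" for x using assms(2) by (simp add: mult.assoc[symmetric])
  then show ?thesis using assms(1)
    by (simp add: twisted_torus_def det_adj2) (simp add: adj2_def)
qed

lemma Ad_twisted_torus:
  assumes "g \<in> twisted_torus \<theta> e" "e * e = 1"
  shows "Ad g (sqrt_mat c \<theta>) = sqrt_mat (e * c) \<theta>"
proof -
  have ee: "e * (e * x) = x" for x using assms(2) by (simp add: mult.assoc[symmetric])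
  have g: "g $ 2 $ 2 = e * g $ 1 $ 1" "g $ 2 $ 1 = e * \<theta> * g $ 1 $ 2" "det g = 1"
    using assms(1) by (auto simp: twisted_torus_def)
  have "g ** sqrt_mat c \<theta> = sqrt_mat (e * c) \<theta> ** g"
    by (rule mat2_eqI) (simp_all add: mat2_mult_nth sqrt_mat_def g ee algebra_simps)
  then have "g ** sqrt_mat c \<theta> ** adj2 g = sqrt_mat (e * c) \<theta> ** (g ** adj2 g)"
    by (simp add: matrix_mul_assoc)
  then show ?thesis by (simp add: Ad_det_1 g(3) adj2_mult)
qed

lemma group_SL2: "group (SL2 :: ('b::field^2^2) monoid)"
proof (rule groupI)
  fix x assume x: "x \<in> carrier (SL2 :: ('b^2^2) monoid)"
  then show "\<exists>y\<in>carrier SL2. y \<otimes>\<^bsub>SL2\<^esub> x = \<one>\<^bsub>SL2\<^esub>"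
    by (intro bexI[of _ "adj2 x"]) (simp_all add: SL2_def adj2_mult det_adj2)
qed (auto simp: SL2_def det_mul matrix_mul_assoc)

lemma SL2_simps [simp]:
  "g \<in> carrier SL2 \<longleftrightarrow> det g = 1" "g \<otimes>\<^bsub>SL2\<^esub> h = g ** h" "\<one>\<^bsub>SL2\<^esub> = mat 1"
  by (simp_all add: SL2_def)

lemma inv_SL2: "det g = 1 \<Longrightarrow> inv\<^bsub>SL2\<^esub> g = adj2 g"
  by (rule group.inv_equality[OF group_SL2]) (simp_all add: adj2_mult det_adj2)

lemma normalizer_SL2_iff:
  assumes "H \<subseteq> carrier (SL2 :: ('b::field^2^2) monoid)"
  shows "g \<in> normalizer SL2 H \<longleftrightarrow> det g = 1 \<and> (\<lambda>t. g ** t ** adj2 g) ` H = H"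
proof -
  have "g <#\<^bsub>SL2\<^esub> H #>\<^bsub>SL2\<^esub> inv\<^bsub>SL2\<^esub> g = (\<lambda>t. g ** t ** adj2 g) ` H" if "det g = 1"
    using that by (auto simp: l_coset_def r_coset_def inv_SL2)
  then show ?thesis using assms by (auto simp: normalizer_def stabilizer_def)
qed

lemma conj_adj2_cancel:
  assumes "det g = 1"
  shows "g ** (adj2 g ** t ** g) ** adj2 g = t" "adj2 g ** (g ** t ** adj2 g) ** g = t"
proof -
  have "g ** (adj2 g ** t ** g) ** adj2 g = (g ** adj2 g) ** t ** (g ** adj2 g)"
    by (simp add: matrix_mul_assoc)
  then show "g ** (adj2 g ** t ** g) ** adj2 g = t" by (simp add: adj2_mult[OF assms])
  have "adj2 g ** (g ** t ** adj2 g) ** g = (adj2 g ** g) ** t ** (adj2 g ** g)"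
    by (simp add: matrix_mul_assoc)
  then show "adj2 g ** (g ** t ** adj2 g) ** g = t" by (simp add: adj2_mult[OF assms])
qed

context
  fixes \<theta> :: "'b::alg_closed_field"
  assumes \<theta>: "\<theta> \<noteq> 0" and two: "(2::'b) \<noteq> 0"
begin

text \<open>The torus contains a multiple of \<open>\<surd>\<theta>\<close>, so an element of the normalizer maps \<open>\<surd>\<theta>\<close> to
  a multiple of itself with the same determinant.\<close>

lemma normalizer_torus: "normalizer SL2 (torus \<theta>) = twisted_torus \<theta> 1 \<union> twisted_torus \<theta> (-1)"
proof -
  have sub: "torus \<theta> \<subseteq> carrier SL2" using twisted_torus_det by (auto simp: torus_eq)
  have conj_imp: "g \<in> twisted_torus \<theta> 1 \<union> twisted_torus \<theta> (-1)"
    if d: "det g = 1" and H: "(\<lambda>t. g ** t ** adj2 g) ` torus \<theta> = torus \<theta>" for g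
  proof -
    \<comment> \<open>The determinant of \<open>sqrt_mat b \<theta>\<close> is
      \<open>- b\<^sup>2 \<theta>\<close>, so this \<open>b\<close> puts the multiple of
      \<open>\<surd>\<theta>\<close> into the torus.\<close>
    obtain b where "b ^ 2 = - (1 / \<theta>)" using nth_root_exists[of 2] by auto
    then have b: "b * b * \<theta> = -1" using \<theta> by (simp add: power2_eq_square field_simps)
    then have bnz: "b \<noteq> 0" by auto
    define t where "t = sqrt_mat b \<theta>"
    have "t \<in> torus \<theta>" using b
      by (simp add: t_def sqrt_mat_def torus_eq twisted_torus_def det_2 algebra_simps)
    with H have t': "g ** t ** adj2 g \<in> torus \<theta>" (is "?t' \<in> _") by blast
    \<comment> \<open>Conjugation keeps the trace 0, which forces the two equal diagonal entries of
      a torus element to vanish.\<close>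
    have "trace ?t' = trace (adj2 g ** g ** t)"
      using trace_mul_sym[of "g ** t" "adj2 g"] by (simp add: matrix_mul_assoc)
    also have "\<dots> = 0"
      by (simp add: adj2_mult[OF d]) (simp add: t_def trace_def sum_2 sqrt_mat_def)
    finally have "2 * ?t' $ 1 $ 1 = 0"
      using t' by (simp add: torus_eq twisted_torus_def trace_def sum_2)
    then have a0: "?t' $ 1 $ 1 = 0" using two by simp
    define c where "c = ?t' $ 1 $ 2"
    have t'c: "?t' = sqrt_mat c \<theta>"
      using t' a0 by (intro mat2_eqI) (simp_all add: torus_eq twisted_torus_def sqrt_mat_def c_def mult.commute)
    have "det (sqrt_mat c \<theta>) = 1" using t' unfolding t'c[symmetric] torus_eq by (rule twisted_torus_det)
    then have "- (c * c * \<theta>) = 1" by (simp add: det_2 sqrt_mat_def algebra_simps)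
    then have "c * c * \<theta> = -1" by (metis minus_minus)
    then have "c * c = b * b" using b \<theta> by (metis mult_right_cancel)
    then have "(c - b) * (c + b) = 0" by (simp add: algebra_simps)
    then have "\<exists>e. (e = 1 \<or> e = -1) \<and> c = e * b"
      by (auto simp: add_eq_0_iff2 intro: exI[of _ "-1"])
    then obtain e where e: "e = 1 \<or> e = -1" "c = e * b" by blast
    have "g ** t ** (adj2 g ** g) = sqrt_mat c \<theta> ** g"
      using t'c by (simp add: matrix_mul_assoc)
    then have eq: "g ** t = sqrt_mat c \<theta> ** g" by (simp add: adj2_mult[OF d])
    have "g $ 1 $ 1 * b = c * g $ 2 $ 2" "g $ 1 $ 2 * (b * \<theta>) = c * g $ 2 $ 1"
      using arg_cong[OF eq, of "\<lambda>A::'b^2^2. A $ 1 $ 2"] arg_cong[OF eq, of "\<lambda>A::'b^2^2. A $ 1 $ 1"]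
      by (simp_all add: mat2_mult_nth t_def sqrt_mat_def)
    then have "b * g $ 1 $ 1 = b * (e * g $ 2 $ 2)" "b * (g $ 1 $ 2 * \<theta>) = b * (e * g $ 2 $ 1)"
      by (simp_all add: e algebra_simps)
    then have "g $ 1 $ 1 = e * g $ 2 $ 2" "g $ 1 $ 2 * \<theta> = e * g $ 2 $ 1"
      using bnz by simp_all
    then have "g \<in> twisted_torus \<theta> e" using d e(1) by (auto simp: twisted_torus_def mult.commute)
    with e(1) show ?thesis by auto
  qed
  have imp_conj: "(\<lambda>t. g ** t ** adj2 g) ` torus \<theta> = torus \<theta>" if g: "g \<in> twisted_torus \<theta> e" "e * e = 1" for g e
  proof -
    have conj: "k ** t ** adj2 k \<in> torus \<theta>" if "k \<in> twisted_torus \<theta> e" "t \<in> torus \<theta>" for k t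
      using twisted_torus_mult[OF twisted_torus_mult[OF that(1), of t 1] twisted_torus_adj2[OF that(1) g(2)] g(2)]
        that(2) g(2) by (simp add: torus_eq)
    have d: "det g = 1" using g by (simp add: twisted_torus_det)
    have "t \<in> (\<lambda>t. g ** t ** adj2 g) ` torus \<theta>" if "t \<in> torus \<theta>" for t
    proof (rule image_eqI)
      show "t = g ** (adj2 g ** t ** g) ** adj2 g" by (simp add: conj_adj2_cancel[OF d])
      show "adj2 g ** t ** g \<in> torus \<theta>"
        using conj[OF twisted_torus_adj2[OF g] that] by (simp add: adj2_adj2)
    qed
    then show ?thesis using conj[OF g(1)] by blast
  qed
  show ?thesis
  proof (rule Set.set_eqI)
    fix g
    show "g \<in> normalizer SL2 (torus \<theta>) \<longleftrightarrow> g \<in> twisted_torus \<theta> 1 \<union> twisted_torus \<theta> (-1)"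
      unfolding normalizer_SL2_iff[OF sub]
      using conj_imp[of g] imp_conj[of g 1] imp_conj[of g "-1"] twisted_torus_det[of g \<theta>] by auto
  qed
qed

lemma r_coset_twisted_torus:
  assumes g: "g \<in> twisted_torus \<theta> e" "e * e = 1"
  shows "(\<lambda>t. t ** g) ` torus \<theta> = twisted_torus \<theta> e"
proof (intro equalityI subsetI)
  fix x assume "x \<in> (\<lambda>t. t ** g) ` torus \<theta>"
  then show "x \<in> twisted_torus \<theta> e"
    using twisted_torus_mult[of _ \<theta> 1 g e] g by (auto simp: torus_eq)
next
  fix x assume x: "x \<in> twisted_torus \<theta> e"
  show "x \<in> (\<lambda>t. t ** g) ` torus \<theta>"
  proof (rule image_eqI)
    have "x ** (adj2 g ** g) = x" using g by (simp add: adj2_mult twisted_torus_det)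
    then show "x = (x ** adj2 g) ** g" by (simp add: matrix_mul_assoc)
    show "x ** adj2 g \<in> torus \<theta>"
      using twisted_torus_mult[OF x twisted_torus_adj2[OF g] g(2)] g(2) by (simp add: torus_eq)
  qed
qed

lemma twisted_torus_nonempty: "\<exists>g. g \<in> twisted_torus \<theta> 1" "\<exists>g. g \<in> twisted_torus \<theta> (-1)"
proof -
  have "mat 1 \<in> twisted_torus \<theta> 1" by (simp add: twisted_torus_def mat_1_nth)
  then show "\<exists>g. g \<in> twisted_torus \<theta> 1" by blast
  \<comment> \<open>The diagonal matrix with entries \<open>i\<close> and \<open>- i\<close> negates
    \<open>\<surd>\<theta>\<close>. Over a smaller field an element of this twisted torus exists
    only if -1 has the form \<open>a\<^sup>2 - b\<^sup>2 * \<theta>\<close>, so the absolute Weyl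
    group calls for the closure.\<close>
  obtain i where "i ^ 2 = (-1 :: 'b)" using nth_root_exists[of 2] by auto
  then have "vector [vector [i, 0], vector [0, - i]] \<in> twisted_torus \<theta> (-1)"
    by (simp add: twisted_torus_def det_2 power2_eq_square)
  then show "\<exists>g. g \<in> twisted_torus \<theta> (-1)" by blast
qed

lemma twisted_torus_distinct: "twisted_torus \<theta> 1 \<noteq> twisted_torus \<theta> (-1)"
proof
  assume eq: "twisted_torus \<theta> 1 = twisted_torus \<theta> (-1)"
  have "mat 1 \<in> twisted_torus \<theta> 1" by (simp add: twisted_torus_def mat_1_nth)
  then have "mat 1 \<in> twisted_torus \<theta> (-1)" using eq by simp
  then have "(1::'b) = - 1" by (simp add: twisted_torus_def mat_1_nth)
  then have "(1::'b) + 1 = 0" by (simp only: eq_neg_iff_add_eq_0)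
  with two show False by simp
qed

end

lemma carrier_weyl_group:
  fixes \<theta> :: "'a::field"
  assumes "\<theta> \<noteq> 0" "(2::'a) \<noteq> 0"
  shows "carrier (weyl_group \<theta>) = {twisted_torus (to_ac \<theta>) 1, twisted_torus (to_ac \<theta>) (-1)}"
proof -
  let ?\<theta> = "to_ac \<theta>"
  have \<theta>: "?\<theta> \<noteq> 0" using assms by simp
  have "to_ac (2::'a) \<noteq> 0" using assms(2) by (simp only: to_ac_eq_0_iff) simp
  then have two: "(2::'a alg_closure) \<noteq> 0" by simp
  let ?N = "twisted_torus ?\<theta> 1 \<union> twisted_torus ?\<theta> (-1)"
  have "carrier (weyl_group \<theta>) = (\<lambda>g. (\<lambda>t. t ** g) ` torus ?\<theta>) ` ?N"
    unfolding weyl_group_def carrier_FactGroup normalizer_torus[OF \<theta> two]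
    by (auto simp: r_coset_def SL2_def)
  also have "\<dots> = (\<lambda>g. twisted_torus ?\<theta> 1) ` twisted_torus ?\<theta> 1 \<union>
      (\<lambda>g. twisted_torus ?\<theta> (-1)) ` twisted_torus ?\<theta> (-1)"
    unfolding image_Un
    by (intro arg_cong2[where f = "(\<union>)"] image_cong refl
        r_coset_twisted_torus[OF \<theta> two]) auto
  also have "\<dots> = {twisted_torus ?\<theta> 1, twisted_torus ?\<theta> (-1)}"
    using twisted_torus_nonempty[OF \<theta> two] by auto
  finally show ?thesis .
qed

text \<open>All representatives act on the Lie algebra of the torus by the same sign
  \<open>e\<close>. The value is therefore common to them and comes from the ground field, which
  justifies the definite description.\<close>

lemma weyl_pairing_twisted_torus:
  fixes \<theta> :: "'a::field" and e :: 'a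
  assumes "\<theta> \<noteq> 0" "(2::'a) \<noteq> 0" "e = 1 \<or> e = -1"
  shows "weyl_pairing \<beta> \<theta> (twisted_torus (to_ac \<theta>) (to_ac e)) (sqrt_mat y \<theta>) = e * (2 * (\<beta> * y * \<theta>))"
proof -
  let ?\<theta> = "to_ac \<theta>" and ?e = "to_ac e"
  have \<theta>: "?\<theta> \<noteq> 0" using assms by simp
  have "to_ac (2::'a) \<noteq> 0" using assms(2) by (simp only: to_ac_eq_0_iff) simp
  then have two: "(2::'a alg_closure) \<noteq> 0" by simp
  have ee: "?e * ?e = 1" using assms(3) by auto
  have "coAd n (trace_functional (to_ac \<beta>) ?\<theta>) (base_change (sqrt_mat y \<theta>)) =
      to_ac (e * (2 * (\<beta> * y * \<theta>)))" if n: "n \<in> twisted_torus ?\<theta> ?e" for n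
  proof -
    have "matrix_inv n \<in> twisted_torus ?\<theta> ?e"
      using twisted_torus_adj2[OF n ee] matrix_inv_det_1[OF twisted_torus_det[OF n]] by simp
    then have "Ad (matrix_inv n) (sqrt_mat (to_ac y) ?\<theta>) = sqrt_mat (?e * to_ac y) ?\<theta>"
      using ee by (rule Ad_twisted_torus)
    then show ?thesis
      by (simp add: coAd_def base_change_sqrt_mat trace_functional_sqrt_mat mult_ac)
  qed
  moreover obtain n where "n \<in> twisted_torus ?\<theta> ?e"
    using twisted_torus_nonempty[OF \<theta> two] assms(3) by auto
  ultimately show ?thesis
    unfolding weyl_pairing_def by (intro the_equality) (metis to_ac_eq_iff)+
qed

lemma sum_weyl_group:
  fixes \<theta> :: "'a::field" and \<Phi> :: "'a \<Rightarrow> complex"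
  assumes "\<theta> \<noteq> 0" "(2::'a) \<noteq> 0"
  shows "(\<Sum>\<sigma>\<in>carrier (weyl_group \<theta>). \<Phi> (weyl_pairing \<beta> \<theta> \<sigma> (sqrt_mat y \<theta>))) =
    \<Phi> (2 * (\<beta> * y * \<theta>)) + \<Phi> (- (2 * (\<beta> * y * \<theta>)))"
proof -
  have \<theta>: "to_ac \<theta> \<noteq> 0" using assms by simp
  have "to_ac (2::'a) \<noteq> 0" using assms(2) by (simp only: to_ac_eq_0_iff) simp
  then have two: "(2::'a alg_closure) \<noteq> 0" by simp
  show ?thesis
    unfolding carrier_weyl_group[OF assms]
    using twisted_torus_distinct[OF \<theta> two] weyl_pairing_twisted_torus[OF assms, of 1]
      weyl_pairing_twisted_torus[OF assms, of "-1"]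
    by simp
qed

section \<open>Depths\<close>

context nonarch_local_field
begin

text \<open>The circle has no small subgroups: doubling expands by at least \<open>3/2\<close> near \<open>1\<close>.\<close>

lemma additive_character_trivial:
  assumes \<Psi>: "additive_character ord \<Psi>"
  obtains n where "\<And>x. x \<in> P n \<Longrightarrow> \<Psi> x = 1"
proof -
  have cont: "continuous_map (valuation_topology ord) euclidean \<Psi>"
    and add: "\<And>x y. \<Psi> (x + y) = \<Psi> x * \<Psi> y" and cm: "\<And>x. cmod (\<Psi> x) = 1"
    using \<Psi> by (auto simp: additive_character_def)
  have "\<Psi> 0 * \<Psi> 0 = \<Psi> 0 * 1" using add[of 0 0] by simp
  then have \<Psi>0: "\<Psi> 0 = 1" using cm[of 0] by (metis mult_left_cancel norm_zero zero_neq_one)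
  let ?U = "{x \<in> topspace (valuation_topology ord). \<Psi> x \<in> ball 1 (1 / 2)}"
  have "openin (valuation_topology ord) ?U"
    using cont by (rule openin_continuous_map_preimage) simp
  moreover have "0 \<in> ?U" using \<Psi>0 by (simp add: topspace_valuation_topology)
  ultimately obtain n where n: "\<And>y. y - 0 \<in> P n \<Longrightarrow> y \<in> ?U" unfolding openin_iff by blast
  have near: "cmod (\<Psi> y - 1) < 1 / 2" if "y \<in> P n" for y
    using n[of y] that by (simp add: dist_norm norm_minus_commute)
  have "\<Psi> x = 1" if x: "x \<in> P n" for x
  proof (rule ccontr)
    assume "\<Psi> x \<noteq> 1"
    then have pos: "cmod (\<Psi> x - 1) > 0" by simp
    have "2 ^ k * x \<in> P n \<and> (3 / 2) ^ k * cmod (\<Psi> x - 1) \<le> cmod (\<Psi> (2 ^ k * x) - 1)" for k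
    proof (induction k)
      case (Suc k)
      let ?y = "2 ^ k * x"
      have y: "?y \<in> P n" using Suc by simp
      have e: "2 ^ Suc k * x = ?y + ?y" by simp
      have "\<Psi> (?y + ?y) - 1 = (\<Psi> ?y - 1) * (\<Psi> ?y + 1)"
        by (simp only: add) (simp add: algebra_simps)
      then have "cmod (\<Psi> (?y + ?y) - 1) = cmod (\<Psi> ?y - 1) * cmod (\<Psi> ?y + 1)"
        by (simp add: norm_mult)
      moreover have "3 / 2 \<le> cmod (\<Psi> ?y + 1)"
        using norm_triangle_ineq4[of "\<Psi> ?y + 1" "\<Psi> ?y - 1"] near[OF y] by simp
      then have "cmod (\<Psi> ?y - 1) * (3 / 2) \<le> cmod (\<Psi> ?y - 1) * cmod (\<Psi> ?y + 1)"
        by (intro mult_left_mono) auto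
      ultimately have "cmod (\<Psi> ?y - 1) * (3 / 2) \<le> cmod (\<Psi> (?y + ?y) - 1)"
        by (simp only:)
      then show ?case using Suc P_add[OF y y] unfolding e by simp
    qed (use x in simp)
    moreover obtain k where "1 / cmod (\<Psi> x - 1) < (3 / 2 :: real) ^ k"
      using real_arch_pow[of "3 / 2"] by auto
    then have "1 < (3 / 2) ^ k * cmod (\<Psi> x - 1)" using pos by (simp add: field_simps)
    ultimately show False using near[of "2 ^ k * x"] by (smt (verit) field_sum_of_halves)
  qed
  with that show ?thesis by blast
qed

text \<open>A least integer requires a lower bound. An \<open>a\<close> with
  \<open>\<Psi> a \<noteq> 1\<close> supplies \<open>m = ord a - 1\<close>, and well-ordering is
  applied to the natural number \<open>i - m\<close>.\<close>

lemma char_depth_nontrivial: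
  assumes \<Psi>: "nontrivial_additive_character ord \<Psi>"
  shows "x \<in> P (char_depth ord \<Psi> + 1) \<Longrightarrow> \<Psi> x = 1" "\<exists>x\<in>P (char_depth ord \<Psi>). \<Psi> x \<noteq> 1"
proof -
  let ?T = "\<lambda>i. \<forall>x\<in>P (i + 1). \<Psi> x = 1"
  obtain n where n: "\<And>x. x \<in> P n \<Longrightarrow> \<Psi> x = 1"
    using \<Psi> additive_character_trivial by (auto simp: nontrivial_additive_character_def)
  obtain a where a: "\<Psi> a \<noteq> 1" using \<Psi> by (auto simp: nontrivial_additive_character_def)
  define m where "m = ord a - 1"
  have low: "m < i" if "?T i" for i
  proof (rule ccontr)
    assume "\<not> m < i"
    then have "a \<in> P (i + 1)" by (simp add: P_iff m_def)
    with that a show False by simp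
  qed
  have "?T (m + int (nat (n - 1 - m)))" using n P_mono[of _ _ n] low[of "n - 1"] by auto
  then have ex: "\<exists>k. ?T (m + int k)" by blast
  define k where "k = (LEAST k. ?T (m + int k))"
  have k: "?T (m + int k)" unfolding k_def using ex by (rule LeastI_ex)
  have "char_depth ord \<Psi> = m + int k"
    unfolding char_depth_def
  proof (rule Least_equality)
    fix i assume i: "?T i"
    then have "i = m + int (nat (i - m))" using low[OF i] by simp
    then have "k \<le> nat (i - m)" unfolding k_def using i by (intro Least_le) simp
    then show "m + int k \<le> i" using low[OF i] by simp
  qed (rule k)
  moreover have "\<not> ?T (m + int k - 1)"
  proof
    assume T: "?T (m + int k - 1)"
    then have "k \<noteq> 0" using low[OF T] by auto
    then have "?T (m + int (k - 1))" using T by (simp add: of_nat_diff)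
    then have "k \<le> k - 1" unfolding k_def by (rule Least_le)
    with \<open>k \<noteq> 0\<close> show False by simp
  qed
  ultimately show "x \<in> P (char_depth ord \<Psi> + 1) \<Longrightarrow> \<Psi> x = 1" "\<exists>x\<in>P (char_depth ord \<Psi>). \<Psi> x \<noteq> 1"
    using k by auto
qed

lemma nontrivial_additive_character_twist:
  assumes "nontrivial_additive_character ord \<Phi>" "\<beta> \<noteq> 0"
  shows "nontrivial_additive_character ord (twist \<Phi> \<beta>)"
proof -
  obtain x where x: "\<Phi> x \<noteq> 1" and cont: "continuous_map (valuation_topology ord) euclidean \<Phi>"
    using assms by (auto simp: nontrivial_additive_character_def additive_character_def)
  have "continuous_map (valuation_topology ord) (valuation_topology ord) (\<lambda>x. \<beta> * x)"
    unfolding continuous_map_def topspace_valuation_topology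
  proof (intro conjI allI impI)
    fix U assume "openin (valuation_topology ord) U"
    then have U: "\<forall>x\<in>U. \<exists>n. \<forall>y. y - x \<in> P n \<longrightarrow> y \<in> U" by (simp add: openin_iff)
    show "openin (valuation_topology ord) {x \<in> UNIV. \<beta> * x \<in> U}"
      unfolding openin_iff
    proof
      fix x assume "x \<in> {x \<in> UNIV. \<beta> * x \<in> U}"
      then obtain n where n: "\<And>y. y - \<beta> * x \<in> P n \<Longrightarrow> y \<in> U" using U by blast
      have "\<beta> * y \<in> U" if "y - x \<in> P (n - ord \<beta>)" for y
        using n[of "\<beta> * y"] P_mult_iff[OF assms(2), of "y - x" n] that by (simp add: right_diff_distrib)
      then show "\<exists>n. \<forall>y. y - x \<in> P n \<longrightarrow> y \<in> {x \<in> UNIV. \<beta> * x \<in> U}" by blast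
    qed
  qed simp
  from continuous_map_compose[OF this cont]
  have "continuous_map (valuation_topology ord) euclidean (twist \<Phi> \<beta>)"
    by (simp add: twist_def o_def)
  moreover have "\<Phi> (\<beta> * (x / \<beta>)) \<noteq> 1" using x assms(2) by simp
  then have "\<exists>x. \<Phi> (\<beta> * x) \<noteq> 1" by blast
  ultimately show ?thesis
    using assms(1) unfolding nontrivial_additive_character_def additive_character_def
    by (auto simp: twist_def distrib_left)
qed

end

context uniformised_field
begin

text \<open>The depth of \<open>sqrt_mat c w\<close> is \<open>ord c + 1/2\<close>. A threshold at a
  half-integer is attained, so the strict and the weak inequality differ by one in
  \<open>ord c\<close>.\<close>

lemma mat_depth_ge_iff:
  "mat_depth ord (sqrt_mat c w) \<ge> ereal (real_of_int m - 1 / 2) \<longleftrightarrow> c \<in> P (m - 1)"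
  "mat_depth ord (sqrt_mat c w) > ereal (real_of_int m - 1 / 2) \<longleftrightarrow> c \<in> P m"
proof -
  have half: "real_of_int (2 * ord c + 1) / 2 = real_of_int (ord c) + 1 / 2"
    by (simp add: add_divide_distrib)
  have "real_of_int m - 1 / 2 \<le> real_of_int (ord c) + 1 / 2 \<longleftrightarrow> real_of_int (m - 1) \<le> real_of_int (ord c)"
    by (rule iffI; linarith)
  then have "real_of_int m - 1 / 2 \<le> real_of_int (2 * ord c + 1) / 2 \<longleftrightarrow> m - 1 \<le> ord c"
    unfolding half of_int_le_iff .
  moreover have "real_of_int m - 1 / 2 < real_of_int (ord c) + 1 / 2 \<longleftrightarrow> real_of_int m < real_of_int (ord c + 1)"
    by (rule iffI; linarith)
  then have "real_of_int m - 1 / 2 < real_of_int (2 * ord c + 1) / 2 \<longleftrightarrow> m \<le> ord c"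
    unfolding half of_int_less_iff zless_add1_eq by linarith
  ultimately show
    "mat_depth ord (sqrt_mat c w) \<ge> ereal (real_of_int m - 1 / 2) \<longleftrightarrow> c \<in> P (m - 1)"
    "mat_depth ord (sqrt_mat c w) > ereal (real_of_int m - 1 / 2) \<longleftrightarrow> c \<in> P m"
    by (auto simp: mat_depth_sqrt_mat P_iff ord_mult ord_power)
qed

text \<open>In terms of coefficients the quotient is \<open>P (h - 1)\<close> modulo
  \<open>P h\<close>, a line over the residue field.\<close>

lemma lie_torus_quot_eq:
  "lie_torus_quot ord w (real_of_int h - 1 / 2) =
    (\<lambda>c. (\<lambda>d. sqrt_mat d w) ` {d. d - c \<in> P h}) ` P (h - 1)"
proof -
  let ?A = "{Z \<in> lie_torus w. mat_depth ord Z \<ge> ereal (real_of_int h - 1 / 2)}"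
  let ?B = "{Z \<in> lie_torus w. mat_depth ord Z > ereal (real_of_int h - 1 / 2)}"
  have A: "?A = (\<lambda>d. sqrt_mat d w) ` P (h - 1)"
    using mat_depth_ge_iff(1)[of h] by (auto simp: lie_torus_def)
  have B: "sqrt_mat d w \<in> ?B \<longleftrightarrow> d \<in> P h" for d
    using mat_depth_ge_iff(2)[of h] by (auto simp: lie_torus_def)
  have cls: "{(x, y). x \<in> ?A \<and> y \<in> ?A \<and> x - y \<in> ?B} `` {sqrt_mat c w} =
      (\<lambda>d. sqrt_mat d w) ` {d. d - c \<in> P h}" if c: "c \<in> P (h - 1)" for c
  proof (intro equalityI subsetI)
    fix Z assume "Z \<in> {(x, y). x \<in> ?A \<and> y \<in> ?A \<and> x - y \<in> ?B} `` {sqrt_mat c w}"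
    then obtain d where d: "Z = sqrt_mat d w" "sqrt_mat c w - sqrt_mat d w \<in> ?B" unfolding A by auto
    then have "d - c \<in> P h" unfolding sqrt_mat_diff B using P_diff_commute by blast
    then show "Z \<in> (\<lambda>d. sqrt_mat d w) ` {d. d - c \<in> P h}" using d(1) by blast
  next
    fix Z assume "Z \<in> (\<lambda>d. sqrt_mat d w) ` {d. d - c \<in> P h}"
    then obtain d where d: "Z = sqrt_mat d w" "d - c \<in> P h" by blast
    have "d \<in> P (h - 1)" using P_add[OF P_mono[OF d(2)] c] by simp
    then have "Z \<in> ?A" "sqrt_mat c w \<in> ?A" unfolding A using d c by blast+
    moreover have "sqrt_mat c w - Z \<in> ?B"
      unfolding d(1) sqrt_mat_diff B using d(2) P_diff_commute by blast
    ultimately show "Z \<in> {(x, y). x \<in> ?A \<and> y \<in> ?A \<and> x - y \<in> ?B} `` {sqrt_mat c w}" by blast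
  qed
  have "lie_torus_quot ord w (real_of_int h - 1 / 2) =
      (\<lambda>Z. {(x, y). x \<in> ?A \<and> y \<in> ?A \<and> x - y \<in> ?B} `` {Z}) ` ?A"
    unfolding lie_torus_quot_def add_quot_def quotient_def by blast
  also have "\<dots> = (\<lambda>c. (\<lambda>d. sqrt_mat d w) ` {d. d - c \<in> P h}) ` P (h - 1)"
    unfolding image_image[of _ "\<lambda>d. sqrt_mat d w" "P (h - 1)", folded A]
    by (rule image_cong[OF refl cls])
  finally show ?thesis .
qed

end

context haar_field_character
begin

lemma dual_depth_eq:
  assumes \<Psi>: "\<And>x. \<Phi> (\<beta> * x) = \<Psi> x"
  shows "dual_depth ord \<Phi> w (trace_functional \<beta> w) = 1 / 2 - real_of_int h"
  unfolding dual_depth_def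
proof (rule Greatest_equality)
  have tf: "\<Phi> (trace_functional \<beta> w (sqrt_mat c w)) = \<Psi> (2 * (c * w))" for c
    unfolding trace_functional_sqrt_mat \<Psi>[symmetric] by (simp add: mult_ac)
  have wP: "c * w \<in> P n \<longleftrightarrow> c \<in> P (n - 1)" for c n
    using P_mult_iff[of w c n] by (simp add: mult.commute)
  show "\<forall>Z\<in>lie_torus w. mat_depth ord Z > ereal (- (1 / 2 - real_of_int h)) \<longrightarrow>
      \<Phi> (trace_functional \<beta> w Z) = 1"
    using mat_depth_ge_iff(2)[of h] \<Psi>_triv by (auto simp: lie_torus_def tf wP)
  fix \<rho> assume \<rho>: "\<forall>Z\<in>lie_torus w. mat_depth ord Z > ereal (- \<rho>) \<longrightarrow> \<Phi> (trace_functional \<beta> w Z) = 1"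
  show "\<rho> \<le> 1 / 2 - real_of_int h"
  proof (rule ccontr)
    assume "\<not> \<rho> \<le> 1 / 2 - real_of_int h"
    then have less: "ereal (- \<rho>) < ereal (real_of_int h - 1 / 2)" by simp
    obtain e where e: "e \<in> P h" "\<Psi> e \<noteq> 1" using \<Psi>_nontriv by blast
    \<comment> \<open>The solution of \<open>2 * (c * w) = e\<close>: its matrix has depth at least
      \<open>h - 1/2\<close>, above \<open>- \<rho>\<close>, yet pairs to an element where
      \<open>\<Psi>\<close> is not 1.\<close>
    define c where "c = e / 2 / w"
    have "c * w = e / 2" by (simp add: c_def)
    then have "c \<in> P (h - 1)" "2 * (c * w) = e"
      unfolding wP[symmetric] using e(1) two_nonzero by (simp_all only: half_P_iff) simp
    then have "mat_depth ord (sqrt_mat c w) > ereal (- \<rho>)" "\<Phi> (trace_functional \<beta> w (sqrt_mat c w)) \<noteq> 1"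
      using less_le_trans[OF less] mat_depth_ge_iff(1)[of h c] e(2) by (simp_all add: tf)
    then show False using \<rho> by (auto simp: lie_torus_def)
  qed
qed

end

context mock_transform
begin

text \<open>The class of \<open>v\<close> in the residue field corresponds to the class of \<open>c2 v / (2 w) \<surd>w\<close>.\<close>

lemma sum_lie_torus_quot:
  assumes \<Psi>: "\<And>x. \<Phi> (\<beta> * x) = \<Psi> x"
  shows "(\<Sum>C\<in>{C \<in> lie_torus_quot ord w (real_of_int h - 1 / 2). sqrt_mat y w \<notin> C \<and> - sqrt_mat y w \<notin> C}.
      \<Phi> (trace_functional \<beta> w (coset_rep C)) *
      sgn_norm w (s\<^sup>2 * \<theta>' - scalar_of (coset_rep C ** coset_rep C))) =
    (\<Sum>v\<in>R. chi (v\<^sup>2 - 4 * \<kappa>\<^sup>2) * \<Psi> (c2 * v))"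
proof -
  define d where "d = c2 / (2 * w)"
  have d: "d \<noteq> 0" "ord d = h - 1"
    using ord_c2 two_nonzero by (simp_all add: d_def ord_divide ord_mult)
  have c2d: "c2 = 2 * (d * w)" using two_nonzero by (simp add: d_def)
  \<comment> \<open>This identifies the stable conjugate and its negative with the classes of
    \<open>2 * \<kappa>\<close> and \<open>- (2 * \<kappa>)\<close>.\<close>
  have y_d: "y = d * (2 * \<kappa>)" using c2_\<kappa> by (simp add: c2d mult_ac)
  have dP: "d * x \<in> P h \<longleftrightarrow> x \<in> P 1" for x using P_mult_iff[OF d(1), of x h] d(2) by simp
  have \<kappa>0: "\<kappa> \<in> P 0" using ord_\<kappa> by (simp add: P_iff)
  define K where "K v = (\<lambda>c. sqrt_mat c w) ` {c. c - d * v \<in> P h}" for v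
  have K_iff: "sqrt_mat (d * x) w \<in> K v \<longleftrightarrow> x \<asymp> v" for x v
    using dP[of "x - v"] by (auto simp: K_def cong1_def right_diff_distrib)
  have inj: "inj_on K R"
  proof (rule inj_onI)
    fix u v assume uv: "u \<in> R" "v \<in> R" "K u = K v"
    have "sqrt_mat (d * u) w \<in> K u" by (simp add: K_iff)
    then have "u \<asymp> v" using uv(3) K_iff by blast
    then show "u = v" using uv R_eqI by (simp add: cong1_def)
  qed
  have Q: "lie_torus_quot ord w (real_of_int h - 1 / 2) = K ` R"
  proof -
    have "(\<lambda>d. sqrt_mat d w) ` {b. b - c \<in> P h} \<in> K ` R" if c: "c \<in> P (h - 1)" for c
    proof -
      define x where "x = c / d"
      have cx: "c = d * x" using d by (simp add: x_def)
      have "x \<in> P 0" using c P_mult_iff[OF d(1), of x "h - 1"] d(2) by (simp add: cx)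
      from red[OF this] have r: "red x \<in> R" "d * x - d * red x \<in> P h"
        using dP[of "x - red x"] by (simp_all add: right_diff_distrib)
      have "b - c \<in> P h \<longleftrightarrow> b - d * red x \<in> P h" for b
        using P_add[OF _ r(2), of "b - d * x"] P_diff[OF _ r(2), of "b - d * red x"] by (auto simp: cx)
      then have "(\<lambda>d. sqrt_mat d w) ` {b. b - c \<in> P h} = K (red x)" by (simp add: K_def)
      with r show ?thesis by blast
    qed
    moreover have "d * v \<in> P (h - 1)" if "v \<in> R" for v
      using P_mult[OF P_ord R_subset[OF that], of d] d by simp
    ultimately show ?thesis unfolding lie_torus_quot_eq K_def by blast
  qed
  have "sqrt_mat y w = sqrt_mat (d * (2 * \<kappa>)) w" using y_d by (rule arg_cong)
  moreover from this have "- sqrt_mat y w = sqrt_mat (d * (- (2 * \<kappa>))) w"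
    by (simp only: sqrt_mat_uminus mult_minus_right)
  moreover have "u \<asymp> v \<longleftrightarrow> v \<asymp> u" for u v using cong1_sym by blast
  ultimately have y_K: "sqrt_mat y w \<in> K v \<longleftrightarrow> v \<asymp> 2 * \<kappa>" "- sqrt_mat y w \<in> K v \<longleftrightarrow> v \<asymp> - (2 * \<kappa>)" for v
    using K_iff by metis+
  let ?g = "\<lambda>C. \<Phi> (trace_functional \<beta> w (coset_rep C)) *
      sgn_norm w (s\<^sup>2 * \<theta>' - scalar_of (coset_rep C ** coset_rep C))"
  let ?V = "{v \<in> R. \<not> v \<asymp> 2 * \<kappa> \<and> \<not> v \<asymp> - (2 * \<kappa>)}"
  have unit: "v\<^sup>2 - 4 * \<kappa>\<^sup>2 \<in> P 0 \<and> (v\<^sup>2 - 4 * \<kappa>\<^sup>2 \<in> P 1 \<longleftrightarrow> v \<asymp> 2 * \<kappa> \<or> v \<asymp> - (2 * \<kappa>))"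
    if "v \<in> P 0" for v
  proof -
    have "v\<^sup>2 - 4 * \<kappa>\<^sup>2 = (v - 2 * \<kappa>) * (v + 2 * \<kappa>)" by (simp add: power2_eq_square algebra_simps)
    moreover have "v - 2 * \<kappa> \<in> P 0" "v + 2 * \<kappa> \<in> P 0" using that \<kappa>0 P_add P_diff by simp_all
    ultimately show ?thesis using P1_prime P0_mult by (simp add: cong1_def)
  qed
  have g: "?g (K v) = chi (v\<^sup>2 - 4 * \<kappa>\<^sup>2) * \<Psi> (c2 * v)" if v: "v \<in> ?V" for v
  proof -
    have v0: "v \<in> P 0" using v R_subset by blast
    have "sqrt_mat (d * v) w \<in> K v" by (simp add: K_iff)
    then have "coset_rep (K v) \<in> K v" unfolding coset_rep_def by (rule someI)
    then obtain c where c: "coset_rep (K v) = sqrt_mat c w" "c - d * v \<in> P h" unfolding K_def by blast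
    define x where "x = c / d"
    have cx: "c = d * x" using d by (simp add: x_def)
    have xv: "x \<asymp> v" using c(2) dP[of "x - v"] by (simp add: cx cong1_def right_diff_distrib)
    have x0: "x \<in> P 0" using cong1_P0[OF xv v0] .
    have xn: "\<not> x \<asymp> 2 * \<kappa>" "\<not> x \<asymp> - (2 * \<kappa>)"
      using v cong1_trans[OF cong1_sym[OF xv]] by blast+
    have "\<Phi> (trace_functional \<beta> w (sqrt_mat c w)) = \<Psi> (c2 * x)"
      unfolding trace_functional_sqrt_mat \<Psi>[symmetric] by (simp add: cx c2d mult_ac)
    also have "\<dots> = \<Psi> (c2 * v)"
    proof (rule \<Psi>_cong)
      have "c2 * (x - v) \<in> P (h + 1)" using xv P_mult_iff[OF ord_c2(1)] ord_c2(2) by (simp add: cong1_def)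
      then show "c2 * x - c2 * v \<in> P (h + 1)" by (simp add: right_diff_distrib)
    qed
    finally have 1: "\<Phi> (trace_functional \<beta> w (coset_rep (K v))) = \<Psi> (c2 * v)" by (simp add: c(1))
    define a where "a = (- w) powi (- (h - 1)) * d"
    have a: "a \<in> P 0" "a \<notin> P 1" using d by (simp_all add: a_def P_iff ord_mult)
    have da: "d = (- w) powi (h - 1) * a"
      unfolding a_def mult.assoc[symmetric] w_power_add[symmetric] by simp
    let ?e = "x\<^sup>2 - 4 * \<kappa>\<^sup>2"
    have e: "?e \<in> P 0" "?e \<notin> P 1" using unit[OF x0] xn by blast+
    have a2: "a\<^sup>2 \<in> P 0" "a\<^sup>2 \<notin> P 1" using a P0_power P_power2_iff by auto
    have "s\<^sup>2 * \<theta>' = (d * (2 * \<kappa>))\<^sup>2 * w"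
      using y_eq[symmetric] arg_cong[OF y_d, of "\<lambda>x. x\<^sup>2 * w"] by (rule trans)
    then have "s\<^sup>2 * \<theta>' - c\<^sup>2 * w = (d * (2 * \<kappa>))\<^sup>2 * w - c\<^sup>2 * w" by (rule arg_cong)
    also have "\<dots> = (- w) * d\<^sup>2 * ?e"
      unfolding cx by (simp add: power2_eq_square algebra_simps)
    \<comment> \<open>An odd power of \<open>- w\<close> times the square of the unit
      \<open>a\<close>, hence a norm: only \<open>chi\<close> of
      \<open>x\<^sup>2 - 4 * \<kappa>\<^sup>2\<close> survives in the sign.\<close>
    also have "(- w) * d\<^sup>2 = (- w) powi (1 + (h - 1) + (h - 1)) * a\<^sup>2"
      unfolding w_power_add da by (simp add: power2_eq_square mult_ac)
    finally have "sgn_norm w (s\<^sup>2 * \<theta>' - c\<^sup>2 * w) = sgn_norm w ((- w) powi (1 + (h - 1) + (h - 1)) * (a\<^sup>2 * ?e))"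
      by (simp only: mult.assoc)
    also have "\<dots> = chi (a\<^sup>2 * ?e)"
      using P0_mult[OF a2(1) e(1)] P1_prime[OF a2(1) e(1)] a2(2) e(2) by (intro sgn_norm_eq) auto
    also have "\<dots> = chi ?e" using a e(1) by (rule chi_square_mult)
    also have "\<dots> = chi (v\<^sup>2 - 4 * \<kappa>\<^sup>2)"
      using cong1_power2[OF xv v0] by (intro chi_cong cong1_diff) auto
    finally have 2: "sgn_norm w (s\<^sup>2 * \<theta>' - scalar_of (coset_rep (K v) ** coset_rep (K v))) = chi (v\<^sup>2 - 4 * \<kappa>\<^sup>2)"
      by (simp add: c(1) sqrt_mat_square)
    show ?thesis unfolding 1 2 by (rule mult.commute)
  qed
  have "{C \<in> lie_torus_quot ord w (real_of_int h - 1 / 2). sqrt_mat y w \<notin> C \<and> - sqrt_mat y w \<notin> C} = K ` ?V"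
    unfolding Q using y_K by blast
  moreover have "(\<Sum>C\<in>K ` ?V. ?g C) = (\<Sum>v\<in>?V. ?g (K v))"
    by (rule sum.reindex_cong[of K]) (use inj in \<open>auto intro: inj_on_subset\<close>)
  moreover have "\<dots> = (\<Sum>v\<in>?V. chi (v\<^sup>2 - 4 * \<kappa>\<^sup>2) * \<Psi> (c2 * v))"
    by (rule sum.cong[OF refl g])
  \<comment> \<open>At the two excluded classes \<open>chi\<close> vanishes, so they may be put back
    into the sum.\<close>
  moreover have "\<dots> = (\<Sum>v\<in>R. chi (v\<^sup>2 - 4 * \<kappa>\<^sup>2) * \<Psi> (c2 * v))"
    using unit R_subset by (intro sum.mono_neutral_left) (auto simp: chi_def)
  ultimately show ?thesis by (simp only:)
qed

end

theorem theorem10p5: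
  fixes ord :: "'a::field \<Rightarrow> int" and \<mu> :: "'a measure" and \<Phi> :: "'a \<Rightarrow> complex"
    and w \<beta> s \<theta>' :: 'a and Yt :: "'a^2^2"
  defines "q \<equiv> real (residue_card ord)"
    and "Xs \<equiv> trace_functional \<beta> w"
    and "Y \<equiv> sqrt_mat s \<theta>'"
    and "r \<equiv> - dual_depth ord \<Phi> w (trace_functional \<beta> w)"
    and "h \<equiv> char_depth ord (twist \<Phi> \<beta>)"
  assumes "nonarch_local_field_odd ord"
    and "normalised_haar ord \<mu>"
    and "nontrivial_additive_character ord \<Phi>"
    and "uniformiser ord w"
    and "\<beta> \<noteq> 0" and "s \<noteq> 0" and "\<theta>' \<noteq> 0"
    and "ereal (dual_depth ord \<Phi> w Xs) + mat_depth ord Y = 0"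
    and "stably_conjugate Y Yt" and "Yt \<in> lie_torus w"
  shows "mock_fourier_transform ord \<mu> \<Phi> w \<beta> s \<theta>' =
    1 / 2 * complex_of_real (q powi (- (h + 1)) * abs_val ord (discr Y) powr (-1/2)) *
    (gamma_const ord \<Phi> w \<beta> s * (\<Sum>\<sigma>\<in>carrier (weyl_group w). \<Phi> (weyl_pairing \<beta> w \<sigma> Yt)) +
     complex_of_real (q powr (-1/2)) *
       (\<Sum>C\<in>{C \<in> lie_torus_quot ord w r. Yt \<notin> C \<and> - Yt \<notin> C}.
          \<Phi> (Xs (coset_rep C)) *
          sgn_norm w (scalar_of (Y ** Y) - scalar_of (coset_rep C ** coset_rep C))))"
proof -
  interpret nonarch_local_field_odd ord by fact
  let ?\<Psi> = "twist \<Phi> \<beta>"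
  have \<Psi>: "nontrivial_additive_character ord ?\<Psi>"
    using assms(8,10) by (rule nontrivial_additive_character_twist)
  interpret haar_field_character ord w \<mu> ?\<Psi> h
  proof unfold_locales
    show "uniformiser ord w" "normalised_haar ord \<mu>" by fact+
    show "?\<Psi> (x + y) = ?\<Psi> x * ?\<Psi> y" "cmod (?\<Psi> x) = 1" for x y
      using \<Psi> by (auto simp: nontrivial_additive_character_def additive_character_def)
    show "x \<in> P (h + 1) \<Longrightarrow> ?\<Psi> x = 1" "\<exists>x\<in>P h. ?\<Psi> x \<noteq> 1" for x
      using char_depth_nontrivial[OF \<Psi>] unfolding h_def by auto
  qed
  have tw: "\<Phi> (\<beta> * x) = ?\<Psi> x" for x by (simp add: twist_def)
  have depth: "dual_depth ord \<Phi> w (trace_functional \<beta> w) = 1 / 2 - real_of_int h"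
    using tw by (rule dual_depth_eq)
  have r: "r = real_of_int h - 1 / 2" by (simp add: r_def depth)
  obtain y where Yt: "Yt = sqrt_mat y w" using assms(15) by (auto simp: lie_torus_def)
  have y_eq: "y\<^sup>2 * w = s\<^sup>2 * \<theta>'"
    using assms(14) unfolding Y_def Yt by (rule stably_conjugate_sqrt_mat)
  then have "y \<noteq> 0" using \<open>s \<noteq> 0\<close> \<open>\<theta>' \<noteq> 0\<close> by auto
  have "1 / 2 - real_of_int h + real_of_int (ord (s\<^sup>2 * \<theta>')) / 2 = 0"
    using assms(13) \<open>s \<noteq> 0\<close> by (simp add: Xs_def Y_def depth mat_depth_sqrt_mat zero_ereal_def)
  then have ord_Y: "ord (s\<^sup>2 * \<theta>') = 2 * h - 1" by linarith
  then have ord_y: "ord y = h - 1"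
    using \<open>y \<noteq> 0\<close> by (simp add: y_eq[symmetric] ord_mult ord_power)
  interpret mock_transform ord w \<mu> ?\<Psi> h s \<theta>' y
    by unfold_locales (fact \<open>s \<noteq> 0\<close> \<open>y \<noteq> 0\<close> ord_y y_eq)+
  \<comment> \<open>As \<open>discr Y\<close> has order \<open>2 * h - 1\<close>, the exponents add
    up to \<open>- (h + 1) + (h - 1/2) - 1/2 = - 2\<close>.\<close>
  have "complex_of_real (q powi (- (h + 1)) * abs_val ord (discr Y) powr (-1/2)) * complex_of_real (q powr (-1/2)) =
      complex_of_real (q powi (- 2))"
  proof -
    have q: "q > 0" using residue_card_pos by (simp add: q_def)
    have four: "ord 4 = 0" "(4::'a) \<noteq> 0"
      using ord_mult[OF two_nonzero two_nonzero] no_zero_divisors[OF two_nonzero two_nonzero] by simp_all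
    then have "ord (discr Y) = 2 * h - 1" "discr Y \<noteq> 0"
      using \<open>s \<noteq> 0\<close> \<open>\<theta>' \<noteq> 0\<close> ord_Y unfolding Y_def discr_sqrt_mat by (simp_all add: ord_mult)
    then have "abs_val ord (discr Y) = q powi (- (2 * h - 1))"
      by (simp add: abs_val_def q_def)
    also have "\<dots> = q powr real_of_int (- (2 * h - 1))"
      using q by (intro powr_real_of_int'[symmetric]) auto
    finally have "abs_val ord (discr Y) = q powr real_of_int (- (2 * h - 1))" .
    moreover have "q powi (- (h + 1)) = q powr real_of_int (- (h + 1))"
      using q by (intro powr_real_of_int'[symmetric]) auto
    ultimately have "q powi (- (h + 1)) * abs_val ord (discr Y) powr (-1/2) * q powr (-1/2) =
        q powr (real_of_int (- (h + 1)) + real_of_int (- (2 * h - 1)) * (-1/2) + (-1/2))"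
      by (simp only: powr_powr powr_add)
    also have "real_of_int (- (h + 1)) + real_of_int (- (2 * h - 1)) * (-1/2) + (-1/2) = real_of_int (- 2)"
      by (simp add: field_simps)
    also have "q powr real_of_int (- 2) = q powi (- 2)" using q by (intro powr_real_of_int') auto
    finally show ?thesis by (metis of_real_mult)
  qed
  moreover have "gauss_sum ord w ?\<Psi> = complex_of_real (q powr (-1/2)) * (\<Sum>z\<in>R. ?\<Psi> ((- w) powi h * z\<^sup>2))"
    unfolding gauss_sum_def sum_residue_field[of "\<lambda>u. ?\<Psi> ((- w) powi char_depth ord ?\<Psi> * u\<^sup>2)"]
    by (simp add: q_def h_def)
  moreover have "(\<Sum>\<sigma>\<in>carrier (weyl_group w). \<Phi> (weyl_pairing \<beta> w \<sigma> Yt)) =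
      ?\<Psi> (2 * (y * w)) + ?\<Psi> (- (2 * (y * w)))"
    unfolding Yt sum_weyl_group[OF w_nonzero two_nonzero] tw[symmetric] by (simp add: mult_ac)
  moreover have "(\<Sum>C\<in>{C \<in> lie_torus_quot ord w r. Yt \<notin> C \<and> - Yt \<notin> C}. \<Phi> (Xs (coset_rep C)) *
          sgn_norm w (scalar_of (Y ** Y) - scalar_of (coset_rep C ** coset_rep C))) =
      (\<Sum>v\<in>R. chi (v\<^sup>2 - 4 * \<kappa>\<^sup>2) * ?\<Psi> (c2 * v))"
    using sum_lie_torus_quot[of \<Phi> \<beta>, OF tw] by (simp only: Xs_def Y_def Yt r sqrt_mat_square scalar_of_mat)
  \<comment> \<open>Here \<open>b\<close> is \<open>q powr (-1/2)\<close>: it stands explicitly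
    before the sum over \<open>Z\<close> and is hidden in the normalisation of the Gauss sum in the
    other term, so one common factor \<open>a * b\<close> can be taken out.\<close>
  moreover have "m / 2 * (K + E * (g * G)) = 1 / 2 * a * (g * (b * G) * E + b * K)"
    if "a * b = m" for a b m K E g G :: complex
    using that by (auto simp: algebra_simps)
  ultimately show ?thesis
    unfolding mock_fourier_value[of \<Phi> \<beta>, OF tw] gamma_const_def q_def[symmetric] by simp
qed

end
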